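(* For each $N\ge 1$ let $A$ be an $N\times N$ matrix from the complex Ginibre ensemble and let $r_{min}^{(N)}(A)$ be the minimum of the moduli of its eigenvalues. In the limit $N\to\infty$, the left tail of the distribution of $r_{min}^{(N)}(A)$ is the Rayleigh distribution with parameter $\sigma=\frac{1}{\sqrt2}$, in the following precise sense: for $0<r\ll 1$ (i.e. as $r\to 0^+$), $$\lim_{N\to+\infty}P\left(r_{min}^{(N)}(A)<r\right)=1-e^{-r^{2}}\left(1-O\left(r^{4}\right)\right).$$
   Context: The complex Ginibre ensemble is the set of $N\times N$ complex matrices whose entries are i.i.d. standard complex Gaussians with density $\frac1\pi e^{-|w|^2}$ on $\mathbb C$. The joint density of the eigenvalues $z_1,\dots,z_N$ (with respect to Lebesgue measure on $\mathbb C^N$) is $\frac{1}{N!\,\pi^N\prod_{k=0}^{N-1}k!}\exp\left(-\sum_{k}|z_k|^2\right)\prod_{i<j}|z_i-z_j|^2$. The minimum modulus is $r_{min}^{(N)}(A)=\min_k|z_k|$. The Rayleigh distribution with parameter $\sigma$ has cumulative distribution function $1-e^{-r^2/(2\sigma^2)}$ for $r\ge 0$. *)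

theory Defs
  imports "HOL-Probability.Probability" "Jordan_Normal_Form.Spectral_Radius"
begin

definition complex_gaussian_density :: "complex \<Rightarrow> real" where
  "complex_gaussian_density w = exp (- (cmod w)\<^sup>2) / pi"

definition ginibre_matrix :: "'a measure \<Rightarrow> nat \<Rightarrow> ('a \<Rightarrow> complex mat) \<Rightarrow> bool" where
  "ginibre_matrix M N A \<longleftrightarrow>
     prob_space M \<and>
     (\<forall>\<omega>\<in>space M. A \<omega> \<in> carrier_mat N N) \<and>
     prob_space.indep_vars M (\<lambda>_. borel) (\<lambda>ij \<omega>. A \<omega> $$ ij) ({..<N} \<times> {..<N}) \<and>
     (\<forall>i<N. \<forall>j<N.
        distributed M lborel (\<lambda>\<omega>. A \<omega> $$ (i, j)) (\<lambda>w. ennreal (complex_gaussian_density w)))"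

text \<open>
  The spectrum of an \<open>N \<times> N\<close> complex matrix is finite, and it is nonempty exactly when
  \<open>N \<ge> 1\<close>, so the minimum is meaningful only in that case.
\<close>

definition min_modulus :: "complex mat \<Rightarrow> real" where
  "min_modulus A = Min (cmod ` spectrum A)"

end

(*
  The eigenvalues are handled by deflation. Write an (n+1) x (n+1) matrix as D bordered by a row b, a
  column c and a corner entry a. For fixed D, b, c, a number x outside the spectrum of D is an
  eigenvalue of the bordered matrix iff a = h(x), where h is a quotient of two characteristic
  polynomials, and h takes every value at most n+1 times. Hence the push-forward of |h'|^2 dx under h
  is at most (n+1) da. On the other hand the linear substitution c = (x - D) u turns (D, b, c, h(x))
  into a matrix with eigenvector (u, 1) and eigenvalue x, similar to a block triangular one with
  diagonal blocks B and x, and |h'(x)| |det (x - D)| = |det (x - B)|. A Gaussian computation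
  integrates out u and b, so that the left-hand side is a constant times the integral of
  exp (-|x|^2) |det (x - B)|^2 over x and an n x n Gaussian matrix B. Comparing total masses shows
  that the inequality is an equality, and induction on n yields the Ginibre density for the law of
  the characteristic polynomial.

  For radial test functions the Leibniz expansion of the Vandermonde determinant makes the density
  factorise: the probability that no eigenvalue has modulus below r is the product over k < N of the
  probabilities that a Gamma(k+1) variable is at least r^2. The first factor is exp (-r^2), and the
  other ones differ from 1 by at most r^(2k+2) / k!.
*)

theory Submission
  imports Defs "HOL-Complex_Analysis.Complex_Analysis"
begin

section \<open>Area inequality for holomorphic functions\<close>

text \<open>Only one variable is changed nonlinearly: for fixed D, b, c the corner is a rational
  function of x, and all other substitutions are linear maps or translations. The two determinant
  factors fit together: the area formula contributes |h'|^2, the substitution c = (x - D) u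
  contributes |det (x - D)|^2, and their product |det (x - B)|^2 is exactly the factor by which the
  squared Vandermonde product grows when x joins the eigenvalues of B.

  Everything is phrased through test functions H of the characteristic polynomial, so that
  eigenvalues never have to be enumerated measurably. Multiplicities could interfere only in the
  count of preimages under h; the bound n + 1 suffices once the total mass is known from another
  source. That source is the radial computation with g = 1, which gives the mass n! prod (pi k!) of
  the Gaussian Vandermonde weight before the density theorem is proved. The constant pi^(2n) / n!
  consists of pi^n from the integral over b and pi^n / n! from the integral of 1 / (1 + |u|^2)^(n+1)
  over u.\<close>

definition to_vec2 :: "complex \<Rightarrow> real ^ 2" where
  "to_vec2 z = vector [Re z, Im z]"

definition of_vec2 :: "real ^ 2 \<Rightarrow> complex" where
  "of_vec2 x = Complex (vec_nth x 1) (vec_nth x 2)"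

lemma of_vec2_inverse [simp]: "to_vec2 (of_vec2 x) = x"
  by (simp add: to_vec2_def of_vec2_def Finite_Cartesian_Product.vec_eq_iff forall_2)

lemma to_vec2_inverse [simp]: "of_vec2 (to_vec2 z) = z"
  by (simp add: to_vec2_def of_vec2_def)

lemma linear_to_vec2: "linear to_vec2"
  by (rule linearI) (simp_all add: to_vec2_def Finite_Cartesian_Product.vec_eq_iff forall_2)

lemma linear_of_vec2: "linear of_vec2"
  by (rule linearI) (simp_all add: of_vec2_def complex_eq_iff)

lemma borel_measurable_to_vec2 [measurable]: "to_vec2 \<in> borel_measurable borel"
  by (intro borel_measurable_continuous_onI linear_continuous_on linear_conv_bounded_linear[THEN iffD1] linear_to_vec2)

lemma borel_measurable_of_vec2 [measurable]: "of_vec2 \<in> borel_measurable borel"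
  by (intro borel_measurable_continuous_onI linear_continuous_on linear_conv_bounded_linear[THEN iffD1] linear_of_vec2)

text \<open>Boxes pull back to boxes with the same side lengths. The identification is needed
  because the change of variables theorem used below speaks about maps on \<open>real ^ 2\<close>
  and their Jacobian matrices.\<close>

lemma distr_lborel_to_vec2: "distr lborel borel to_vec2 = (lborel :: (real ^ 2) measure)"
proof (rule lborel_eqI[symmetric])
  fix l u :: "real ^ 2"
  assume lu: "\<And>b. b \<in> Basis \<Longrightarrow> inner l b \<le> inner u b"
  have *: "vec_nth l 1 \<le> vec_nth u 1" "vec_nth l 2 \<le> vec_nth u 2"
    using lu[of "axis 1 1"] lu[of "axis 2 1"] by (simp_all add: inner_axis)
  have "to_vec2 -` box l u = box (of_vec2 l) (of_vec2 u)"
    by (auto simp: box_def to_vec2_def of_vec2_def Basis_complex_def Basis_vec_def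
        inner_axis' inner_axis forall_2 UNIV_2)
  then show "emeasure (distr lborel borel to_vec2) (box l u) = (\<Prod>b\<in>Basis. inner (u - l) b)"
    using * by (subst emeasure_distr)
      (auto simp: emeasure_lborel_box_eq Basis_complex_def of_vec2_def Basis_vec_def
        inner_axis' inner_axis UNIV_2 axis_eq_axis inner_diff_left)
qed simp

lemma lborel_vec2_eq: "emeasure (lborel :: (real^2) measure) (to_vec2 ` S) = emeasure lborel S"
  if S: "S \<in> sets borel"
proof -
  have eq: "to_vec2 ` S = of_vec2 -` S"
    by (auto simp: image_iff) (metis of_vec2_inverse)
  have vb: "to_vec2 ` S \<in> sets borel"
    unfolding eq using measurable_sets[OF borel_measurable_of_vec2 S] by simp
  have "emeasure lborel (to_vec2 ` S) = emeasure (distr lborel borel to_vec2) (to_vec2 ` S)"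
    by (simp add: distr_lborel_to_vec2)
  also have "\<dots> = emeasure lborel (to_vec2 -` to_vec2 ` S \<inter> space lborel)"
    using vb by (subst emeasure_distr) auto
  also have "to_vec2 -` to_vec2 ` S \<inter> space lborel = S"
    by (auto simp: image_iff) (metis to_vec2_inverse)
  finally show ?thesis .
qed

lemma nn_integral_vec2:
  assumes f: "f \<in> borel_measurable borel"
  shows "(\<integral>\<^sup>+ x. f (of_vec2 x) \<partial>lborel) = (\<integral>\<^sup>+ z. f z \<partial>lborel)"
proof -
  have "(\<integral>\<^sup>+ x. f (of_vec2 x) \<partial>lborel) = (\<integral>\<^sup>+ x. f (of_vec2 x) \<partial>distr lborel borel to_vec2)"
    by (simp add: distr_lborel_to_vec2)
  also have "\<dots> = (\<integral>\<^sup>+ z. f z \<partial>lborel)"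
    using f by (subst nn_integral_distr) auto
  finally show ?thesis .
qed

text \<open>Multiplication by \<open>h' z\<close>, read as a real 2 x 2 matrix, has determinant |h'
  z|^2, so this is the real change of variables formula. Stating only an inequality disposes of
  images of infinite measure at once.\<close>

lemma nn_integral_deriv_square_le_emeasure_image:
  fixes h h' :: "complex \<Rightarrow> complex"
  assumes S: "S \<in> sets borel" and hS: "h ` S \<in> sets borel"
    and der: "\<And>z. z \<in> S \<Longrightarrow> (h has_field_derivative h' z) (at z)"
    and inj: "inj_on h S" and h': "h' \<in> borel_measurable borel"
  shows "(\<integral>\<^sup>+ z. ennreal ((cmod (h' z))\<^sup>2) * indicator S z \<partial>lborel) \<le> emeasure lborel (h ` S)"
proof (cases "emeasure lborel (h ` S) = \<infinity>")
  case False
  define T where "T = to_vec2 ` S"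
  define g where "g = to_vec2 \<circ> h \<circ> of_vec2"
  define g' where "g' x v = to_vec2 (h' (of_vec2 x) * of_vec2 v)" for x v
  have Teq: "T = of_vec2 -` S"
    by (auto simp: T_def image_iff) (metis of_vec2_inverse)
  have Tb: "T \<in> sets borel"
    unfolding Teq using measurable_sets[OF borel_measurable_of_vec2 S] by simp
  then have T: "T \<in> sets lebesgue" by simp
  have gT: "g ` T = to_vec2 ` (h ` S)"
    by (auto simp: g_def T_def image_iff)
  have dg: "(g has_derivative g' x) (at x within T)" if "x \<in> T" for x
  proof -
    have "(h has_derivative (*) (h' (of_vec2 x))) (at (of_vec2 x))"
      using der[of "of_vec2 x"] that by (simp add: Teq has_field_derivative_def)
    from has_derivative_compose[of of_vec2 of_vec2 x T h "(*) (h' (of_vec2 x))", OF _ this]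
    have "((\<lambda>x. h (of_vec2 x)) has_derivative (\<lambda>v. h' (of_vec2 x) * of_vec2 v)) (at x within T)"
      using linear_of_vec2 by (simp add: linear_imp_has_derivative)
    from has_derivative_compose[OF this, of to_vec2 to_vec2]
    show ?thesis
      using linear_imp_has_derivative[OF linear_to_vec2]
      by (simp add: g_def g'_def[abs_def] o_def)
  qed
  have injg: "inj_on g T"
    using inj by (auto simp: g_def T_def inj_on_def) (metis to_vec2_inverse)
  have det: "\<bar>Determinants.det (matrix (g' x))\<bar> = (cmod (h' (of_vec2 x)))\<^sup>2" for x
  proof -
    have "Determinants.det (matrix (g' x)) = Re (h' (of_vec2 x)) * Re (h' (of_vec2 x))
        + Im (h' (of_vec2 x)) * Im (h' (of_vec2 x))"
      by (simp add: det_2 matrix_def g'_def to_vec2_def of_vec2_def axis_def)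
    then show ?thesis by (simp add: cmod_power2 flip: power2_eq_square)
  qed
  have e: "emeasure lborel (g ` T) = emeasure lborel (h ` S)"
    unfolding gT using hS by (rule lborel_vec2_eq)
  have gTb: "g ` T \<in> sets borel"
  proof -
    have "to_vec2 ` (h ` S) = of_vec2 -` (h ` S)"
      by (auto simp: image_iff) (metis of_vec2_inverse)
    then show ?thesis unfolding gT using measurable_sets[OF borel_measurable_of_vec2 hS] by simp
  qed
  have lm: "g ` T \<in> lmeasurable"
    using e False gTb by (auto simp: fmeasurable_def less_top)
  define m where "m = measure lebesgue (g ` T)"
  have hi: "((\<lambda>x. \<bar>Determinants.det (matrix (g' x))\<bar>) has_integral m) T"
    using has_measure_differentiable_image[OF T dg injg, of m] lm by (simp add: m_def)
  have mb: "(\<lambda>x. (cmod (h' (of_vec2 x)))\<^sup>2) \<in> borel_measurable borel"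
    using h' by measurable
  have "(\<integral>\<^sup>+ z. ennreal ((cmod (h' z))\<^sup>2) * indicator S z \<partial>lborel)
      = (\<integral>\<^sup>+ x. ennreal ((cmod (h' (of_vec2 x)))\<^sup>2) * indicator S (of_vec2 x) \<partial>lborel)"
    using h' S by (subst nn_integral_vec2) auto
  also have "\<dots> = (\<integral>\<^sup>+ x. ennreal ((cmod (h' (of_vec2 x)))\<^sup>2 * indicator T x) \<partial>lborel)"
    by (intro nn_integral_cong) (auto simp: Teq indicator_def)
  also have "\<dots> = ennreal m"
  proof (rule nn_integral_has_integral_lborel)
    show "(\<lambda>x. (cmod (h' (of_vec2 x)))\<^sup>2 * indicator T x) \<in> borel_measurable borel"
      using mb Tb by measurable
    have "((\<lambda>x. if x \<in> T then (cmod (h' (of_vec2 x)))\<^sup>2 else 0) has_integral m) UNIV"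
      using hi unfolding det by (simp add: has_integral_restrict_UNIV)
    then show "((\<lambda>x. (cmod (h' (of_vec2 x)))\<^sup>2 * indicator T x) has_integral m) UNIV"
      by (rule has_integral_eq[rotated]) (auto simp: indicator_def)
  qed auto
  also have "\<dots> = emeasure lborel (g ` T)"
  proof -
    have "emeasure lborel (g ` T) = emeasure lebesgue (g ` T)" using gTb by simp
    then show ?thesis using emeasure_eq_measure2[OF lm] by (simp add: m_def)
  qed
  finally show ?thesis using e by simp
qed auto

lemma nn_integral_borel_le_measure:
  assumes s: "sets M = sets N" and le: "\<And>B. B \<in> sets M \<Longrightarrow> emeasure M B \<le> emeasure N B"
  shows "integral\<^sup>N M f \<le> integral\<^sup>N N f"
proof -
  have sf: "simple_function M g = simple_function N g" for g :: "_ \<Rightarrow> ennreal"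
    using s sets_eq_imp_space_eq[OF s] by (simp add: simple_function_def)
  have "integral\<^sup>S M g \<le> integral\<^sup>S N g" if "simple_function M g" for g :: "_ \<Rightarrow> ennreal"
    unfolding simple_integral_def sets_eq_imp_space_eq[OF s]
    using that sets_eq_imp_space_eq[OF s]
    by (intro sum_mono mult_left_mono le) (auto simp: simple_function_def)
  then show ?thesis
    unfolding nn_integral_def sf[symmetric]
    by (intro SUP_mono) auto
qed

text \<open>Away from critical points \<open>h\<close> is locally injective, and critical points
  carry weight 0. Countably many balls of injectivity cover the rest; made disjoint, each piece
  contributes at most the measure of its image, and no point lies in more than \<open>N\<close> of
  these images.\<close>

theorem nn_integral_area_le:
  fixes h h' :: "complex \<Rightarrow> complex"
  assumes U: "open U" and der: "\<And>z. z \<in> U \<Longrightarrow> (h has_field_derivative h' z) (at z)"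
    and h': "h' \<in> borel_measurable borel" and h: "h \<in> borel_measurable borel"
    and fin: "\<And>a. finite {z\<in>U. h z = a}" and card: "\<And>a. card {z\<in>U. h z = a} \<le> N"
    and \<psi>: "\<psi> \<in> borel_measurable borel"
  shows "(\<integral>\<^sup>+ z. ennreal ((cmod (h' z))\<^sup>2) * indicator U z * \<psi> (h z) \<partial>lborel)
    \<le> of_nat N * (\<integral>\<^sup>+ a. \<psi> a \<partial>lborel)"
proof -
  have hol: "h holomorphic_on U"
    using der U by (auto simp: holomorphic_on_open)
  have dh: "deriv h z = h' z" if "z \<in> U" for z
    using der[OF that] by (rule DERIV_imp_deriv)
  define W where "W = {z\<in>U. h' z \<noteq> 0}"
  have "\<exists>r>0. ball z r \<subseteq> U \<and> inj_on h (ball z r)" if "z \<in> W" for z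
  proof -
    have "z \<in> U" "deriv h z \<noteq> 0" using that dh by (auto simp: W_def)
    then obtain r where r: "r > 0" "inj_on h (ball z r)"
      using holomorphic_on_imp_differentiable_at has_complex_derivative_locally_injective[OF hol _ U]
      by (metis (no_types, lifting))
    obtain e where "e > 0" "ball z e \<subseteq> U" using U \<open>z \<in> U\<close> openE by blast
    then show ?thesis using r by (intro exI[of _ "min r e"]) (auto intro: inj_on_subset)
  qed
  then obtain r where r: "\<And>z. z \<in> W \<Longrightarrow> r z > 0 \<and> ball z (r z) \<subseteq> U \<and> inj_on h (ball z (r z))" by metis
  define F where "F = (\<lambda>z. ball z (r z)) ` W"
  obtain F' where F': "F' \<subseteq> F" "countable F'" "\<Union>F' = \<Union>F"
    using Lindelof[of F] by (auto simp: F_def)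
  have Wsub: "W \<subseteq> \<Union>F" using r by (force simp: F_def)
  define V where "V = (if F' = {} then (\<lambda>_. {}) else from_nat_into F')"
  have Vun: "(\<Union>i. V i) = \<Union>F"
    using F' range_from_nat_into[of F'] by (auto simp: V_def)
  have V: "open (V i) \<and> V i \<subseteq> U \<and> inj_on h (V i)" for i
  proof (cases "F' = {}")
    case False
    then have "V i \<in> F" using F' from_nat_into[of F' i] by (auto simp: V_def)
    then show ?thesis using r by (auto simp: F_def)
  qed (auto simp: V_def)
  define Y where "Y i = disjointed V i" for i
  have Yb: "Y i \<in> sets borel" for i
    unfolding Y_def disjointed_def using V by (intro sets.Diff sets.finite_UN) auto
  have Ysub: "Y i \<subseteq> V i" for i by (auto simp: Y_def disjointed_subset)
  have Ydisj: "disjoint_family Y" unfolding Y_def[abs_def] by (rule disjoint_family_disjointed)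
  have Yun: "(\<Union>i. Y i) = \<Union>F" unfolding Y_def[abs_def] using Vun by (simp add: UN_disjointed_eq)
  have img: "h ` X \<in> sets borel" if X: "X \<in> sets borel" "X \<subseteq> V i" for X i
  proof -
    have Vi: "open (V i)" "h holomorphic_on V i" "inj_on h (V i)"
      using V[of i] holomorphic_on_subset[OF hol] by auto
    obtain g where g: "g holomorphic_on (h ` V i)" "\<And>z. z \<in> V i \<Longrightarrow> g (h z) = z"
      using holomorphic_has_inverse[OF Vi(2,1,3)] by metis
    have oV: "open (h ` V i)" by (rule open_mapping_thm3[OF Vi(2,1,3)])
    have "h ` X = h ` V i \<inter> g -` X"
      using X g(2) by (force simp: image_iff)
    moreover have "g -` X \<inter> h ` V i \<in> sets (restrict_space borel (h ` V i))"
      using measurable_sets[OF borel_measurable_continuous_on_restrict[OF holomorphic_on_imp_continuous_on[OF g(1)]] X(1)]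
      by (simp add: space_restrict_space)
    ultimately show ?thesis
      using oV by (auto simp: sets_restrict_space_iff Int_commute)
  qed
  define w where "w z = ennreal ((cmod (h' z))\<^sup>2) * indicator U z" for z
  have w[measurable]: "w \<in> borel_measurable borel"
    using h' borel_open[OF U] unfolding w_def by measurable
  note h[measurable] h'[measurable] \<psi>[measurable]
  define \<nu> where "\<nu> = distr (density lborel w) borel h"
  define \<mu> where "\<mu> = density lborel (\<lambda>_::complex. of_nat N :: ennreal)"
  have "emeasure \<nu> B \<le> emeasure \<mu> B" if B: "B \<in> sets borel" for B
  proof -
    have "emeasure \<nu> B = (\<integral>\<^sup>+ z. w z * indicator (h -` B) z \<partial>lborel)"
      using B measurable_sets[OF h B] by (simp add: \<nu>_def emeasure_distr emeasure_density)
    also have "\<dots> = (\<integral>\<^sup>+ z. (\<Sum>i. ennreal ((cmod (h' z))\<^sup>2) * indicator (Y i \<inter> h -` B) z) \<partial>lborel)"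
    proof (rule nn_integral_cong)
      fix z
      \<comment> \<open>Points of \<open>U\<close> missed by the cover are critical, so the weight
        vanishes there on both sides.\<close>
      have "w z = ennreal ((cmod (h' z))\<^sup>2) * indicator (\<Union>i. Y i) z"
      proof (cases "z \<in> \<Union>F")
        case True
        then obtain x where "x \<in> W" "z \<in> ball x (r x)" by (auto simp: F_def)
        then have "z \<in> U" using r[of x] by blast
        then show ?thesis using True by (simp add: w_def Yun)
      next
        case False
        then have "z \<notin> W" using Wsub by blast
        then show ?thesis using False by (auto simp: w_def W_def Yun indicator_def)
      qed
      also have "indicator (\<Union>i. Y i) z = (\<Sum>i. indicator (Y i) z :: ennreal)"
        using suminf_indicator[OF Ydisj, of z] by simp
      finally show "w z * indicator (h -` B) z = (\<Sum>i. ennreal ((cmod (h' z))\<^sup>2) * indicator (Y i \<inter> h -` B) z)"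
        by (simp add: indicator_inter_arith flip: ennreal_suminf_cmult ennreal_suminf_multc mult.assoc)
    qed
    also have "\<dots> = (\<Sum>i. \<integral>\<^sup>+ z. ennreal ((cmod (h' z))\<^sup>2) * indicator (Y i \<inter> h -` B) z \<partial>lborel)"
      using Yb B measurable_sets[OF h B] by (intro nn_integral_suminf) auto
    also have "\<dots> \<le> (\<Sum>i. emeasure lborel (h ` (Y i \<inter> h -` B)))"
    proof (rule suminf_le)
      fix i
      have b: "Y i \<inter> h -` B \<in> sets borel" using Yb measurable_sets[OF h B] by simp
      show "(\<integral>\<^sup>+ z. ennreal ((cmod (h' z))\<^sup>2) * indicator (Y i \<inter> h -` B) z \<partial>lborel) \<le> emeasure lborel (h ` (Y i \<inter> h -` B))"
        using b V[of i] Ysub[of i]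
        by (intro nn_integral_deriv_square_le_emeasure_image der img[of _ i] h') (auto intro: inj_on_subset)
    qed auto
    also have "\<dots> = (\<Sum>i. \<integral>\<^sup>+ a. indicator (h ` (Y i \<inter> h -` B)) a \<partial>lborel)"
      using Yb B Ysub measurable_sets[OF h B]
      by (subst nn_integral_indicator) (auto intro!: img)
    also have "\<dots> = (\<integral>\<^sup>+ a. (\<Sum>i. indicator (h ` (Y i \<inter> h -` B)) a) \<partial>lborel)"
      using Yb B Ysub measurable_sets[OF h B]
      by (intro nn_integral_suminf[symmetric] borel_measurable_indicator) (auto intro!: img)
    also have "\<dots> \<le> (\<integral>\<^sup>+ a. of_nat N * indicator B a \<partial>lborel)"
    proof (rule nn_integral_mono)
      fix a
      show "(\<Sum>i. indicator (h ` (Y i \<inter> h -` B)) a) \<le> (of_nat N * indicator B a :: ennreal)"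
      proof (cases "a \<in> B")
        case True
        define I where "I = {i. a \<in> h ` (Y i \<inter> h -` B)}"
        \<comment> \<open>One preimage of \<open>a\<close> is chosen in every piece that hits it;
          since the pieces are disjoint, these preimages are distinct, and their number is at most
          \<open>N\<close>.\<close>
        define pre where "pre i = (SOME z. z \<in> Y i \<and> h z = a)" for i
        have pre: "pre i \<in> Y i \<and> h (pre i) = a" if "i \<in> I" for i
        proof -
          have "\<exists>z. z \<in> Y i \<and> h z = a" using that by (auto simp: I_def)
          from someI_ex[OF this] show ?thesis by (simp add: pre_def)
        qed
        have inj: "inj_on pre I"
          using pre Ydisj by (auto simp: inj_on_def disjoint_family_on_def) (metis IntI empty_iff)
        have sub: "pre ` I \<subseteq> {z\<in>U. h z = a}" using pre Ysub V by blast
        have finI: "finite I" using finite_subset[OF sub fin] inj by (rule finite_imageD)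
        have "card I \<le> N" using card_image[OF inj] card_mono[OF fin sub] card[of a] by simp
        have "(\<Sum>i. indicator (h ` (Y i \<inter> h -` B)) a) = (\<Sum>i\<in>I. indicator (h ` (Y i \<inter> h -` B)) a :: ennreal)"
          using finI by (intro suminf_finite) (auto simp: I_def)
        also have "\<dots> = of_nat (card I)" by (simp add: I_def)
        finally show ?thesis using \<open>card I \<le> N\<close> True by simp
      next
        case False
        then have "indicator (h ` (Y i \<inter> h -` B)) a = (0::ennreal)" for i by (auto simp: indicator_def)
        then show ?thesis by simp
      qed
    qed
    also have "\<dots> = emeasure \<mu> B" using B by (simp add: \<mu>_def emeasure_density)
    finally show ?thesis .
  qed
  then have "integral\<^sup>N \<nu> \<psi> \<le> integral\<^sup>N \<mu> \<psi>"
    by (intro nn_integral_borel_le_measure) (auto simp: \<nu>_def \<mu>_def)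
  then show ?thesis
    unfolding \<nu>_def \<mu>_def w_def[symmetric]
    by (simp add: nn_integral_distr nn_integral_density nn_integral_cmult)
qed

section \<open>Linear changes of variables in complex coordinate space\<close>

text \<open>The area inequality with one preimage, applied to the map and to its inverse, gives both
  directions.\<close>

lemma nn_integral_complex_affine:
  fixes c d :: complex
  assumes c: "c \<noteq> 0" and f[measurable]: "f \<in> borel_measurable borel"
  shows "ennreal ((cmod c)\<^sup>2) * (\<integral>\<^sup>+ z. f (c * z + d) \<partial>lborel) = (\<integral>\<^sup>+ z. f z \<partial>lborel)"
proof -
  have *: "ennreal ((cmod c)\<^sup>2) * (\<integral>\<^sup>+ z. f (c * z + d) \<partial>lborel) \<le> (\<integral>\<^sup>+ z. f z \<partial>lborel)"
    if c: "c \<noteq> 0" and [measurable]: "f \<in> borel_measurable borel" for c d :: complex and f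
  proof -
    have eq: "{z \<in> UNIV. c * z + d = a} = {(a - d) / c}" for a
      using c by (auto simp: field_simps)
    have "(\<integral>\<^sup>+ z. ennreal ((cmod c)\<^sup>2) * indicator UNIV z * f (c * z + d) \<partial>lborel) \<le> of_nat 1 * (\<integral>\<^sup>+ z. f z \<partial>lborel)"
      by (rule nn_integral_area_le[where h' = "\<lambda>_. c"]) (unfold eq, auto intro!: derivative_eq_intros)
    then show ?thesis by (simp add: nn_integral_cmult)
  qed
  have "ennreal ((cmod (1 / c))\<^sup>2) * (\<integral>\<^sup>+ z. f (c * (1 / c * z + - d / c) + d) \<partial>lborel) \<le> (\<integral>\<^sup>+ z. f (c * z + d) \<partial>lborel)"
    using c by (intro *[where f = "\<lambda>z. f (c * z + d)"]) auto
  also have "(\<lambda>z. f (c * (1 / c * z + - d / c) + d)) = f"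
    using c by (auto simp: field_simps)
  finally have "ennreal ((cmod c)\<^sup>2) * (ennreal ((cmod (1 / c))\<^sup>2) * (\<integral>\<^sup>+ z. f z \<partial>lborel))
      \<le> ennreal ((cmod c)\<^sup>2) * (\<integral>\<^sup>+ z. f (c * z + d) \<partial>lborel)"
    by (intro mult_left_mono) auto
  moreover have "ennreal ((cmod c)\<^sup>2) * ennreal ((cmod (1 / c))\<^sup>2) = 1"
    using c by (simp add: norm_divide power_divide flip: ennreal_mult)
  ultimately have "(\<integral>\<^sup>+ z. f z \<partial>lborel) \<le> ennreal ((cmod c)\<^sup>2) * (\<integral>\<^sup>+ z. f (c * z + d) \<partial>lborel)"
    by (simp flip: mult.assoc)
  then show ?thesis using *[OF c f] by (intro antisym)
qed

lemma nn_integral_complex_translation: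
  fixes d :: complex
  assumes f[measurable]: "f \<in> borel_measurable borel"
  shows "(\<integral>\<^sup>+ z. f (z + d) \<partial>lborel) = (\<integral>\<^sup>+ z. f z \<partial>lborel)"
  using nn_integral_complex_affine[of 1 f d] by simp

section \<open>Lebesgue measure on complex coordinate spaces\<close>

type_synonym cvec = "nat \<Rightarrow> complex"

type_synonym cmatrix = "nat \<times> nat \<Rightarrow> complex"

abbreviation cspace :: "'i set \<Rightarrow> ('i \<Rightarrow> complex) measure" where
  "cspace I \<equiv> PiM I (\<lambda>_. lborel)"

abbreviation msp :: "nat \<Rightarrow> cmatrix measure" where
  "msp n \<equiv> cspace ({..<n} \<times> {..<n})"

abbreviation vsp :: "nat \<Rightarrow> cvec measure" where
  "vsp n \<equiv> cspace {..<n}"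

interpretation cs: product_sigma_finite "\<lambda>_. lborel :: complex measure" ..

lemma sigma_finite_cspace: "finite I \<Longrightarrow> sigma_finite_measure (cspace I)"
  by (rule cs.sigma_finite)

lemma cspace_nn_integral_insert:
  assumes "finite I" "i \<notin> I" "f \<in> borel_measurable (cspace (insert i I))"
  shows "(\<integral>\<^sup>+ x. f x \<partial>cspace (insert i I)) = (\<integral>\<^sup>+ x. (\<integral>\<^sup>+ y. f (x(i := y)) \<partial>lborel) \<partial>cspace I)"
  using assms by (rule cs.product_nn_integral_insert)

lemma nn_integral_swap:
  assumes "sigma_finite_measure M" "sigma_finite_measure N" "case_prod f \<in> borel_measurable (M \<Otimes>\<^sub>M N)"
  shows "(\<integral>\<^sup>+ x. (\<integral>\<^sup>+ y. f x y \<partial>N) \<partial>M) = (\<integral>\<^sup>+ y. (\<integral>\<^sup>+ x. f x y \<partial>M) \<partial>N)"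
proof -
  interpret M: sigma_finite_measure M by fact
  interpret N: sigma_finite_measure N by fact
  interpret pair_sigma_finite M N ..
  show ?thesis using Fubini'[OF assms(3)] by simp
qed

lemma cspace_translation:
  assumes "finite I" "f \<in> borel_measurable (cspace I)"
  shows "(\<integral>\<^sup>+ x. f (\<lambda>i\<in>I. x i + t i) \<partial>cspace I) = (\<integral>\<^sup>+ x. f x \<partial>cspace I)"
  using assms
proof (induction I arbitrary: f)
  case (insert i I)
  note [measurable] = insert.prems
  interpret I: sigma_finite_measure "cspace I" using insert by (intro sigma_finite_cspace)
  have "(\<integral>\<^sup>+ x. f (\<lambda>j\<in>insert i I. x j + t j) \<partial>cspace (insert i I))
      = (\<integral>\<^sup>+ x. (\<integral>\<^sup>+ y. f (\<lambda>j\<in>insert i I. (x(i := y)) j + t j) \<partial>lborel) \<partial>cspace I)"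
    by (rule cspace_nn_integral_insert) (use insert in auto)
  also have "\<dots> = (\<integral>\<^sup>+ x. (\<integral>\<^sup>+ y. f ((\<lambda>j\<in>I. x j + t j)(i := y + t i)) \<partial>lborel) \<partial>cspace I)"
    using insert.hyps by (intro nn_integral_cong arg_cong[where f = f]) (auto simp: restrict_def)
  also have "\<dots> = (\<integral>\<^sup>+ x. (\<integral>\<^sup>+ y. f ((\<lambda>j\<in>I. x j + t j)(i := y)) \<partial>lborel) \<partial>cspace I)"
    by (intro nn_integral_cong nn_integral_complex_translation[where f = "\<lambda>y. f (_(i := y))"]) measurable
  also have "\<dots> = (\<integral>\<^sup>+ x. (\<integral>\<^sup>+ y. f (x(i := y)) \<partial>lborel) \<partial>cspace I)"
    by (rule insert.IH) measurable
  also have "\<dots> = (\<integral>\<^sup>+ x. f x \<partial>cspace (insert i I))"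
    by (rule cspace_nn_integral_insert[symmetric]) (use insert in auto)
  finally show ?case .
qed (simp add: PiM_empty nn_integral_count_space_finite restrict_def)

lemma cspace_reindex:
  assumes I: "finite I" and g: "bij_betw g J I" and f: "f \<in> borel_measurable (cspace J)"
  shows "(\<integral>\<^sup>+ x. f (\<lambda>j\<in>J. x (g j)) \<partial>cspace I) = (\<integral>\<^sup>+ y. f y \<partial>cspace J)"
proof -
  have J: "finite J" using g I bij_betw_finite by blast
  have gI: "g j \<in> I" if "j \<in> J" for j using g that by (auto dest: bij_betwE)
  have m: "(\<lambda>x. \<lambda>j\<in>J. x (g j)) \<in> measurable (cspace I) (cspace J)"
    by (intro measurable_restrict measurable_component_singleton gI)
  have "distr (cspace I) (cspace J) (\<lambda>x. \<lambda>j\<in>J. x (g j)) = cspace J"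
  proof (rule cs.PiM_eqI)
    fix A :: "'b \<Rightarrow> complex set" assume A: "\<And>j. j \<in> J \<Longrightarrow> A j \<in> sets lborel"
    define h where "h = the_inv_into J g"
    have h: "h (g j) = j" if "j \<in> J" for j
      using g that by (simp add: h_def the_inv_into_f_f bij_betw_def)
    have hJ: "h i \<in> J" "g (h i) = i" if "i \<in> I" for i
      using g that by (auto simp: h_def bij_betw_def f_the_inv_into_f intro: the_inv_into_into)
    have "(\<lambda>x. \<lambda>j\<in>J. x (g j)) -` Pi\<^sub>E J A \<inter> space (cspace I) = Pi\<^sub>E I (\<lambda>i. A (h i))"
    proof -
      have "(\<forall>j\<in>J. x (g j) \<in> A j) \<longleftrightarrow> (\<forall>i\<in>I. x i \<in> A (h i))" for x :: "_ \<Rightarrow> complex"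
        using gI h hJ by metis
      then show ?thesis by (auto simp: space_PiM PiE_def Pi_def restrict_def extensional_def)
    qed
    then have "emeasure (distr (cspace I) (cspace J) (\<lambda>x. \<lambda>j\<in>J. x (g j))) (Pi\<^sub>E J A)
        = emeasure (cspace I) (Pi\<^sub>E I (\<lambda>i. A (h i)))"
      using m A J by (subst emeasure_distr) (auto intro!: sets_PiM_I_finite)
    also have "\<dots> = (\<Prod>i\<in>I. emeasure lborel (A (h i)))"
      using A hJ I by (intro cs.emeasure_PiM) auto
    also have "\<dots> = (\<Prod>j\<in>J. emeasure lborel (A j))"
      by (rule prod.reindex_bij_betw[OF g, symmetric, THEN trans]) (auto intro!: prod.cong simp: h)
    finally show "emeasure (distr (cspace I) (cspace J) (\<lambda>x. \<lambda>j\<in>J. x (g j))) (Pi\<^sub>E J A) = (\<Prod>j\<in>J. emeasure lborel (A j))" .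
  qed (use J in auto)
  then have "(\<integral>\<^sup>+ y. f y \<partial>cspace J) = (\<integral>\<^sup>+ y. f y \<partial>distr (cspace I) (cspace J) (\<lambda>x. \<lambda>j\<in>J. x (g j)))"
    by simp
  also have "\<dots> = (\<integral>\<^sup>+ x. f (\<lambda>j\<in>J. x (g j)) \<partial>cspace I)"
    using m f by (simp add: nn_integral_distr)
  finally show ?thesis by simp
qed

section \<open>Gaussian elimination for determinants and integrals\<close>

abbreviation matf :: "nat \<Rightarrow> (nat \<Rightarrow> nat \<Rightarrow> complex) \<Rightarrow> complex mat" where
  "matf n m \<equiv> mat n n (\<lambda>(i, j). m i j)"

definition mulv :: "nat \<Rightarrow> (nat \<Rightarrow> nat \<Rightarrow> complex) \<Rightarrow> cvec \<Rightarrow> cvec" where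
  "mulv n m x = (\<lambda>i\<in>{..<n}. \<Sum>j<n. m i j * x j)"

lemma mulv_measurable [measurable]: "mulv n m \<in> measurable (vsp n) (vsp n)"
  unfolding mulv_def[abs_def] by measurable

lemma det_unitriangular:
  assumes "A \<in> carrier_mat n n" "upper_triangular A \<or> (\<forall>i j. i < j \<longrightarrow> j < n \<longrightarrow> A $$ (i, j) = 0)"
    and "\<And>i. i < n \<Longrightarrow> A $$ (i, i) = 1"
  shows "det A = (1 :: complex)"
proof -
  have "diag_mat A = replicate n 1"
    using assms by (intro nth_equalityI) (auto simp: diag_mat_def simp del: upt_Suc replicate_Suc)
  then show ?thesis
    using assms det_upper_triangular[of A n] det_lower_triangular[of n A] by auto
qed

text \<open>Multiplying by the unitriangular \<open>E\<close> subtracts multiples of the last column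
  and clears the last row up to its pivot. The pivot sits in the last position because
  \<open>cspace_linear\<close> integrates out the last coordinate.\<close>

lemma det_schur_step:
  assumes a: "m n n \<noteq> 0"
  shows "det (matf (Suc n) m) = m n n * det (matf n (\<lambda>i j. m i j - m i n * m n j / m n n))"
proof -
  define E where "E = mat (Suc n) (Suc n) (\<lambda>(i, j). if i = j then 1 else if i = n then - m n j / m n n else 0)"
  have dE: "det E = 1"
    by (rule det_unitriangular[of _ "Suc n"]) (auto simp: E_def)
  have "matf (Suc n) m * E = four_block_mat (matf n (\<lambda>i j. m i j - m i n * m n j / m n n))
      (mat n 1 (\<lambda>(i, j). m i n)) (0\<^sub>m 1 n) (mat 1 1 (\<lambda>_. m n n))" (is "?L = ?R")
  proof (rule eq_matI)
    fix i j assume "i < dim_row ?R" "j < dim_col ?R"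
    then have ij: "i < Suc n" "j < Suc n" by simp_all
    have "?L $$ (i, j) = (\<Sum>k<Suc n. m i k * (if k = j then 1 else if k = n then - m n j / m n n else 0))"
      using ij by (simp add: E_def scalar_prod_def row_def col_def lessThan_atLeast0)
    also have "\<dots> = (\<Sum>k<n. if k = j then m i k else 0) + (if n = j then m i n else - m i n * m n j / m n n)"
      by (simp add: if_distrib cong: if_cong)
    also have "\<dots> = ?R $$ (i, j)"
      using ij a by (cases "i = n"; cases "j = n") auto
    finally show "?L $$ (i, j) = ?R $$ (i, j)" .
  qed (auto simp: E_def)
  then have "det (matf (Suc n) m) * det E = det ?R"
    by (subst det_mult[symmetric, of _ "Suc n"]) (auto simp: E_def)
  also have "det ?R = det (matf n (\<lambda>i j. m i j - m i n * m n j / m n n)) * det (mat 1 1 (\<lambda>_. m n n))"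
    by (subst det_four_block_mat_lower_left_zero) auto
  also have "det (mat 1 1 (\<lambda>_. m n n)) = m n n"
    by (subst det_single) auto
  finally show ?thesis by (simp add: dE mult.commute)
qed

text \<open>Repairs a vanishing pivot on the side of determinants; \<open>cspace_shear\<close> is
  the matching statement for integrals.\<close>

lemma det_add_last_column:
  assumes k: "k < n"
  shows "det (matf (Suc n) (\<lambda>i j. if j = n then m i n + m i k else m i j)) = det (matf (Suc n) m)"
proof -
  define E :: "complex mat" where "E = mat (Suc n) (Suc n) (\<lambda>(i, j). if i = j \<or> (i = k \<and> j = n) then 1 else 0)"
  have dE: "det E = 1"
    using k by (intro det_unitriangular[of _ "Suc n"]) (auto simp: E_def)
  have "matf (Suc n) m * E = matf (Suc n) (\<lambda>i j. if j = n then m i n + m i k else m i j)" (is "?L = ?R")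
  proof (rule eq_matI)
    fix i j assume "i < dim_row ?R" "j < dim_col ?R"
    then have ij: "i < Suc n" "j < Suc n" by simp_all
    have "?L $$ (i, j) = (\<Sum>l<Suc n. m i l * (if l = j \<or> l = k \<and> j = n then 1 else 0))"
      using ij by (simp add: E_def scalar_prod_def row_def col_def lessThan_atLeast0)
    also have "\<dots> = (\<Sum>l\<in>{l\<in>{..<Suc n}. l = j \<or> l = k \<and> j = n}. m i l)"
      by (subst sum.inter_filter) (simp_all add: if_distrib cong: if_cong del: sum.lessThan_Suc)
    also have "{l\<in>{..<Suc n}. l = j \<or> l = k \<and> j = n} = (if j = n then {n, k} else {j})"
      using ij k by auto
    finally show "?L $$ (i, j) = ?R $$ (i, j)" using ij k by auto
  qed (auto simp: E_def)
  then have "det (matf (Suc n) m) * det E = det ?R"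
    by (subst det_mult[symmetric, of _ "Suc n"]) (auto simp: E_def)
  then show ?thesis by (simp add: dE)
qed

text \<open>With the other coordinates fixed, the shear is a translation of coordinate
  \<open>k\<close> by \<open>x n\<close>.\<close>

lemma cspace_shear:
  assumes k: "k < n" and f[measurable]: "f \<in> borel_measurable (vsp (Suc n))"
  shows "(\<integral>\<^sup>+ x. f (x(k := x k + x n)) \<partial>vsp (Suc n)) = (\<integral>\<^sup>+ x. f x \<partial>vsp (Suc n))"
proof -
  define I where "I = {..<Suc n} - {k}"
  have I: "finite I" "k \<notin> I" "{..<Suc n} = insert k I" "n \<in> I" using k by (auto simp: I_def)
  note f'[measurable] = f[unfolded I(3)]
  have m: "(\<lambda>x. x(k := x k + x n)) \<in> measurable (cspace (insert k I)) (cspace (insert k I))"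
  proof -
    have "(\<lambda>x. \<lambda>i\<in>insert k I. if i = k then x k + x n else x i) \<in> measurable (cspace (insert k I)) (cspace (insert k I))"
      using I(4) by (intro measurable_restrict) auto
    then show ?thesis
      by (rule measurable_cong[THEN iffD1, rotated]) (auto simp: space_PiM PiE_def extensional_def restrict_def)
  qed
  have "(\<integral>\<^sup>+ x. f (x(k := x k + x n)) \<partial>cspace (insert k I))
      = (\<integral>\<^sup>+ x. (\<integral>\<^sup>+ y. f ((x(k := y))(k := (x(k := y)) k + (x(k := y)) n)) \<partial>lborel) \<partial>cspace I)"
    by (rule cspace_nn_integral_insert[OF I(1,2)]) (rule measurable_compose[OF m f'])
  also have "\<dots> = (\<integral>\<^sup>+ x. (\<integral>\<^sup>+ y. f (x(k := y)) \<partial>lborel) \<partial>cspace I)"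
  proof (rule nn_integral_cong)
    fix x assume x[measurable]: "x \<in> space (cspace I)"
    have "(\<integral>\<^sup>+ y. f (x(k := y + x n)) \<partial>lborel) = (\<integral>\<^sup>+ y. f (x(k := y)) \<partial>lborel)"
      using measurable_compose[OF measurable_component_update[OF x I(2)] f']
      by (intro nn_integral_complex_translation[where f = "\<lambda>y. f (x(k := y))"]) simp
    then show "(\<integral>\<^sup>+ y. f ((x(k := y))(k := (x(k := y)) k + (x(k := y)) n)) \<partial>lborel) = (\<integral>\<^sup>+ y. f (x(k := y)) \<partial>lborel)"
      using k by simp
  qed
  also have "\<dots> = (\<integral>\<^sup>+ x. f x \<partial>cspace (insert k I))"
    by (rule cspace_nn_integral_insert[OF I(1,2) f', symmetric])
  finally show ?thesis unfolding I(3) .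
qed

text \<open>Gaussian elimination on the integral. For a nonzero pivot \<open>a\<close> the last
  coordinate is replaced by the last output \<open>w\<close>, at the cost |a|^2; what remains is the
  Schur complement acting on the first \<open>n\<close> coordinates, followed by a translation
  depending on \<open>w\<close>. The determinant enters squared because the map is complex
  linear.\<close>

theorem cspace_linear:
  assumes "det (matf n m) \<noteq> 0" and "f \<in> borel_measurable (vsp n)"
  shows "ennreal ((cmod (det (matf n m)))\<^sup>2) * (\<integral>\<^sup>+ x. f (mulv n m x) \<partial>vsp n)
    = (\<integral>\<^sup>+ x. f x \<partial>vsp n)"
  using assms
proof (induction n arbitrary: m f)
  case 0
  then show ?case
    by (simp add: PiM_empty nn_integral_count_space_finite mulv_def restrict_def)
next
  case (Suc n)
  have *: "ennreal ((cmod (det (matf (Suc n) m)))\<^sup>2) * (\<integral>\<^sup>+ x. f (mulv (Suc n) m x) \<partial>vsp (Suc n))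
    = (\<integral>\<^sup>+ x. f x \<partial>vsp (Suc n))" if a: "m n n \<noteq> 0" and d: "det (matf (Suc n) m) \<noteq> 0" for m
  proof -
    define a where "a = m n n"
    define \<beta> where "\<beta> x = (\<Sum>j<n. m n j * x j)" for x
    define m' where "m' i j = m i j - m i n * m n j / a" for i j
    have dm: "det (matf (Suc n) m) = a * det (matf n m')"
      unfolding a_def m'_def by (rule det_schur_step[of m n, OF a])
    have dm': "det (matf n m') \<noteq> 0" using dm d by auto
    note f[measurable] = Suc.prems(2)
    note f'[measurable] = f[unfolded lessThan_Suc]
    have \<beta>[measurable]: "\<beta> \<in> borel_measurable (vsp n)" unfolding \<beta>_def by measurable
    \<comment> \<open>The output vector, expressed by the first \<open>n\<close> inputs and by the
      last output \<open>w\<close> in place of the last input.\<close>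
    define G where "G x w = (\<lambda>i\<in>{..<Suc n}. if i < n then mulv n m' x i + m i n / a * w else w)" for x w
    have Geq: "G x w = (\<lambda>i\<in>{..<n}. mulv n m' x i + m i n / a * w)(n := w)" for x w
      by (auto simp: G_def restrict_def fun_eq_iff)
    have step: "mulv (Suc n) m (x(n := t)) = G x (a * t + \<beta> x)" for x t
    proof -
      have "(\<Sum>j<n. m i j * x j) + m i n * t = (\<Sum>j<n. m' i j * x j) + m i n / a * (a * t + \<beta> x)" for i
        using a by (simp add: m'_def \<beta>_def a_def sum_subtractf sum_distrib_left algebra_simps flip: sum_divide_distrib)
      note e = this
      show ?thesis
      proof (rule ext)
        fix i
        consider "i < n" | "i = n" | "i > n" by linarith
        then show "mulv (Suc n) m (x(n := t)) i = G x (a * t + \<beta> x) i"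
        proof cases
          case 1
          then show ?thesis using e[of i] by (simp add: G_def mulv_def)
        qed (simp_all add: G_def mulv_def a_def \<beta>_def)
      qed
    qed
    have Gm[measurable]: "case_prod G \<in> measurable (vsp n \<Otimes>\<^sub>M lborel) (cspace (insert n {..<n}))"
    proof -
      have [measurable]: "(\<lambda>p. mulv n m' (fst p) i) \<in> borel_measurable (vsp n \<Otimes>\<^sub>M (lborel :: complex measure))" if "i < n" for i
        using that by (intro measurable_compose[OF measurable_compose[OF measurable_fst mulv_measurable], of "\<lambda>x. x i"]) auto
      show ?thesis
        unfolding G_def[abs_def] lessThan_Suc[symmetric] case_prod_beta
      proof (intro measurable_restrict)
        fix i
        show "(\<lambda>p. if i < n then mulv n m' (fst p) i + m i n / a * snd p else snd p)
            \<in> vsp n \<Otimes>\<^sub>M lborel \<rightarrow>\<^sub>M lborel"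
          by (cases "i < n") simp_all
      qed
    qed
    have "(\<integral>\<^sup>+ x. f (mulv (Suc n) m x) \<partial>vsp (Suc n))
        = (\<integral>\<^sup>+ x. (\<integral>\<^sup>+ t. f (G x (a * t + \<beta> x)) \<partial>lborel) \<partial>vsp n)"
      unfolding lessThan_Suc
      by (subst cspace_nn_integral_insert)
        (use measurable_compose[OF mulv_measurable f] in \<open>auto simp: step lessThan_Suc\<close>)
    also have "ennreal ((cmod a)\<^sup>2) * \<dots> = (\<integral>\<^sup>+ x. (\<integral>\<^sup>+ w. f (G x w) \<partial>lborel) \<partial>vsp n)"
      using a
      by (subst nn_integral_cmult[symmetric]) (auto simp: a_def intro!: nn_integral_cong nn_integral_complex_affine)
    also have "\<dots> = (\<integral>\<^sup>+ w. (\<integral>\<^sup>+ x. f (G x w) \<partial>vsp n) \<partial>lborel)"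
      by (intro nn_integral_swap sigma_finite_cspace sigma_finite_lborel) auto
    also have "ennreal ((cmod (det (matf n m')))\<^sup>2) * \<dots> =
        (\<integral>\<^sup>+ w. (\<integral>\<^sup>+ x. f ((\<lambda>i\<in>{..<n}. x i + m i n / a * w)(n := w)) \<partial>vsp n) \<partial>lborel)"
    proof (subst nn_integral_cmult[symmetric])
      show "(\<integral>\<^sup>+ w. ennreal ((cmod (det (matf n m')))\<^sup>2) * (\<integral>\<^sup>+ x. f (G x w) \<partial>vsp n) \<partial>lborel) =
          (\<integral>\<^sup>+ w. (\<integral>\<^sup>+ x. f ((\<lambda>i\<in>{..<n}. x i + m i n / a * w)(n := w)) \<partial>vsp n) \<partial>lborel)"
        unfolding Geq by (intro nn_integral_cong Suc.IH[OF dm', where f = "\<lambda>y. f ((\<lambda>i\<in>{..<n}. y i + m i n / a * _)(n := _))"]) measurable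
    qed (use sigma_finite_cspace[of "{..<n}"] in \<open>auto intro!: sigma_finite_measure.borel_measurable_nn_integral\<close>)
    also have "\<dots> = (\<integral>\<^sup>+ w. (\<integral>\<^sup>+ x. f (x(n := w)) \<partial>vsp n) \<partial>lborel)"
      by (intro nn_integral_cong cspace_translation[where f = "\<lambda>x. f (x(n := _))"]) auto
    also have "\<dots> = (\<integral>\<^sup>+ x. (\<integral>\<^sup>+ w. f (x(n := w)) \<partial>lborel) \<partial>vsp n)"
      by (intro nn_integral_swap sigma_finite_cspace sigma_finite_lborel) auto
    also have "\<dots> = (\<integral>\<^sup>+ x. f x \<partial>vsp (Suc n))"
      unfolding lessThan_Suc by (rule cspace_nn_integral_insert[symmetric]) auto
    finally show ?thesis
      by (simp add: dm norm_mult power_mult_distrib ennreal_mult mult_ac)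
  qed
  show ?case
  proof (cases "m n n = 0")
    case True
    have "\<exists>k<n. m n k \<noteq> 0"
    proof (rule ccontr)
      assume "\<not> ?thesis"
      with True have z: "m n k = 0" if "k < Suc n" for k using that less_antisym by blast
      have "row (matf (Suc n) m) n = 0\<^sub>v (Suc n)"
        using z by (intro eq_vecI) auto
      from det_row_0[of n "Suc n", OF _ _ ] have "det (matf (Suc n) m) = 0"
        using laplace_expansion_row[of "matf (Suc n) m" "Suc n" n] z by simp
      with Suc.prems show False by simp
    qed
    then obtain k where k: "k < n" "m n k \<noteq> 0" by blast
    \<comment> \<open>Adding column \<open>k\<close> to the last column makes the pivot equal to
      \<open>m n k\<close>, which is nonzero; such a \<open>k\<close> exists since a zero last row
      would force the determinant to vanish.\<close>
    define m'' where "m'' = (\<lambda>i j. if j = n then m i n + m i k else m i j)"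
    have d: "det (matf (Suc n) m'') = det (matf (Suc n) m)"
      unfolding m''_def by (rule det_add_last_column[OF k(1)])
    have eq: "mulv (Suc n) m'' x = mulv (Suc n) m (x(k := x k + x n))" for x
    proof -
      have "(\<Sum>j<n. m i j * (if j = k then x k + x n else x j)) = (\<Sum>j<n. m i j * x j) + m i k * x n" for i
      proof -
        have "(\<Sum>j<n. m i j * (if j = k then x k + x n else x j)) = (\<Sum>j<n. m i j * x j + (if j = k then m i k * x n else 0))"
          by (intro sum.cong) (auto simp: algebra_simps)
        then show ?thesis using k by (simp add: sum.distrib)
      qed
      then show ?thesis
        using k by (auto simp: mulv_def m''_def restrict_def fun_eq_iff algebra_simps)
    qed
    have "(\<integral>\<^sup>+ x. f (mulv (Suc n) m'' x) \<partial>vsp (Suc n)) = (\<integral>\<^sup>+ x. f (mulv (Suc n) m x) \<partial>vsp (Suc n))"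
      unfolding eq by (intro cspace_shear[where f = "\<lambda>x. f (mulv (Suc n) m x)"] k(1)
          measurable_compose[OF mulv_measurable Suc.prems(2)])
    then show ?thesis
      using *[of m''] k True Suc.prems d by (simp add: m''_def)
  qed (use * Suc.prems in auto)
qed

section \<open>Characteristic polynomials of bordered matrices\<close>

lemma cspace_component: "i \<in> I \<Longrightarrow> (\<lambda>x. x i) \<in> borel_measurable (cspace I)"
  using measurable_component_singleton[of i I "\<lambda>_. lborel :: complex measure"] by simp

lemma cspace_restrictI:
  "(\<And>i. i \<in> I \<Longrightarrow> (\<lambda>x. f x i) \<in> borel_measurable N) \<Longrightarrow> (\<lambda>x. \<lambda>i\<in>I. f x i) \<in> measurable N (cspace I)"
  by (intro measurable_restrict) simp

text \<open>The set \<open>J\<close> of columns is arbitrary so that \<open>cspace_lmul\<close> can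
  proceed by adding one column at a time.\<close>

definition lmul :: "nat \<Rightarrow> nat set \<Rightarrow> (nat \<Rightarrow> nat \<Rightarrow> complex) \<Rightarrow> cmatrix \<Rightarrow> cmatrix" where
  "lmul n J m B = (\<lambda>p\<in>{..<n} \<times> J. \<Sum>k<n. m (fst p) k * B (k, snd p))"

definition rmul :: "nat \<Rightarrow> (nat \<Rightarrow> nat \<Rightarrow> complex) \<Rightarrow> cmatrix \<Rightarrow> cmatrix" where
  "rmul n m B = (\<lambda>p\<in>{..<n} \<times> {..<n}. \<Sum>k<n. B (fst p, k) * m k (snd p))"

lemma lmul_measurable [measurable]: "lmul n J m \<in> measurable (cspace ({..<n} \<times> J)) (cspace ({..<n} \<times> J))"
  unfolding lmul_def[abs_def]
  by (intro cspace_restrictI borel_measurable_sum borel_measurable_times borel_measurable_const cspace_component) auto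

lemma rmul_measurable [measurable]: "rmul n m \<in> measurable (msp n) (msp n)"
  unfolding rmul_def[abs_def]
  by (intro cspace_restrictI borel_measurable_sum borel_measurable_times borel_measurable_const cspace_component) auto

lemma cspace_linear_column:
  assumes d: "det (matf n m) \<noteq> 0" and f: "f \<in> borel_measurable (cspace ({..<n} \<times> {j}))"
  shows "ennreal ((cmod (det (matf n m)))\<^sup>2) * (\<integral>\<^sup>+ C. f (lmul n {j} m C) \<partial>cspace ({..<n} \<times> {j}))
    = (\<integral>\<^sup>+ C. f C \<partial>cspace ({..<n} \<times> {j}))"
proof -
  have bij: "bij_betw fst ({..<n} \<times> {j}) {..<n}"
    by (auto simp: bij_betw_def inj_on_def)
  have m: "(\<lambda>x. \<lambda>p\<in>{..<n} \<times> {j}. x (fst p)) \<in> measurable (vsp n) (cspace ({..<n} \<times> {j}))"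
    by (intro measurable_restrict measurable_component_singleton) auto
  have eq: "lmul n {j} m (\<lambda>p\<in>{..<n} \<times> {j}. x (fst p)) = (\<lambda>p\<in>{..<n} \<times> {j}. mulv n m x (fst p))" for x
    by (auto simp: lmul_def mulv_def restrict_def fun_eq_iff intro!: sum.cong)
  have "(\<integral>\<^sup>+ C. f (lmul n {j} m C) \<partial>cspace ({..<n} \<times> {j}))
      = (\<integral>\<^sup>+ x. f (\<lambda>p\<in>{..<n} \<times> {j}. mulv n m x (fst p)) \<partial>vsp n)"
    by (subst cspace_reindex[OF _ bij measurable_compose[OF lmul_measurable f], symmetric]) (simp_all add: eq)
  also have "ennreal ((cmod (det (matf n m)))\<^sup>2) * \<dots> = (\<integral>\<^sup>+ x. f (\<lambda>p\<in>{..<n} \<times> {j}. x (fst p)) \<partial>vsp n)"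
    by (rule cspace_linear[OF d measurable_compose[OF m f]])
  also have "\<dots> = (\<integral>\<^sup>+ C. f C \<partial>cspace ({..<n} \<times> {j}))"
    by (rule cspace_reindex[OF _ bij f]) simp
  finally show ?thesis .
qed

text \<open>Left multiplication acts on each column separately, so every column contributes one
  factor |det|^2.\<close>

lemma cspace_lmul:
  assumes "finite J" and d: "det (matf n m) \<noteq> 0" and "f \<in> borel_measurable (cspace ({..<n} \<times> J))"
  shows "ennreal ((cmod (det (matf n m)))\<^sup>2) ^ card J * (\<integral>\<^sup>+ B. f (lmul n J m B) \<partial>cspace ({..<n} \<times> J))
    = (\<integral>\<^sup>+ B. f B \<partial>cspace ({..<n} \<times> J))"
  using assms(1,3)
proof (induction J arbitrary: f)
  case empty
  then show ?case by (simp add: PiM_empty nn_integral_count_space_finite lmul_def restrict_def)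
next
  case (insert j J)
  let ?I = "{..<n} \<times> J" and ?K = "{..<n} \<times> {j}"
  let ?c = "ennreal ((cmod (det (matf n m)))\<^sup>2)"
  have IK: "?I \<inter> ?K = {}" "finite ?I" "finite ?K" using insert.hyps by auto
  have un: "{..<n} \<times> insert j J = ?I \<union> ?K" by auto
  note f = insert.prems[unfolded un]
  note mm = measurable_merge[of ?I ?K "\<lambda>_. lborel :: complex measure"]
  interpret K: sigma_finite_measure "cspace ?K" using IK by (intro sigma_finite_cspace)
  have eq: "lmul n (insert j J) m (merge ?I ?K (B, C)) = merge ?I ?K (lmul n J m B, lmul n {j} m C)" for B C
    using insert.hyps by (auto simp: lmul_def merge_def restrict_def fun_eq_iff intro!: sum.cong)
  have fm: "(\<lambda>(B, C). f (merge ?I ?K (B, C))) \<in> borel_measurable (cspace ?I \<Otimes>\<^sub>M cspace ?K)"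
    using measurable_compose[OF mm f] by (simp add: case_prod_beta')
  have fm1: "(\<lambda>C. f (merge ?I ?K (B, C))) \<in> borel_measurable (cspace ?K)" if "B \<in> space (cspace ?I)" for B
    using measurable_compose[OF measurable_Pair1'[OF that] fm] by simp
  have fm2: "(\<lambda>B. \<integral>\<^sup>+ C. f (merge ?I ?K (B, C)) \<partial>cspace ?K) \<in> borel_measurable (cspace ?I)"
    using K.borel_measurable_nn_integral[OF fm] .
  have 1: "(\<integral>\<^sup>+ B. f (lmul n (insert j J) m B) \<partial>cspace ({..<n} \<times> insert j J))
      = (\<integral>\<^sup>+ B. (\<integral>\<^sup>+ C. f (merge ?I ?K (lmul n J m B, lmul n {j} m C)) \<partial>cspace ?K) \<partial>cspace ?I)" (is "_ = ?X")
    unfolding un eq[symmetric]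
    using measurable_compose[OF lmul_measurable insert.prems]
    by (subst cs.product_nn_integral_fold[OF IK]) (simp_all add: un)
  have 2: "?c * ?X = (\<integral>\<^sup>+ B. ?c * (\<integral>\<^sup>+ C. f (merge ?I ?K (lmul n J m B, lmul n {j} m C)) \<partial>cspace ?K) \<partial>cspace ?I)"
  proof (rule nn_integral_cmult[symmetric])
    have "(\<lambda>(B, C). f (merge ?I ?K (lmul n J m B, lmul n {j} m C))) \<in> borel_measurable (cspace ?I \<Otimes>\<^sub>M cspace ?K)"
    proof -
      have "(\<lambda>(B, C). (lmul n J m B, lmul n {j} m C)) \<in> measurable (cspace ?I \<Otimes>\<^sub>M cspace ?K) (cspace ?I \<Otimes>\<^sub>M cspace ?K)"
        by measurable
      from measurable_compose[OF this fm] show ?thesis by (simp add: case_prod_beta')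
    qed
    from K.borel_measurable_nn_integral[OF this]
    show "(\<lambda>B. \<integral>\<^sup>+ C. f (merge ?I ?K (lmul n J m B, lmul n {j} m C)) \<partial>cspace ?K) \<in> borel_measurable (cspace ?I)" .
  qed
  have 3: "(\<integral>\<^sup>+ B. ?c * (\<integral>\<^sup>+ C. f (merge ?I ?K (lmul n J m B, lmul n {j} m C)) \<partial>cspace ?K) \<partial>cspace ?I) = (\<integral>\<^sup>+ B. (\<integral>\<^sup>+ C. f (merge ?I ?K (lmul n J m B, C)) \<partial>cspace ?K) \<partial>cspace ?I)" (is "_ = ?Y")
  proof (rule nn_integral_cong)
    fix B assume "B \<in> space (cspace ?I)"
    then have "lmul n J m B \<in> space (cspace ?I)" by (rule measurable_space[OF lmul_measurable])
    from cspace_linear_column[OF d fm1[OF this]]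
    show "?c * (\<integral>\<^sup>+ C. f (merge ?I ?K (lmul n J m B, lmul n {j} m C)) \<partial>cspace ?K)
      = (\<integral>\<^sup>+ C. f (merge ?I ?K (lmul n J m B, C)) \<partial>cspace ?K)" .
  qed
  have "?c ^ card J * ?Y = (\<integral>\<^sup>+ B. (\<integral>\<^sup>+ C. f (merge ?I ?K (B, C)) \<partial>cspace ?K) \<partial>cspace ?I)"
    by (rule insert.IH[OF fm2])
  also have "\<dots> = (\<integral>\<^sup>+ B. f B \<partial>cspace ({..<n} \<times> insert j J))"
    unfolding un by (rule cs.product_nn_integral_fold[OF IK f, symmetric])
  finally have 5: "?c ^ card J * ?Y = (\<integral>\<^sup>+ B. f B \<partial>cspace ({..<n} \<times> insert j J))" .
  have "?c ^ card (insert j J) * ?X = ?c ^ card J * (?c * ?X)"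
    using insert.hyps by (simp add: mult_ac)
  then show ?case unfolding 1 2 3 5 .
qed

text \<open>Transposition permutes the coordinates and turns right multiplication into left
  multiplication.\<close>

lemma cspace_rmul:
  assumes d: "det (matf n m) \<noteq> 0" and f: "f \<in> borel_measurable (msp n)"
  shows "ennreal ((cmod (det (matf n m)))\<^sup>2) ^ n * (\<integral>\<^sup>+ B. f (rmul n m B) \<partial>msp n)
    = (\<integral>\<^sup>+ B. f B \<partial>msp n)"
proof -
  let ?I = "{..<n} \<times> {..<n}"
  let ?t = "\<lambda>B. \<lambda>p\<in>?I. B (prod.swap p)"
  let ?m = "\<lambda>i j. m j i"
  have bij: "bij_betw prod.swap ?I ?I" by (auto simp: bij_betw_def)
  have dt: "det (matf n ?m) = det (matf n m)"
    by (subst det_transpose[symmetric, of _ n]) (auto intro!: arg_cong[where f = det])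
  have eq: "rmul n m (?t B) = ?t (lmul n {..<n} ?m B)" for B
    by (auto simp: rmul_def lmul_def restrict_def fun_eq_iff intro!: sum.cong)
  have t: "?t \<in> measurable (cspace ?I) (cspace ?I)"
    by (intro measurable_restrict measurable_component_singleton) auto
  have "(\<integral>\<^sup>+ B. f (rmul n m B) \<partial>cspace ?I) = (\<integral>\<^sup>+ B. f (?t (lmul n {..<n} ?m B)) \<partial>cspace ?I)"
    unfolding eq[symmetric]
    by (rule cspace_reindex[OF _ bij measurable_compose[OF rmul_measurable f], symmetric]) simp
  also have "ennreal ((cmod (det (matf n m)))\<^sup>2) ^ n * \<dots> = (\<integral>\<^sup>+ B. f (?t B) \<partial>cspace ?I)"
    using cspace_lmul[of "{..<n}" n ?m, OF _ _ measurable_compose[OF t f]] d by (simp add: dt)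
  also have "\<dots> = (\<integral>\<^sup>+ B. f B \<partial>cspace ?I)"
    by (rule cspace_reindex[OF _ bij f]) simp
  finally show ?thesis .
qed

lemma mat_lmul: "mat n n (lmul n {..<n} m B) = matf n m * mat n n B"
  by (rule eq_matI) (auto simp: lmul_def scalar_prod_def row_def col_def lessThan_atLeast0)

lemma mat_rmul: "mat n n (rmul n m B) = mat n n B * matf n m"
  by (rule eq_matI) (auto simp: rmul_def scalar_prod_def row_def col_def lessThan_atLeast0)

text \<open>The Jacobians |det P|^(2n) and |det Q|^(2n) cancel because P Q = I. Hence matrices can
  be conjugated freely under the integral.\<close>

lemma cspace_similarity:
  assumes PQ: "matf n P * matf n Q = 1\<^sub>m n" and f: "f \<in> borel_measurable (msp n)"
  shows "(\<integral>\<^sup>+ B. f (rmul n Q (lmul n {..<n} P B)) \<partial>msp n) = (\<integral>\<^sup>+ B. f B \<partial>msp n)"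
proof -
  have d: "det (matf n P) * det (matf n Q) = 1"
    using PQ by (subst det_mult[symmetric, of _ n]) auto
  then have nz: "det (matf n P) \<noteq> 0" "det (matf n Q) \<noteq> 0" by auto
  have "ennreal ((cmod (det (matf n P)))\<^sup>2) * ennreal ((cmod (det (matf n Q)))\<^sup>2) = 1"
    using d by (simp add: norm_mult flip: ennreal_mult power_mult_distrib norm_mult)
  then have one: "ennreal ((cmod (det (matf n P)))\<^sup>2) ^ n * ennreal ((cmod (det (matf n Q)))\<^sup>2) ^ n = 1"
    by (simp flip: power_mult_distrib)
  have 1: "ennreal ((cmod (det (matf n P)))\<^sup>2) ^ n * (\<integral>\<^sup>+ B. f (rmul n Q (lmul n {..<n} P B)) \<partial>msp n)
      = (\<integral>\<^sup>+ B. f (rmul n Q B) \<partial>msp n)"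
    using cspace_lmul[OF _ nz(1) measurable_compose[OF rmul_measurable f], of Q] by simp
  have "(\<integral>\<^sup>+ B. f (rmul n Q (lmul n {..<n} P B)) \<partial>msp n)
     = ennreal ((cmod (det (matf n P)))\<^sup>2) ^ n * ennreal ((cmod (det (matf n Q)))\<^sup>2) ^ n *
       (\<integral>\<^sup>+ B. f (rmul n Q (lmul n {..<n} P B)) \<partial>msp n)"
    unfolding one by simp
  also have "\<dots> = ennreal ((cmod (det (matf n Q)))\<^sup>2) ^ n * (\<integral>\<^sup>+ B. f (rmul n Q B) \<partial>msp n)"
    unfolding 1[symmetric] by (simp only: mult_ac)
  also have "\<dots> = (\<integral>\<^sup>+ B. f B \<partial>msp n)"
    by (rule cspace_rmul[OF nz(2) f])
  finally show ?thesis .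
qed

section \<open>Characteristic polynomials and bordering\<close>

abbreviation charp :: "nat \<Rightarrow> cmatrix \<Rightarrow> complex poly" where
  "charp n B \<equiv> char_poly (mat n n B)"

lemma charp_similarity:
  assumes PQ: "matf n P * matf n Q = 1\<^sub>m n"
  shows "charp n (rmul n Q (lmul n {..<n} P B)) = charp n B"
proof -
  have QP: "matf n Q * matf n P = 1\<^sub>m n"
    by (rule mat_mult_left_right_inverse[OF _ _ PQ]) auto
  show ?thesis
    by (rule char_poly_similar, rule similar_matI[of _ _ "matf n P" "matf n Q" n])
      (auto simp: mat_rmul mat_lmul PQ QP)
qed

lemma poly_charp: "poly (charp n B) x = det (matf n (\<lambda>i j. (if i = j then x else 0) - B (i, j)))"
  unfolding char_poly_def
  by (rule poly_det_cong[of _ n]) (auto simp: char_poly_matrix_def)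

lemma charp_monic: "degree (charp n B) = n" "lead_coeff (charp n B) = 1"
  using degree_monic_char_poly[of "mat n n B" n] by auto

lemma charp_nonzero: "charp n B \<noteq> 0"
  using charp_monic(2)[of n B] by auto

definition bord :: "nat \<Rightarrow> cmatrix \<Rightarrow> cvec \<Rightarrow> cvec \<Rightarrow> complex \<Rightarrow> cmatrix" where
  "bord n D b c a = (\<lambda>p\<in>{..<Suc n} \<times> {..<Suc n}.
     if fst p < n then if snd p < n then D p else c (fst p)
     else if snd p < n then b (snd p) else a)"

text \<open>Expansion along the last row: its cofactors do not see that row, hence not
  \<open>a\<close>, and the cofactor of the corner is the characteristic polynomial of
  \<open>D\<close>. So the polynomial is affine in \<open>a\<close>, and being an eigenvalue can be
  solved for the corner.\<close>

lemma charp_bord_corner: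
  "poly (charp (Suc n) (bord n D b c a)) x = poly (charp (Suc n) (bord n D b c 0)) x - a * poly (charp n D) x"
proof -
  let ?M = "\<lambda>a. matf (Suc n) (\<lambda>i j. (if i = j then x else 0) - bord n D b c a (i, j))"
  have cof: "cofactor (?M a) n j = cofactor (?M 0) n j" if "j < Suc n" for j a
  proof -
    have "mat_delete (?M a) n j = mat_delete (?M 0) n j"
      using that by (intro eq_matI) (auto simp: mat_delete_def bord_def)
    then show ?thesis by (simp add: cofactor_def)
  qed
  have "mat_delete (?M 0) n n = matf n (\<lambda>i j. (if i = j then x else 0) - D (i, j))"
    by (intro eq_matI) (auto simp: mat_delete_def bord_def)
  then have cn: "cofactor (?M 0) n n = poly (charp n D) x"
  proof -
    assume *: "mat_delete (?M 0) n n = matf n (\<lambda>i j. (if i = j then x else 0) - D (i, j))"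
    have "(-1::complex) ^ (n + n) = 1" unfolding mult_2[symmetric] by (simp add: power_mult)
    then show ?thesis unfolding cofactor_def * poly_charp[of n] by simp
  qed
  have exp: "det (?M a) = (\<Sum>j<n. ?M a $$ (n, j) * cofactor (?M 0) n j) + (x - a) * poly (charp n D) x" for a
  proof -
    have "det (?M a) = (\<Sum>j<Suc n. ?M a $$ (n, j) * cofactor (?M a) n j)"
      by (rule laplace_expansion_row) auto
    also have "\<dots> = (\<Sum>j<Suc n. ?M a $$ (n, j) * cofactor (?M 0) n j)"
      using cof[of _ a] by (intro sum.cong) auto
    also have "\<dots> = (\<Sum>j<n. ?M a $$ (n, j) * cofactor (?M 0) n j) + ?M a $$ (n, n) * cofactor (?M 0) n n"
      by simp
    also have "?M a $$ (n, n) = x - a" by (simp add: bord_def)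
    finally show ?thesis unfolding cn .
  qed
  show ?thesis
  proof -
    have "(\<Sum>j<n. ?M a $$ (n, j) * cofactor (?M 0) n j) = (\<Sum>j<n. ?M 0 $$ (n, j) * cofactor (?M 0) n j)"
      by (intro sum.cong) (auto simp: bord_def)
    then show ?thesis
      unfolding poly_charp[of "Suc n"] exp[of a] exp[of 0] by (simp only: algebra_simps mult_zero_left add_0_left)
  qed
qed

text \<open>The conditions on \<open>c\<close> and \<open>a\<close> say that (u, 1) is an
  eigenvector with eigenvalue \<open>e\<close>. Conjugation by the unitriangular matrix
  \<open>S\<close> with last column (u, 1) makes the last column of the result \<open>e\<close>
  times a unit vector, and the condition on \<open>D\<close> identifies the upper left block as
  \<open>B\<close>.\<close>

lemma charp_eigen_bord:
  assumes D: "\<And>i j. i < n \<Longrightarrow> j < n \<Longrightarrow> D (i, j) = B (i, j) + u i * b j"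
    and c: "\<And>i. i < n \<Longrightarrow> c i = e * u i - (\<Sum>j<n. D (i, j) * u j)"
    and a: "a = e - (\<Sum>j<n. b j * u j)"
  shows "charp (Suc n) (bord n D b c a) = [:-e, 1:] * charp n B"
proof -
  define S where "S = (\<lambda>p::nat \<times> nat. if fst p = snd p then 1 else if snd p = n then u (fst p) else 0)"
  define S' where "S' = (\<lambda>p::nat \<times> nat. if fst p = snd p then 1 else if snd p = n then - u (fst p) else 0)"
  define T where "T = (\<lambda>p. if fst p < n \<and> snd p < n then B p else if fst p < n then 0 else if snd p < n then b (snd p) else e)"
  let ?m = "mat (Suc n) (Suc n)"
  have SS': "?m S * ?m S' = 1\<^sub>m (Suc n)"
  proof (rule eq_matI)
    fix i j assume "i < dim_row (1\<^sub>m (Suc n))" "j < dim_col (1\<^sub>m (Suc n))"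
    then have ij: "i < Suc n" "j < Suc n" by auto
    have "(?m S * ?m S') $$ (i, j) = (\<Sum>k<n. S (i, k) * S' (k, j)) + S (i, n) * S' (n, j)"
      using ij by (simp add: scalar_prod_def row_def col_def lessThan_atLeast0)
    also have "(\<Sum>k<n. S (i, k) * S' (k, j)) = (\<Sum>k<n. if k = i then S' (i, j) else 0)"
      by (intro sum.cong) (auto simp: S_def)
    finally show "(?m S * ?m S') $$ (i, j) = 1\<^sub>m (Suc n) $$ (i, j)"
      using ij by (auto simp: S_def S'_def)
  qed auto
  have S'S: "?m S' * ?m S = 1\<^sub>m (Suc n)"
    by (rule mat_mult_left_right_inverse[OF _ _ SS']) auto
  have "?m (bord n D b c a) * ?m S = ?m S * ?m T"
  proof (rule eq_matI)
    fix i j assume "i < dim_row (?m S * ?m T)" "j < dim_col (?m S * ?m T)"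
    then have ij: "i < Suc n" "j < Suc n" by auto
    have "(?m (bord n D b c a) * ?m S) $$ (i, j) = (\<Sum>k<n. bord n D b c a (i, k) * S (k, j)) + bord n D b c a (i, n) * S (n, j)"
      using ij by (simp add: scalar_prod_def row_def col_def lessThan_atLeast0)
    moreover have "(\<Sum>k<n. bord n D b c a (i, k) * S (k, j)) =
       (if j < n then bord n D b c a (i, j) else (\<Sum>k<n. bord n D b c a (i, k) * u k))"
    proof (cases "j < n")
      case True
      then have "(\<Sum>k<n. bord n D b c a (i, k) * S (k, j)) = (\<Sum>k<n. if k = j then bord n D b c a (i, j) else 0)"
        by (intro sum.cong) (auto simp: S_def)
      then show ?thesis using True by simp
    qed (use ij in \<open>auto simp: S_def intro!: sum.cong\<close>)
    ultimately have L: "(?m (bord n D b c a) * ?m S) $$ (i, j) = (if j < n then bord n D b c a (i, j) else (\<Sum>k<n. bord n D b c a (i, k) * u k) + bord n D b c a (i, n))"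
      using ij by (auto simp: S_def)
    have "(?m S * ?m T) $$ (i, j) = (\<Sum>k<n. S (i, k) * T (k, j)) + S (i, n) * T (n, j)"
      using ij by (simp add: scalar_prod_def row_def col_def lessThan_atLeast0)
    also have "(\<Sum>k<n. S (i, k) * T (k, j)) = (\<Sum>k<n. if k = i then T (i, j) else 0)"
      by (intro sum.cong) (auto simp: S_def)
    finally have R: "(?m S * ?m T) $$ (i, j) = (if i < n then T (i, j) + u i * T (n, j) else T (n, j))"
      using ij by (auto simp: S_def)
    have "(\<Sum>k<n. bord n D b c a (i, k) * u k) = (if i < n then \<Sum>k<n. D (i, k) * u k else \<Sum>k<n. b k * u k)"
      using ij by (auto simp: bord_def intro!: sum.cong)
    then show "(?m (bord n D b c a) * ?m S) $$ (i, j) = (?m S * ?m T) $$ (i, j)"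
      unfolding L R using ij by (auto simp: bord_def T_def D c a algebra_simps)
  qed auto
  then have "?m (bord n D b c a) * ?m S * ?m S' = ?m S * ?m T * ?m S'" by simp
  moreover have "?m (bord n D b c a) * ?m S * ?m S' = ?m (bord n D b c a)"
    by (subst assoc_mult_mat[of _ "Suc n" "Suc n" _ "Suc n" _ "Suc n"]) (auto simp: SS')
  ultimately have "similar_mat (?m (bord n D b c a)) (?m T)"
    by (intro similar_matI[of _ _ "?m S" "?m S'" "Suc n"]) (auto simp: SS' S'S)
  then have "charp (Suc n) (bord n D b c a) = charp (Suc n) T" by (rule char_poly_similar)
  also have "\<dots> = [:-e, 1:] * charp n B"
  proof (rule poly_ext)
    fix x
    have "matf (Suc n) (\<lambda>i j. (if i = j then x else 0) - T (i, j)) =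
      four_block_mat (matf n (\<lambda>i j. (if i = j then x else 0) - B (i, j))) (0\<^sub>m n 1)
        (mat 1 n (\<lambda>(i, j). - b j)) (mat 1 1 (\<lambda>_. x - e))"
      by (intro eq_matI) (auto simp: T_def)
    then have "poly (charp (Suc n) T) x = poly (charp n B) x * det (mat 1 1 (\<lambda>_. x - e))"
      unfolding poly_charp
      by (simp add: det_four_block_mat_upper_right_zero[of _ n _ 1])
    also have "det (mat 1 1 (\<lambda>_. x - e)) = x - e" by (subst det_single) auto
    finally show "poly (charp (Suc n) T) x = poly ([:-e, 1:] * charp n B) x" by (simp add: algebra_simps)
  qed
  finally show ?thesis .
qed

lemma poly_charp_measurable:
  assumes X: "\<And>i j. i < n \<Longrightarrow> j < n \<Longrightarrow> (\<lambda>\<omega>. X \<omega> (i, j)) \<in> borel_measurable M"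
    and x: "x \<in> borel_measurable M"
  shows "(\<lambda>\<omega>. poly (charp n (X \<omega>)) (x \<omega> :: complex)) \<in> borel_measurable M"
proof -
  have "(\<lambda>\<omega>. \<Sum>p\<in>{p. p permutes {0..<n}}. signof p * (\<Prod>i = 0..<n. (if i = p i then x \<omega> else 0) - X \<omega> (i, p i))) \<in> borel_measurable M"
  proof (intro borel_measurable_sum borel_measurable_times borel_measurable_prod borel_measurable_const)
    fix p i assume "p \<in> {p. p permutes {0..<n}}" "i \<in> {0..<n}"
    then have "p i < n" "i < n" using permutes_in_image[of p "{0..<n}" i] by auto
    then show "(\<lambda>\<omega>. (if i = p i then x \<omega> else 0) - X \<omega> (i, p i)) \<in> borel_measurable M"
      using X x by (cases "i = p i") auto
  qed
  also have "(\<lambda>\<omega>. \<Sum>p\<in>{p. p permutes {0..<n}}. signof p * (\<Prod>i = 0..<n. (if i = p i then x \<omega> else 0) - X \<omega> (i, p i)))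
      = (\<lambda>\<omega>. poly (charp n (X \<omega>)) (x \<omega>))"
  proof (rule ext)
    fix \<omega>
    have p: "p i < n" if "p permutes {0..<n}" "i < n" for p i
      using permutes_in_image[OF that(1), of i] that(2) by auto
    show "(\<Sum>p\<in>{p. p permutes {0..<n}}. signof p * (\<Prod>i = 0..<n. (if i = p i then x \<omega> else 0) - X \<omega> (i, p i)))
        = poly (charp n (X \<omega>)) (x \<omega>)"
      unfolding poly_charp
      by (subst det_def'[of _ n]) (auto intro!: sum.cong prod.cong simp: p)
  qed
  finally show ?thesis .
qed

section \<open>Gaussian integrals\<close>

lemma nn_integral_complex_radial:
  fixes f :: "real \<Rightarrow> ennreal"
  assumes f[measurable]: "f \<in> borel_measurable borel"
  shows "(\<integral>\<^sup>+ z. f ((cmod z)\<^sup>2) \<partial>lborel) = ennreal pi * (\<integral>\<^sup>+ t. f t * indicator {0..} t \<partial>lborel)"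
proof -
  \<comment> \<open>The minus sign makes the half-lines \<open>{x<..}\<close> pull back to discs,
    which have finite area; the uniqueness criterion \<open>measure_eqI_lessThan\<close> compares
    finite values on such half-lines.\<close>
  define M where "M = distr (lborel :: complex measure) borel (\<lambda>z. - ((cmod z)\<^sup>2))"
  define N where "N = density lborel (\<lambda>t::real. ennreal pi * indicator {..0} t)"
  have M: "emeasure M {x<..} = (if x < 0 then ennreal (pi * (- x)) else 0)" for x
  proof -
    have "(\<lambda>z. - ((cmod z)\<^sup>2)) -` {x<..} = (if x < 0 then ball 0 (sqrt (- x)) else {})"
    proof (cases "x < 0")
      case True
      have "x < - (cmod z)\<^sup>2 \<longleftrightarrow> cmod z < sqrt (- x)" for z
      proof -
        have "x < - (cmod z)\<^sup>2 \<longleftrightarrow> sqrt ((cmod z)\<^sup>2) < sqrt (- x)" by (simp only: real_sqrt_less_iff) auto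
        then show ?thesis by simp
      qed
      then show ?thesis using True by auto
    next
      case False
      then have "\<not> x < - (cmod z)\<^sup>2" for z
        using zero_le_power2[of "cmod z"] by linarith
      then show ?thesis using False by auto
    qed
    then have "emeasure M {x<..} = emeasure lborel (if x < 0 then ball 0 (sqrt (- x)) else {} :: complex set)"
      by (simp add: M_def emeasure_distr)
    then show ?thesis
      by (simp add: emeasure_ball unit_ball_vol_2)
  qed
  have N: "emeasure N {x<..} = (if x < 0 then ennreal (pi * (- x)) else 0)" for x
  proof -
    have "emeasure N {x<..} = (\<integral>\<^sup>+ t. ennreal pi * indicator ({..0} \<inter> {x<..}) t \<partial>lborel)"
      by (simp add: N_def emeasure_density indicator_inter_arith mult.assoc)
    also have "{..0} \<inter> {x<..} = {x<..0}" by auto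
    also have "(\<integral>\<^sup>+ t. ennreal pi * indicator {x<..0} t \<partial>lborel) = ennreal pi * emeasure lborel {x<..0}"
      by (simp add: nn_integral_cmult)
    also have "\<dots> = (if x < 0 then ennreal (pi * (- x)) else 0)"
      by (simp flip: ennreal_mult)
    finally show ?thesis .
  qed
  have "M = N"
    by (rule measure_eqI_lessThan) (auto simp: M N, auto simp: M_def N_def)
  then have "(\<integral>\<^sup>+ t. f (- t) \<partial>M) = (\<integral>\<^sup>+ t. f (- t) \<partial>N)" by simp
  moreover have "(\<integral>\<^sup>+ t. f (- t) \<partial>M) = (\<integral>\<^sup>+ z. f ((cmod z)\<^sup>2) \<partial>lborel)"
    by (simp add: M_def nn_integral_distr)
  moreover have "(\<integral>\<^sup>+ t. f (- t) \<partial>N) = (\<integral>\<^sup>+ t. ennreal pi * (f (- t) * indicator {..0} t) \<partial>lborel)"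
    by (simp add: N_def nn_integral_density mult_ac)
  moreover have "\<dots> = ennreal pi * (\<integral>\<^sup>+ t. f (- t) * indicator {..0} t \<partial>lborel)"
    by (simp add: nn_integral_cmult)
  moreover have "(\<integral>\<^sup>+ t. f (- t) * indicator {..0} t \<partial>lborel) = (\<integral>\<^sup>+ t. f t * indicator {0..} t \<partial>lborel)"
    by (subst nn_integral_real_affine[where c = "-1" and t = 0]) (auto intro!: nn_integral_cong simp: indicator_def)
  ultimately show ?thesis by simp
qed

lemma ennreal_mult_eq_iff_divide:
  assumes "s > 0" "ennreal s * x = ennreal t"
  shows "x = ennreal (t / s)"
proof -
  have "ennreal (1 / s) * ennreal s = 1" using assms by (simp flip: ennreal_mult)
  then have "x = ennreal (1 / s) * (ennreal s * x)" by (simp only: mult.assoc[symmetric] mult_1_left)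
  then show ?thesis using assms by (cases "t \<ge> 0") (simp_all add: ennreal_neg divide_nonpos_pos flip: ennreal_mult)
qed

lemma nn_integral_power_times_exp_scale:
  assumes s: "s > 0"
  shows "(\<integral>\<^sup>+ t. ennreal (t ^ k * exp (- s * t)) * indicator {0..} t \<partial>lborel) = ennreal (fact k / s ^ Suc k)"
proof -
  have "ennreal (fact k) = (\<integral>\<^sup>+ x. ennreal (x ^ k * exp (- x)) * indicator {0..} x \<partial>lborel)"
    by (simp add: nn_intergal_power_times_exp_Ici)
  also have "\<dots> = ennreal s * (\<integral>\<^sup>+ t. ennreal ((s * t) ^ k * exp (- (s * t))) * indicator {0..} (s * t) \<partial>lborel)"
    using s by (subst nn_integral_real_affine[where c = s and t = 0]) auto
  also have "(\<integral>\<^sup>+ t. ennreal ((s * t) ^ k * exp (- (s * t))) * indicator {0..} (s * t) \<partial>lborel)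
      = (\<integral>\<^sup>+ t. ennreal (s ^ k) * (ennreal (t ^ k * exp (- s * t)) * indicator {0..} t) \<partial>lborel)"
    using s by (intro nn_integral_cong)
      (auto simp: indicator_def zero_le_mult_iff power_mult_distrib mult_ac simp flip: ennreal_mult)
  also have "\<dots> = ennreal (s ^ k) * (\<integral>\<^sup>+ t. ennreal (t ^ k * exp (- s * t)) * indicator {0..} t \<partial>lborel)"
    by (rule nn_integral_cmult) auto
  finally have *: "ennreal (fact k) = ennreal (s ^ Suc k) * (\<integral>\<^sup>+ t. ennreal (t ^ k * exp (- s * t)) * indicator {0..} t \<partial>lborel)" (is "_ = _ * ?I")
    using s by (simp add: ennreal_mult mult.assoc)
  show ?thesis
    by (rule ennreal_mult_eq_iff_divide) (use s * in \<open>simp_all del: power_Suc\<close>)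
qed

lemma nn_integral_complex_gauss:
  assumes s: "s > 0"
  shows "(\<integral>\<^sup>+ z. ennreal ((cmod z) ^ (2 * k) * exp (- s * (cmod z)\<^sup>2)) \<partial>lborel) = ennreal (pi * fact k / s ^ Suc k)"
proof -
  have "(\<integral>\<^sup>+ z. ennreal ((cmod z) ^ (2 * k) * exp (- s * (cmod z)\<^sup>2)) \<partial>lborel)
      = (\<integral>\<^sup>+ z. (\<lambda>t. ennreal (t ^ k * exp (- s * t))) ((cmod z)\<^sup>2) \<partial>lborel)"
    by (simp add: power_mult)
  also have "\<dots> = ennreal pi * ennreal (fact k / s ^ Suc k)"
    by (subst nn_integral_complex_radial) (simp_all only: nn_integral_power_times_exp_scale[OF s], measurable)
  finally show ?thesis using s by (simp flip: ennreal_mult)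
qed

text \<open>Unnormalised: the total mass is pi to the number of coordinates, and powers of pi are
  carried along explicitly until the law of a Ginibre matrix is introduced.\<close>

definition gauss :: "'i set \<Rightarrow> ('i \<Rightarrow> complex) \<Rightarrow> ennreal" where
  "gauss I x = ennreal (exp (- (\<Sum>i\<in>I. (cmod (x i))\<^sup>2)))"

abbreviation mgauss :: "nat \<Rightarrow> cmatrix \<Rightarrow> ennreal" where
  "mgauss n \<equiv> gauss ({..<n} \<times> {..<n})"

lemma gauss_measurable [measurable]: "gauss I \<in> borel_measurable (cspace I)"
proof -
  have "(\<lambda>x. ennreal (exp (- (\<Sum>i\<in>I. (cmod (x i))\<^sup>2)))) \<in> borel_measurable (cspace I)"
    using cspace_component[of _ I] by measurable
  then show ?thesis by (simp add: gauss_def[abs_def])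
qed

lemma nn_integral_cspace_gauss:
  assumes I: "finite I" and s: "s > 0"
  shows "(\<integral>\<^sup>+ x. ennreal (exp (- s * (\<Sum>i\<in>I. (cmod (x i))\<^sup>2))) \<partial>cspace I) = ennreal ((pi / s) ^ card I)"
proof -
  have "(\<integral>\<^sup>+ x. ennreal (exp (- s * (\<Sum>i\<in>I. (cmod (x i))\<^sup>2))) \<partial>cspace I)
      = (\<integral>\<^sup>+ x. (\<Prod>i\<in>I. ennreal (exp (- s * (cmod (x i))\<^sup>2))) \<partial>cspace I)"
    using I by (simp add: sum_distrib_left prod_ennreal flip: sum_negf exp_sum)
  also have "\<dots> = (\<Prod>i\<in>I. \<integral>\<^sup>+ z. ennreal (exp (- s * (cmod z)\<^sup>2)) \<partial>lborel)"
    using I by (intro cs.product_nn_integral_prod) auto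
  also have "(\<integral>\<^sup>+ z. ennreal (exp (- s * (cmod z)\<^sup>2)) \<partial>lborel) = ennreal (pi / s)"
    using nn_integral_complex_gauss[OF s, of 0] by simp
  finally show ?thesis using s by (simp add: ennreal_power)
qed

text \<open>Writing n! / s^(n+1) as the integral of t^n exp (-s t) turns the integral over
  \<open>u\<close> into a Gaussian one with parameter \<open>t\<close>; its value (pi / t)^n cancels
  t^n. The exponent n + 1 is the one left by the integral over the row \<open>b\<close> of a
  deflated matrix.\<close>

lemma nn_integral_cspace_cauchy:
  "(\<integral>\<^sup>+ u. ennreal (1 / (1 + (\<Sum>i<n. (cmod (u i))\<^sup>2)) ^ Suc n) \<partial>vsp n) = ennreal (pi ^ n / fact n)"
proof -
  let ?q = "\<lambda>u. \<Sum>i<n. (cmod (u i))\<^sup>2"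
  have q[measurable]: "?q \<in> borel_measurable (vsp n)"
    using cspace_component[of _ "{..<n}"] by measurable
  have pos: "1 + ?q u > 0" for u
    by (intro add_pos_nonneg sum_nonneg) auto
  have "ennreal (fact n) * (\<integral>\<^sup>+ u. ennreal (1 / (1 + ?q u) ^ Suc n) \<partial>vsp n)
      = (\<integral>\<^sup>+ u. ennreal (fact n / (1 + ?q u) ^ Suc n) \<partial>vsp n)"
  proof (subst nn_integral_cmult[symmetric])
    show "(\<integral>\<^sup>+ u. ennreal (fact n) * ennreal (1 / (1 + ?q u) ^ Suc n) \<partial>vsp n)
      = (\<integral>\<^sup>+ u. ennreal (fact n / (1 + ?q u) ^ Suc n) \<partial>vsp n)"
      using pos by (intro nn_integral_cong) (simp add: ennreal_mult[symmetric] less_imp_le del: power_Suc)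
  qed measurable
  also have "\<dots> = (\<integral>\<^sup>+ u. (\<integral>\<^sup>+ t. ennreal (t ^ n * exp (- (1 + ?q u) * t)) * indicator {0..} t \<partial>lborel) \<partial>vsp n)"
    by (simp only: nn_integral_power_times_exp_scale[OF pos])
  also have "\<dots> = (\<integral>\<^sup>+ t. (\<integral>\<^sup>+ u. ennreal (t ^ n * exp (- (1 + ?q u) * t)) * indicator {0..} t \<partial>vsp n) \<partial>lborel)"
    by (intro nn_integral_swap sigma_finite_cspace sigma_finite_lborel) measurable
  also have "\<dots> = (\<integral>\<^sup>+ t. ennreal (pi ^ n) * (ennreal (exp (- t)) * indicator {0..} t) \<partial>lborel)"
  proof (rule nn_integral_cong_AE)
    \<comment> \<open>The Gaussian formula requires t > 0, so the point 0 is discarded as a null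
      set.\<close>
    have "AE t::real in lborel. t \<noteq> 0" by (rule AE_lborel_singleton)
    then show "AE t in lborel. (\<integral>\<^sup>+ u. ennreal (t ^ n * exp (- (1 + ?q u) * t)) * indicator {0..} t \<partial>vsp n)
        = ennreal (pi ^ n) * (ennreal (exp (- t)) * indicator {0..} t)"
    proof (rule AE_mp, intro AE_I2 impI)
      fix t :: real assume t: "t \<noteq> 0"
      show "(\<integral>\<^sup>+ u. ennreal (t ^ n * exp (- (1 + ?q u) * t)) * indicator {0..} t \<partial>vsp n)
        = ennreal (pi ^ n) * (ennreal (exp (- t)) * indicator {0..} t)"
      proof (cases "t > 0")
        case True
        have "(\<integral>\<^sup>+ u. ennreal (t ^ n * exp (- (1 + ?q u) * t)) * indicator {0..} t \<partial>vsp n)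
          = (\<integral>\<^sup>+ u. ennreal (t ^ n * exp (- t)) * ennreal (exp (- t * ?q u)) \<partial>vsp n)"
          using True by (intro nn_integral_cong) (simp add: algebra_simps exp_add[symmetric] flip: ennreal_mult)
        also have "\<dots> = ennreal (t ^ n * exp (- t)) * (\<integral>\<^sup>+ u. ennreal (exp (- t * ?q u)) \<partial>vsp n)"
          by (rule nn_integral_cmult) measurable
        also have "(\<integral>\<^sup>+ u. ennreal (exp (- t * ?q u)) \<partial>vsp n) = ennreal ((pi / t) ^ n)"
          using nn_integral_cspace_gauss[OF _ True, of "{..<n}"] by simp
        also have "ennreal (t ^ n * exp (- t)) * ennreal ((pi / t) ^ n) = ennreal (pi ^ n * exp (- t))"
          using True by (simp add: power_divide flip: ennreal_mult)
        finally show ?thesis using True by (simp add: ennreal_mult)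
      qed (use t in auto)
    qed
  qed
  also have "\<dots> = ennreal (pi ^ n) * (\<integral>\<^sup>+ t. ennreal (exp (- t)) * indicator {0..} t \<partial>lborel)"
    by (rule nn_integral_cmult) auto
  also have "(\<integral>\<^sup>+ t. ennreal (exp (- t)) * indicator {0..} t \<partial>lborel) = 1"
    using nn_intergal_power_times_exp_Ici[of 0] by simp
  finally have *: "ennreal (fact n) * (\<integral>\<^sup>+ u. ennreal (1 / (1 + ?q u) ^ Suc n) \<partial>vsp n) = ennreal (pi ^ n)" (is "_ * ?I = _")
    by simp
  show ?thesis
    using ennreal_mult_eq_iff_divide[OF _ *] by simp
qed

text \<open>The block matrix with blocks I, -u, b, 1 is evaluated in two ways: eliminating the
  corner gives I + u b, while clearing the last column gives a lower triangular matrix with corner 1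
  + b u.\<close>

lemma det_rank_one_update:
  "det (matf n (\<lambda>i j. (if i = j then 1 else 0) + u i * b j)) = 1 + (\<Sum>j<n. b j * u j)"
proof -
  define M where "M = (\<lambda>i j. if i = j then 1 else if i < n \<and> j = n then - u i else if i = n \<and> j < n then b j else (0::complex))"
  define E where "E = mat (Suc n) (Suc n) (\<lambda>(i, j). if i = j then 1 else if i < n \<and> j = n then u i else (0::complex))"
  define L where "L = matf (Suc n) (\<lambda>i j. if i = n then (if j = n then 1 + (\<Sum>j<n. b j * u j) else b j) else if i = j then 1 else 0)"
  have dE: "det E = 1"
    by (rule det_unitriangular[of _ "Suc n"]) (auto simp: E_def)
  have dL: "det L = 1 + (\<Sum>j<n. b j * u j)"
  proof -
    have "diag_mat L = replicate n 1 @ [1 + (\<Sum>j<n. b j * u j)]"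
      by (rule nth_equalityI) (auto simp: L_def diag_mat_def nth_append simp del: upt_Suc)
    then show ?thesis
      by (subst det_lower_triangular[of "Suc n"]) (auto simp: L_def)
  qed
  have "matf (Suc n) M * E = L"
  proof (rule eq_matI)
    fix i j assume "i < dim_row L" "j < dim_col L"
    then have ij: "i < Suc n" "j < Suc n" by (simp_all add: L_def)
    have "(matf (Suc n) M * E) $$ (i, j) = (\<Sum>k<n. M i k * E $$ (k, j)) + M i n * E $$ (n, j)"
      using ij by (simp add: E_def scalar_prod_def row_def col_def lessThan_atLeast0)
    also have "(\<Sum>k<n. M i k * E $$ (k, j)) = (if j < n then M i j else \<Sum>k<n. M i k * u k)"
    proof (cases "j < n")
      case True
      have "(\<Sum>k<n. M i k * E $$ (k, j)) = (\<Sum>k<n. if k = j then M i j else 0)"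
        using True by (intro sum.cong) (auto simp: E_def)
      then show ?thesis using True by simp
    qed (use ij in \<open>auto simp: E_def intro!: sum.cong\<close>)
    also have "(\<Sum>k<n. M i k * u k) = (if i < n then u i else \<Sum>k<n. b k * u k)"
    proof (cases "i < n")
      case True
      have "(\<Sum>k<n. M i k * u k) = (\<Sum>k<n. if k = i then u i else 0)"
        using True by (intro sum.cong) (auto simp: M_def)
      then show ?thesis using True by simp
    qed (use ij in \<open>auto simp: M_def intro!: sum.cong\<close>)
    finally show "(matf (Suc n) M * E) $$ (i, j) = L $$ (i, j)"
      using ij by (auto simp: M_def E_def L_def)
  qed (auto simp: E_def L_def)
  then have "det (matf (Suc n) M) * det E = det L"
    by (subst det_mult[symmetric, of _ "Suc n"]) (auto simp: E_def)
  moreover have "det (matf (Suc n) M) = det (matf n (\<lambda>i j. M i j - M i n * M n j / M n n))"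
    by (subst det_schur_step[of M n]) (auto simp: M_def)
  moreover have "matf n (\<lambda>i j. M i j - M i n * M n j / M n n) = matf n (\<lambda>i j. (if i = j then 1 else 0) + u i * b j)"
    by (intro eq_matI) (auto simp: M_def)
  ultimately show ?thesis by (simp add: dE dL)
qed

section \<open>The Gaussian weight of a deflated matrix\<close>

lemma bord_measurable:
  assumes "\<And>i j. i < n \<Longrightarrow> j < n \<Longrightarrow> (\<lambda>\<omega>. D \<omega> (i, j)) \<in> borel_measurable M"
    and "\<And>j. j < n \<Longrightarrow> (\<lambda>\<omega>. b \<omega> j) \<in> borel_measurable M"
    and "\<And>i. i < n \<Longrightarrow> (\<lambda>\<omega>. c \<omega> i) \<in> borel_measurable M"
    and "a \<in> borel_measurable M"
  shows "(\<lambda>\<omega>. bord n (D \<omega>) (b \<omega>) (c \<omega>) (a \<omega>)) \<in> measurable M (msp (Suc n))"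
  unfolding bord_def
proof (rule cspace_restrictI)
  fix p :: "nat \<times> nat" assume p: "p \<in> {..<Suc n} \<times> {..<Suc n}"
  obtain i j where [simp]: "p = (i, j)" by (cases p)
  show "(\<lambda>\<omega>. if fst p < n then if snd p < n then D \<omega> p else c \<omega> (fst p)
     else if snd p < n then b \<omega> (snd p) else a \<omega>) \<in> borel_measurable M"
    using assms by (cases "i < n"; cases "j < n") auto
qed

text \<open>The squared norm of the eigenvector (u, 1).\<close>

definition usq :: "nat \<Rightarrow> cvec \<Rightarrow> real" where
  "usq n u = 1 + (\<Sum>i<n. (cmod (u i))\<^sup>2)"

text \<open>The coefficient k for which I + k u u^H squares to I + u u^H, with u^H the conjugate
  transpose. It equals (sqrt (1 + |u|^2) - 1) / |u|^2, rewritten so that u = 0 is no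
  exception.\<close>

definition kap :: "nat \<Rightarrow> cvec \<Rightarrow> real" where
  "kap n u = 1 / (1 + sqrt (usq n u))"

text \<open>
  \<open>rootI n u\<close> is the positive square root of \<open>I + u u*\<close>, which has determinant \<open>sqrt (1 + |u|\<^sup>2)\<close>.
\<close>

definition rootI :: "nat \<Rightarrow> cvec \<Rightarrow> nat \<Rightarrow> cvec" where
  "rootI n u i j = (if i = j then 1 else 0) + u i * (of_real (kap n u) * cnj (u j))"

text \<open>The Sherman-Morrison inverse I - k / (1 + k |u|^2) u u^H, with the denominator
  simplified by \<open>kap_root\<close>.\<close>

definition rootI_inv :: "nat \<Rightarrow> cvec \<Rightarrow> nat \<Rightarrow> cvec" where
  "rootI_inv n u i j = (if i = j then 1 else 0) - u i * (of_real (kap n u / sqrt (usq n u)) * cnj (u j))"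

lemma usq_pos: "usq n u > 0" "usq n u \<ge> 1"
proof -
  have "(\<Sum>i<n. (cmod (u i))\<^sup>2) \<ge> 0" by (intro sum_nonneg) auto
  then show "usq n u > 0" "usq n u \<ge> 1" by (simp_all add: usq_def)
qed

text \<open>Expresses that the square of \<open>rootI n u\<close> is I + u u^H, in the scalar form
  in which the norm identities consume it.\<close>

lemma kap_quadratic: "2 * kap n u + (kap n u)\<^sup>2 * (usq n u - 1) = 1"
proof -
  define r where "r = sqrt (usq n u)"
  have r: "r > 0" "usq n u = r\<^sup>2" using usq_pos[of n u] by (simp_all add: r_def)
  have k: "kap n u * (1 + r) = 1" using r by (simp add: kap_def r_def[symmetric])
  have "2 * kap n u + (kap n u)\<^sup>2 * (r\<^sup>2 - 1) = 2 * kap n u + kap n u * (kap n u * (1 + r)) * (r - 1)"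
    by (simp add: algebra_simps power2_eq_square)
  also have "\<dots> = kap n u * (1 + r)" by (subst k) (simp add: algebra_simps)
  finally show ?thesis using k r by simp
qed

text \<open>The left-hand side is the eigenvalue of \<open>rootI n u\<close> on the vector u; on the
  orthogonal complement it acts as the identity, so this is also its determinant.\<close>

lemma kap_root: "1 + kap n u * (usq n u - 1) = sqrt (usq n u)"
proof -
  define r where "r = sqrt (usq n u)"
  have r: "r > 0" "usq n u = r\<^sup>2" using usq_pos[of n u] by (simp_all add: r_def)
  have k: "kap n u * (1 + r) = 1" using r by (simp add: kap_def r_def[symmetric])
  have "1 + kap n u * (r\<^sup>2 - 1) = 1 + (kap n u * (1 + r)) * (r - 1)"
    by (simp add: algebra_simps power2_eq_square)
  then show ?thesis unfolding k using r by (simp flip: r_def)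
qed

lemma sum_u_cnj: "(\<Sum>k<n. u k * cnj (u k)) = of_real (usq n u - 1)"
proof -
  have "complex_of_real (usq n u - 1) = (\<Sum>k<n. of_real ((cmod (u k))\<^sup>2))"
    by (simp add: usq_def)
  then show ?thesis by (simp only: complex_norm_square)
qed

lemma cmod_add_sq: "(cmod (x + y))\<^sup>2 = (cmod x)\<^sup>2 + 2 * Re (cnj y * x) + (cmod y)\<^sup>2"
  unfolding cmod_power2 by (simp add: power2_eq_square algebra_simps)

lemma Re_cnj_mult_self: "Re (cnj z * z) = (cmod z)\<^sup>2"
  unfolding cmod_power2 by (simp add: power2_eq_square)

lemma det_rootI: "det (matf n (rootI n u)) = of_real (sqrt (usq n u))"
proof -
  have "det (matf n (rootI n u)) = 1 + (\<Sum>j<n. of_real (kap n u) * cnj (u j) * u j)"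
    unfolding rootI_def[abs_def] by (rule det_rank_one_update)
  also have "(\<Sum>j<n. of_real (kap n u) * cnj (u j) * u j) = of_real (kap n u) * (\<Sum>j<n. u j * cnj (u j))"
    by (simp add: sum_distrib_left mult_ac)
  also have "1 + \<dots> = of_real (1 + kap n u * (usq n u - 1))"
    by (simp add: sum_u_cnj)
  finally show ?thesis by (simp add: kap_root)
qed

lemma row_times_rootI: "j < n \<Longrightarrow> (\<Sum>k<n. x k * rootI n u k j) = x j + of_real (kap n u) * (\<Sum>k<n. x k * u k) * cnj (u j)"
proof -
  assume j: "j < n"
  have "(\<Sum>k<n. x k * rootI n u k j) = (\<Sum>k<n. (if k = j then x j else 0) + of_real (kap n u) * (x k * u k) * cnj (u j))"
    by (intro sum.cong) (auto simp: rootI_def algebra_simps)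
  then show ?thesis using j by (simp add: sum.distrib sum_distrib_left sum_distrib_right mult_ac)
qed

lemma rootI_times_col: "i < n \<Longrightarrow> (\<Sum>k<n. rootI n u i k * x k) = x i + of_real (kap n u) * (\<Sum>k<n. cnj (u k) * x k) * u i"
proof -
  assume i: "i < n"
  have "(\<Sum>k<n. rootI n u i k * x k) = (\<Sum>k<n. (if k = i then x i else 0) + of_real (kap n u) * (cnj (u k) * x k) * u i)"
    by (intro sum.cong) (auto simp: rootI_def algebra_simps)
  then show ?thesis using i by (simp add: sum.distrib sum_distrib_left sum_distrib_right mult_ac)
qed

lemma rootI_inv: "matf n (rootI n u) * matf n (rootI_inv n u) = 1\<^sub>m n"
proof (rule eq_matI)
  fix i j assume "i < dim_row (1\<^sub>m n)" "j < dim_col (1\<^sub>m n)"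
  then have ij: "i < n" "j < n" by auto
  define k where "k = complex_of_real (kap n u)"
  define r where "r = complex_of_real (sqrt (usq n u))"
  have r0: "r \<noteq> 0" using usq_pos[of n u] by (simp add: r_def)
  have k1: "1 + k * of_real (usq n u - 1) = r"
    using arg_cong[OF kap_root[of n u], of complex_of_real] by (simp add: k_def r_def)
  have "(matf n (rootI n u) * matf n (rootI_inv n u)) $$ (i, j) = (\<Sum>l<n. rootI n u i l * rootI_inv n u l j)"
    using ij by (simp add: scalar_prod_def row_def col_def lessThan_atLeast0)
  also have "\<dots> = rootI_inv n u i j + k * (\<Sum>l<n. cnj (u l) * rootI_inv n u l j) * u i"
    using ij by (simp add: rootI_times_col k_def)
  also have "(\<Sum>l<n. cnj (u l) * rootI_inv n u l j) = (\<Sum>l<n. (if l = j then cnj (u j) else 0) - k / r * cnj (u j) * (u l * cnj (u l)))"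
    by (intro sum.cong) (auto simp: rootI_inv_def k_def r_def algebra_simps)
  also have "\<dots> = cnj (u j) - k / r * cnj (u j) * of_real (usq n u - 1)"
  proof -
    have "(\<Sum>l<n. k / r * cnj (u j) * (u l * cnj (u l))) = k / r * cnj (u j) * of_real (usq n u - 1)"
      by (simp only: sum_distrib_left[symmetric] sum_u_cnj)
    then show ?thesis using ij by (simp only: sum_subtractf) simp
  qed
  also have "rootI_inv n u i j + k * (cnj (u j) - k / r * cnj (u j) * of_real (usq n u - 1)) * u i
    = (if i = j then 1 else 0) + k * u i * cnj (u j) * (r - (1 + k * of_real (usq n u - 1))) / r"
    using r0 by (simp add: rootI_inv_def field_simps k_def[symmetric] r_def[symmetric])
  also have "\<dots> = (if i = j then 1 else 0)" unfolding k1 by simp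
  finally show "(matf n (rootI n u) * matf n (rootI_inv n u)) $$ (i, j) = 1\<^sub>m n $$ (i, j)"
    using ij by simp
qed auto

lemma sum_cmod_shift:
  "(\<Sum>j<n. (cmod (x j + a * cnj (u j)))\<^sup>2) = (\<Sum>j<n. (cmod (x j))\<^sup>2) + 2 * Re (cnj a * (\<Sum>j<n. x j * u j)) + (cmod a)\<^sup>2 * (usq n u - 1)"
proof -
  have "(cmod (x j + a * cnj (u j)))\<^sup>2 = (cmod (x j))\<^sup>2 + 2 * Re (cnj a * (x j * u j)) + (cmod a)\<^sup>2 * (cmod (u j))\<^sup>2" for j
    by (simp only: cmod_add_sq) (simp add: norm_mult power_mult_distrib mult_ac)
  then show ?thesis
    by (simp add: sum.distrib usq_def sum_distrib_left)
qed

lemma sum_cmod_shift':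
  "(\<Sum>j<n. (cmod (x j + a * u j))\<^sup>2) = (\<Sum>j<n. (cmod (x j))\<^sup>2) + 2 * Re (cnj a * (\<Sum>j<n. cnj (u j) * x j)) + (cmod a)\<^sup>2 * (usq n u - 1)"
proof -
  have "usq n (\<lambda>j. cnj (u j)) = usq n u" by (simp add: usq_def)
  then show ?thesis using sum_cmod_shift[where u = "\<lambda>j. cnj (u j)"] by (simp add: mult_ac)
qed

text \<open>The row (x, l - x u) has product \<open>l\<close> with (u, 1). Subtracting the shortest
  row with this property, of squared norm |l|^2 / s with s = \<open>usq n u\<close>, leaves an
  orthogonal row (y, -y u), and |y|^2 + |y u|^2 is the squared norm of y times the square root of I
  + u u^H.\<close>

lemma row_norm_identity:
  fixes l :: complex and u :: cvec and n :: nat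
  defines "t \<equiv> \<lambda>j. l * cnj (u j) / of_real (usq n u)"
  shows "(\<Sum>j<n. (cmod (x j))\<^sup>2) + (cmod (l - (\<Sum>j<n. x j * u j)))\<^sup>2
    = (cmod l)\<^sup>2 / usq n u + (\<Sum>j<n. (cmod (\<Sum>k<n. (x k - t k) * rootI n u k j))\<^sup>2)"
proof -
  define s where "s = usq n u"
  have s: "s > 0" using usq_pos by (simp add: s_def)
  define a where "a = l / of_real s"
  define y where "y j = x j - t j" for j
  define T where "T = (\<Sum>j<n. y j * u j)"
  have la: "l = a * of_real s" using s by (simp add: a_def)
  have xy: "x j = y j + a * cnj (u j)" for j by (simp add: y_def t_def a_def s_def)
  have 1: "(\<Sum>j<n. (cmod (x j))\<^sup>2) = (\<Sum>j<n. (cmod (y j))\<^sup>2) + 2 * Re (cnj a * T) + (cmod a)\<^sup>2 * (s - 1)"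
    unfolding xy T_def s_def by (rule sum_cmod_shift)
  have "(\<Sum>j<n. x j * u j) = T + a * (\<Sum>j<n. u j * cnj (u j))"
    unfolding xy T_def by (simp add: algebra_simps sum.distrib sum_distrib_left)
  also have "\<dots> = T + a * of_real (s - 1)" by (simp add: sum_u_cnj s_def)
  finally have "l - (\<Sum>j<n. x j * u j) = a - T" by (simp add: la algebra_simps)
  then have 2: "(cmod (l - (\<Sum>j<n. x j * u j)))\<^sup>2 = (cmod a)\<^sup>2 - 2 * Re (cnj a * T) + (cmod T)\<^sup>2"
    using cmod_add_sq[of a "- T"] by simp
  have "(\<Sum>j<n. (cmod (\<Sum>k<n. (x k - t k) * rootI n u k j))\<^sup>2) = (\<Sum>j<n. (cmod (y j + of_real (kap n u) * T * cnj (u j)))\<^sup>2)"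
    by (intro sum.cong) (auto simp: y_def[symmetric] T_def row_times_rootI)
  also have "\<dots> = (\<Sum>j<n. (cmod (y j))\<^sup>2) + 2 * Re (cnj (of_real (kap n u) * T) * T) + (cmod (of_real (kap n u) * T))\<^sup>2 * (s - 1)"
    unfolding T_def s_def by (rule sum_cmod_shift)
  also have "2 * Re (cnj (of_real (kap n u) * T) * T) = 2 * kap n u * (cmod T)\<^sup>2"
    using Re_cnj_mult_self[of T] by (simp add: mult.assoc distrib_left[symmetric])
  also have "(cmod (of_real (kap n u) * T))\<^sup>2 = (kap n u)\<^sup>2 * (cmod T)\<^sup>2"
    by (simp add: norm_mult power_mult_distrib)
  also have "(\<Sum>j<n. (cmod (y j))\<^sup>2) + 2 * kap n u * (cmod T)\<^sup>2 + (kap n u)\<^sup>2 * (cmod T)\<^sup>2 * (s - 1)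
     = (\<Sum>j<n. (cmod (y j))\<^sup>2) + (2 * kap n u + (kap n u)\<^sup>2 * (usq n u - 1)) * (cmod T)\<^sup>2"
    by (simp add: s_def algebra_simps)
  finally have 3: "(\<Sum>j<n. (cmod (\<Sum>k<n. (x k - t k) * rootI n u k j))\<^sup>2) = (\<Sum>j<n. (cmod (y j))\<^sup>2) + (cmod T)\<^sup>2"
    by (simp add: kap_quadratic)
  have "(cmod l)\<^sup>2 / s = (cmod a)\<^sup>2 * s"
    using s by (simp add: la norm_mult power_mult_distrib power2_eq_square)
  then show ?thesis unfolding 1 2 3 s_def[symmetric] by (simp add: algebra_simps)
qed

text \<open>Completes the square in \<open>\<beta>\<close>. The remainder is x^H (I + u u^H)^-1 x,
  by the formula for the inverse of a rank one perturbation.\<close>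

lemma column_norm_identity:
  fixes \<beta> :: complex and x u :: cvec and n :: nat
  defines "w \<equiv> \<Sum>i<n. cnj (u i) * x i"
  shows "(\<Sum>i<n. (cmod (x i + \<beta> * u i))\<^sup>2) + (cmod \<beta>)\<^sup>2
    = usq n u * (cmod (\<beta> + w / of_real (usq n u)))\<^sup>2 + ((\<Sum>i<n. (cmod (x i))\<^sup>2) - (cmod w)\<^sup>2 / usq n u)"
proof -
  define s where "s = usq n u"
  have s: "s > 0" using usq_pos by (simp add: s_def)
  define v where "v = w / of_real s"
  have wv: "w = v * of_real s" using s by (simp add: v_def)
  have e: "(\<Sum>i<n. (cmod (x i + \<beta> * u i))\<^sup>2) = (\<Sum>i<n. (cmod (x i))\<^sup>2) + 2 * Re (cnj \<beta> * w) + (cmod \<beta>)\<^sup>2 * (s - 1)"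
    unfolding w_def s_def by (rule sum_cmod_shift')
  have "(cmod w)\<^sup>2 / s = (cmod v)\<^sup>2 * s"
    using s by (simp add: wv norm_mult power_mult_distrib power2_eq_square)
  moreover have "2 * Re (cnj \<beta> * w) = s * (2 * Re (cnj \<beta> * v))" by (simp add: wv algebra_simps)
  moreover have "(cmod (\<beta> + v))\<^sup>2 = (cmod \<beta>)\<^sup>2 + 2 * Re (cnj \<beta> * v) + (cmod v)\<^sup>2"
    using cmod_add_sq[of v \<beta>] by (simp add: add_ac)
  ultimately show ?thesis unfolding e s_def[symmetric] v_def[symmetric] by (simp add: algebra_simps)
qed

text \<open>The remainder of \<open>column_norm_identity\<close> is the quadratic form of (I + u
  u^H)^-1, and y = R x with R^2 = I + u u^H, so the form collapses to |x|^2.\<close>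

lemma rootI_column_norm:
  fixes x u :: cvec and n :: nat
  defines "y \<equiv> \<lambda>i. \<Sum>k<n. rootI n u i k * x k"
  shows "(\<Sum>i<n. (cmod (y i))\<^sup>2) - (cmod (\<Sum>i<n. cnj (u i) * y i))\<^sup>2 / usq n u = (\<Sum>i<n. (cmod (x i))\<^sup>2)"
proof -
  define s where "s = usq n u"
  have s: "s > 0" using usq_pos by (simp add: s_def)
  define w where "w = (\<Sum>i<n. cnj (u i) * x i)"
  have "(\<Sum>i<n. (cmod (y i))\<^sup>2) = (\<Sum>i<n. (cmod (x i + of_real (kap n u) * w * u i))\<^sup>2)"
    by (intro sum.cong) (auto simp: y_def w_def rootI_times_col)
  also have "\<dots> = (\<Sum>i<n. (cmod (x i))\<^sup>2) + 2 * Re (cnj (of_real (kap n u) * w) * w) + (cmod (of_real (kap n u) * w))\<^sup>2 * (s - 1)"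
    unfolding w_def s_def by (rule sum_cmod_shift')
  also have "2 * Re (cnj (of_real (kap n u) * w) * w) = 2 * kap n u * (cmod w)\<^sup>2"
    using Re_cnj_mult_self[of w] by (simp add: mult.assoc distrib_left[symmetric])
  also have "(cmod (of_real (kap n u) * w))\<^sup>2 = (kap n u)\<^sup>2 * (cmod w)\<^sup>2"
    by (simp add: norm_mult power_mult_distrib)
  also have "(\<Sum>i<n. (cmod (x i))\<^sup>2) + 2 * kap n u * (cmod w)\<^sup>2 + (kap n u)\<^sup>2 * (cmod w)\<^sup>2 * (s - 1)
     = (\<Sum>i<n. (cmod (x i))\<^sup>2) + (2 * kap n u + (kap n u)\<^sup>2 * (usq n u - 1)) * (cmod w)\<^sup>2"
    by (simp add: s_def algebra_simps)
  finally have 1: "(\<Sum>i<n. (cmod (y i))\<^sup>2) = (\<Sum>i<n. (cmod (x i))\<^sup>2) + (cmod w)\<^sup>2"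
    by (simp add: kap_quadratic)
  have "(\<Sum>i<n. cnj (u i) * y i) = (\<Sum>i<n. cnj (u i) * x i + of_real (kap n u) * w * (u i * cnj (u i)))"
  proof (rule sum.cong)
    fix i assume "i \<in> {..<n}"
    then have "y i = x i + of_real (kap n u) * w * u i"
      by (simp add: y_def w_def rootI_times_col)
    then show "cnj (u i) * y i = cnj (u i) * x i + of_real (kap n u) * w * (u i * cnj (u i))"
      by (simp add: algebra_simps)
  qed simp
  also have "\<dots> = w + of_real (kap n u) * w * (\<Sum>i<n. u i * cnj (u i))"
    by (simp add: sum.distrib w_def sum_distrib_left)
  also have "\<dots> = w * of_real (1 + kap n u * (usq n u - 1))"
    by (simp add: sum_u_cnj algebra_simps)
  finally have "(cmod (\<Sum>i<n. cnj (u i) * y i))\<^sup>2 / s = (cmod w)\<^sup>2"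
    unfolding kap_root using s by (simp add: norm_mult power_mult_distrib s_def)
  then show ?thesis unfolding 1 s_def[symmetric] by simp
qed

section \<open>Norm and Gaussian integral of a deflated matrix\<close>

text \<open>
  The matrix with eigenvector \<open>(u, 1)\<close> and eigenvalue \<open>l\<close> that the shear with last column \<open>(u, 1)\<close>
  conjugates to the block triangular matrix with diagonal blocks \<open>B\<close> and \<open>l\<close> and lower left block \<open>b\<close>.
\<close>

definition deflated :: "nat \<Rightarrow> cvec \<Rightarrow> complex \<Rightarrow> cmatrix \<Rightarrow> cvec \<Rightarrow> cmatrix" where
  "deflated n u l B b = bord n (\<lambda>p. B p + u (fst p) * b (snd p)) b
     (\<lambda>i. l * u i - (\<Sum>j<n. (B (i, j) + u i * b j) * u j)) (l - (\<Sum>j<n. b j * u j))"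

definition colw :: "nat \<Rightarrow> cvec \<Rightarrow> cmatrix \<Rightarrow> cvec" where
  "colw n u X j = (\<Sum>i<n. cnj (u i) * X (i, j))"

text \<open>The trace of X^H (I + u u^H)^-1 X: the part of the squared norm of a deflated matrix
  that survives completing the square in the row \<open>b\<close>.\<close>

definition colR :: "nat \<Rightarrow> cvec \<Rightarrow> cmatrix \<Rightarrow> real" where
  "colR n u X = (\<Sum>j<n. (\<Sum>i<n. (cmod (X (i, j)))\<^sup>2) - (cmod (colw n u X j))\<^sup>2 / usq n u)"

text \<open>All rows are treated by \<open>row_norm_identity\<close>: since (u, 1) is an
  eigenvector, row i has product l u_i with it, and the last row has product l. The remaining
  vectors form the columns X + u \<open>\<beta>\<close> together with \<open>\<beta>\<close>, where
  \<open>column_norm_identity\<close> separates the integration variable.\<close>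

lemma deflated_norm:
  fixes n :: nat and u :: cvec
  defines "X \<equiv> rmul n (rootI n u)"
  defines "\<beta> \<equiv> \<lambda>l b. mulv n (\<lambda>i j. rootI n u j i) (\<lambda>j\<in>{..<n}. b j + - (l * cnj (u j) / of_real (usq n u)))"
  shows "(\<Sum>p\<in>{..<Suc n} \<times> {..<Suc n}. (cmod (deflated n u l B b p))\<^sup>2)
    = (cmod l)\<^sup>2 + usq n u * (\<Sum>j<n. (cmod (\<beta> l b j + colw n u (X B) j / of_real (usq n u)))\<^sup>2) + colR n u (X B)"
proof -
  let ?d = "\<lambda>i j. (cmod (X B (i, j) + \<beta> l b j * u i))\<^sup>2"
  define s where "s = usq n u"
  have s: "s > 0" using usq_pos by (simp add: s_def)
  define t where "t j = l * cnj (u j) / of_real s" for j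
  have \<beta>: "\<beta> l b j = (\<Sum>k<n. (b k - t k) * rootI n u k j)" if "j < n" for j
    using that by (simp add: \<beta>_def mulv_def t_def s_def mult.commute)
  have "(\<Sum>p\<in>{..<Suc n} \<times> {..<Suc n}. (cmod (deflated n u l B b p))\<^sup>2)
      = (\<Sum>i<Suc n. \<Sum>j<Suc n. (cmod (deflated n u l B b (i, j)))\<^sup>2)"
    by (simp add: sum.cartesian_product del: sum.lessThan_Suc)
  also have "\<dots> = (\<Sum>i<n. \<Sum>j<Suc n. (cmod (deflated n u l B b (i, j)))\<^sup>2) + (\<Sum>j<Suc n. (cmod (deflated n u l B b (n, j)))\<^sup>2)"
    by (rule sum.lessThan_Suc)
  also have "(\<Sum>j<Suc n. (cmod (deflated n u l B b (n, j)))\<^sup>2) = (\<Sum>j<n. (cmod (b j))\<^sup>2) + (cmod (l - (\<Sum>j<n. b j * u j)))\<^sup>2"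
    by (simp add: deflated_def bord_def)
  also have "\<dots> = (cmod l)\<^sup>2 / s + (\<Sum>j<n. (cmod (\<beta> l b j))\<^sup>2)"
    unfolding row_norm_identity s_def[symmetric] by (simp add: \<beta> t_def)
  also have "(\<Sum>i<n. \<Sum>j<Suc n. (cmod (deflated n u l B b (i, j)))\<^sup>2)
      = (\<Sum>i<n. (cmod (u i))\<^sup>2 * ((cmod l)\<^sup>2 / s) + (\<Sum>j<n. ?d i j))"
  proof (rule sum.cong)
    fix i assume i: "i \<in> {..<n}"
    let ?x = "\<lambda>j. B (i, j) + u i * b j"
    have "(\<Sum>j<Suc n. (cmod (deflated n u l B b (i, j)))\<^sup>2) = (\<Sum>j<n. (cmod (?x j))\<^sup>2) + (cmod (l * u i - (\<Sum>j<n. ?x j * u j)))\<^sup>2"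
      using i by (simp add: deflated_def bord_def)
    also have "\<dots> = (cmod (l * u i))\<^sup>2 / s + (\<Sum>j<n. (cmod (\<Sum>k<n. (?x k - l * u i * cnj (u k) / of_real s) * rootI n u k j))\<^sup>2)"
      unfolding row_norm_identity s_def[symmetric] by simp
    also have "(\<Sum>j<n. (cmod (\<Sum>k<n. (?x k - l * u i * cnj (u k) / of_real s) * rootI n u k j))\<^sup>2) = (\<Sum>j<n. ?d i j)"
    proof (intro sum.cong refl arg_cong[where f = "\<lambda>z. (cmod z)\<^sup>2"])
      fix j assume "j \<in> {..<n}"
      show "(\<Sum>k<n. (?x k - l * u i * cnj (u k) / of_real s) * rootI n u k j) = X B (i, j) + \<beta> l b j * u i"
      proof -
        note j = \<open>j \<in> {..<n}\<close>
        have "X B (i, j) + \<beta> l b j * u i = (\<Sum>k<n. B (i, k) * rootI n u k j) + (\<Sum>k<n. (b k - t k) * rootI n u k j) * u i"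
          using i j by (simp add: X_def rmul_def \<beta>)
        then show ?thesis
          by (simp only: sum_distrib_right sum.distrib[symmetric]) (intro sum.cong, auto simp: t_def algebra_simps)
      qed
    qed
    finally show "(\<Sum>j<Suc n. (cmod (deflated n u l B b (i, j)))\<^sup>2) = (cmod (u i))\<^sup>2 * ((cmod l)\<^sup>2 / s) + (\<Sum>j<n. ?d i j)"
      by (simp add: norm_mult power_mult_distrib mult_ac)
  qed simp
  also have "\<dots> = (s - 1) * ((cmod l)\<^sup>2 / s) + (\<Sum>j<n. \<Sum>i<n. ?d i j)"
  proof -
    have "(\<Sum>i<n. (cmod (u i))\<^sup>2 * ((cmod l)\<^sup>2 / s)) = (s - 1) * ((cmod l)\<^sup>2 / s)"
    proof -
      have "s - 1 = (\<Sum>i<n. (cmod (u i))\<^sup>2)" by (simp add: s_def usq_def)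
      then show ?thesis by (simp only: sum_distrib_right)
    qed
    moreover have "(\<Sum>i<n. \<Sum>j<n. ?d i j) = (\<Sum>j<n. \<Sum>i<n. ?d i j)"
      by (rule sum.swap)
    ultimately show ?thesis by (simp add: sum.distrib)
  qed
  \<comment> \<open>The shortest rows contribute |l|^2 |u|^2 / s from the upper block and |l|^2 / s
    from the last row, together |l|^2 since s = 1 + |u|^2.\<close>
  also have "(s - 1) * ((cmod l)\<^sup>2 / s) + (\<Sum>j<n. \<Sum>i<n. ?d i j) + ((cmod l)\<^sup>2 / s + (\<Sum>j<n. (cmod (\<beta> l b j))\<^sup>2))
    = (cmod l)\<^sup>2 + (\<Sum>j<n. (\<Sum>i<n. ?d i j) + (cmod (\<beta> l b j))\<^sup>2)"
    using s by (simp add: sum.distrib field_simps)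
  also have "\<dots> = (cmod l)\<^sup>2 + (\<Sum>j<n. s * (cmod (\<beta> l b j + colw n u (X B) j / of_real s))\<^sup>2 + ((\<Sum>i<n. (cmod (X B (i, j)))\<^sup>2) - (cmod (colw n u (X B) j))\<^sup>2 / s))"
    unfolding column_norm_identity colw_def s_def ..
  also have "\<dots> = (cmod l)\<^sup>2 + s * (\<Sum>j<n. (cmod (\<beta> l b j + colw n u (X B) j / of_real s))\<^sup>2) + colR n u (X B)"
    by (simp add: colR_def s_def[symmetric] sum.distrib sum_distrib_left)
  finally show ?thesis by (simp add: s_def)
qed

text \<open>Replacing B by R B R^-1, where R is the square root, turns the product B R into R B, so
  that \<open>rootI_column_norm\<close> applies column by column. A similarity is used so that the
  characteristic polynomial and the volume are both preserved.\<close>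

lemma colR_conjugate:
  "colR n u (rmul n (rootI n u) (rmul n (rootI_inv n u) (lmul n {..<n} (rootI n u) B)))
    = (\<Sum>p\<in>{..<n} \<times> {..<n}. (cmod (B p))\<^sup>2)"
proof -
  let ?P = "rootI n u" and ?Q = "rootI_inv n u"
  let ?Y = "lmul n {..<n} ?P B"
  have QP: "matf n ?Q * matf n ?P = 1\<^sub>m n"
    by (rule mat_mult_left_right_inverse[OF _ _ rootI_inv]) auto
  have "mat n n (rmul n ?P (rmul n ?Q ?Y)) = mat n n ?Y"
    unfolding mat_rmul by (subst assoc_mult_mat[of _ n n _ n _ n]) (auto simp: QP)
  then have "rmul n ?P (rmul n ?Q ?Y) (i, j) = ?Y (i, j)" if "i < n" "j < n" for i j
    using that by (metis index_mat(1))
  then have e: "rmul n ?P (rmul n ?Q ?Y) (i, j) = (\<Sum>k<n. ?P i k * B (k, j))" if "i < n" "j < n" for i j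
    using that by (simp add: lmul_def)
  have "colR n u (rmul n ?P (rmul n ?Q ?Y)) = (\<Sum>j<n. \<Sum>i<n. (cmod (B (i, j)))\<^sup>2)"
    unfolding colR_def
  proof (rule sum.cong)
    fix j assume j: "j \<in> {..<n}"
    have "colw n u (rmul n ?P (rmul n ?Q ?Y)) j = (\<Sum>i<n. cnj (u i) * (\<Sum>k<n. ?P i k * B (k, j)))"
      unfolding colw_def using j by (intro sum.cong) (auto simp: e)
    moreover have "(\<Sum>i<n. (cmod (rmul n ?P (rmul n ?Q ?Y) (i, j)))\<^sup>2) = (\<Sum>i<n. (cmod (\<Sum>k<n. ?P i k * B (k, j)))\<^sup>2)"
      using j by (intro sum.cong) (auto simp: e)
    ultimately show "(\<Sum>i<n. (cmod (rmul n ?P (rmul n ?Q ?Y) (i, j)))\<^sup>2) - (cmod (colw n u (rmul n ?P (rmul n ?Q ?Y)) j))\<^sup>2 / usq n u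
        = (\<Sum>i<n. (cmod (B (i, j)))\<^sup>2)"
      by (simp only: rootI_column_norm)
  qed simp
  also have "\<dots> = (\<Sum>p\<in>{..<n} \<times> {..<n}. (cmod (B p))\<^sup>2)"
    by (subst sum.swap) (simp add: sum.cartesian_product)
  finally show ?thesis .
qed

lemma deflated_measurable:
  assumes "\<And>i j. i < n \<Longrightarrow> j < n \<Longrightarrow> (\<lambda>\<omega>. B \<omega> (i, j)) \<in> borel_measurable M"
    and "\<And>j. j < n \<Longrightarrow> (\<lambda>\<omega>. b \<omega> j) \<in> borel_measurable M"
    and "\<And>i. i < n \<Longrightarrow> (\<lambda>\<omega>. u \<omega> i) \<in> borel_measurable M"
    and "l \<in> borel_measurable M"
  shows "(\<lambda>\<omega>. deflated n (u \<omega>) (l \<omega>) (B \<omega>) (b \<omega>)) \<in> measurable M (msp (Suc n))"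
  unfolding deflated_def
  using assms by (intro bord_measurable) (auto intro!: borel_measurable_sum borel_measurable_times borel_measurable_add borel_measurable_diff)

text \<open>Passing from \<open>b\<close> to \<open>\<beta>\<close> costs |det R|^2 = s, where s =
  \<open>usq n u\<close>, and the Gaussian exp (-s |\<beta>|^2) integrates to (pi / s)^n; this
  explains the exponent n + 1.\<close>

lemma nn_integral_gauss_deflated_row:
  "(\<integral>\<^sup>+ b. mgauss (Suc n) (deflated n u l B b) \<partial>vsp n)
    = ennreal (exp (- (cmod l)\<^sup>2) * pi ^ n / usq n u ^ Suc n) * ennreal (exp (- colR n u (rmul n (rootI n u) B)))"
proof -
  define s where "s = usq n u"
  have s: "s > 0" using usq_pos by (simp add: s_def)
  define C where "C = exp (- (cmod l)\<^sup>2) * exp (- colR n u (rmul n (rootI n u) B))"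
  have C: "C \<ge> 0" by (simp add: C_def)
  define w where "w j = colw n u (rmul n (rootI n u) B) j / of_real s" for j
  define G where "G \<beta> = ennreal (exp (- s * (\<Sum>j<n. (cmod (\<beta> j))\<^sup>2)))" for \<beta> :: cvec
  have G[measurable]: "G \<in> borel_measurable (vsp n)"
    unfolding G_def using cspace_component[of _ "{..<n}"] by measurable
  define G1 where "G1 \<beta> = G (\<lambda>j\<in>{..<n}. \<beta> j + w j)" for \<beta>
  have G1[measurable]: "G1 \<in> borel_measurable (vsp n)"
  proof -
    have "(\<lambda>\<beta>. \<lambda>j\<in>{..<n}. \<beta> j + w j) \<in> measurable (vsp n) (vsp n)"
      by (intro cspace_restrictI borel_measurable_add cspace_component) auto
    from measurable_compose[OF this G] show ?thesis by (simp add: G1_def[abs_def])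
  qed
  let ?PT = "\<lambda>i j. rootI n u j i"
  let ?t = "\<lambda>j. - (l * cnj (u j) / of_real s)"
  have dPT: "det (matf n ?PT) = of_real (sqrt s)"
    unfolding s_def det_rootI[symmetric]
    by (subst det_transpose[symmetric, of _ n]) (auto intro!: arg_cong[where f = det])
  have "mgauss (Suc n) (deflated n u l B b) = ennreal C * G1 (mulv n ?PT (\<lambda>j\<in>{..<n}. b j + ?t j))" for b
    unfolding gauss_def deflated_norm G1_def G_def w_def s_def
    by (simp add: C_def exp_add exp_diff exp_minus field_simps flip: ennreal_mult)
  then have "(\<integral>\<^sup>+ b. mgauss (Suc n) (deflated n u l B b) \<partial>vsp n)
      = (\<integral>\<^sup>+ b. ennreal C * G1 (mulv n ?PT (\<lambda>j\<in>{..<n}. b j + ?t j)) \<partial>vsp n)" by simp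
  also have "\<dots> = (\<integral>\<^sup>+ b. ennreal C * G1 (mulv n ?PT b) \<partial>vsp n)"
    by (rule cspace_translation[where f = "\<lambda>b. ennreal C * G1 (mulv n ?PT b)"]) measurable
  also have "\<dots> = ennreal C * (\<integral>\<^sup>+ b. G1 (mulv n ?PT b) \<partial>vsp n)"
    by (rule nn_integral_cmult) measurable
  finally have 1: "(\<integral>\<^sup>+ b. mgauss (Suc n) (deflated n u l B b) \<partial>vsp n)
      = ennreal C * (\<integral>\<^sup>+ b. G1 (mulv n ?PT b) \<partial>vsp n)" (is "_ = _ * ?I") .
  have "ennreal s * ?I = (\<integral>\<^sup>+ \<beta>. G1 \<beta> \<partial>vsp n)"
    using cspace_linear[of n ?PT G1] s by (simp add: dPT)
  also have "\<dots> = (\<integral>\<^sup>+ \<beta>. G \<beta> \<partial>vsp n)"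
    unfolding G1_def by (rule cspace_translation) measurable
  also have "\<dots> = ennreal ((pi / s) ^ n)"
    unfolding G_def using nn_integral_cspace_gauss[OF _ s, of "{..<n}"] by simp
  finally have 2: "ennreal s * ?I = ennreal ((pi / s) ^ n)" .
  then have "?I = ennreal ((pi / s) ^ n / s)" by (rule ennreal_mult_eq_iff_divide[OF s])
  also have "(pi / s) ^ n / s = pi ^ n / s ^ Suc n" by (simp add: power_divide)
  finally show ?thesis
    unfolding 1 using s by (simp add: C_def s_def[symmetric] field_simps flip: ennreal_mult)
qed

text \<open>After the integral over \<open>b\<close> the variable \<open>u\<close> still enters
  through \<open>colR\<close>. Conjugation by \<open>rootI n u\<close> removes it and leaves
  \<open>\<Theta>\<close> unchanged by invariance, so that \<open>u\<close> survives only in the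
  scalar factor.\<close>

theorem nn_integral_gauss_deflated:
  assumes \<Theta>: "\<Theta> \<in> borel_measurable (msp n)"
    and inv: "\<And>P Q B. matf n P * matf n Q = 1\<^sub>m n \<Longrightarrow> \<Theta> (rmul n Q (lmul n {..<n} P B)) = \<Theta> B"
  shows "(\<integral>\<^sup>+ B. (\<integral>\<^sup>+ b. \<Theta> B * mgauss (Suc n) (deflated n u l B b) \<partial>vsp n) \<partial>msp n)
    = ennreal (exp (- (cmod l)\<^sup>2) * pi ^ n / usq n u ^ Suc n) *
      (\<integral>\<^sup>+ B. \<Theta> B * mgauss n B \<partial>msp n)"
proof -
  let ?I = "{..<n} \<times> {..<n}"
  let ?P = "rootI n u" and ?Q = "rootI_inv n u"
  note \<Theta>[measurable]
  have R[measurable]: "(\<lambda>B. ennreal (exp (- colR n u (rmul n ?P B)))) \<in> borel_measurable (cspace ?I)"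
  proof -
    have "(\<lambda>X. ennreal (exp (- colR n u X))) \<in> borel_measurable (cspace ?I)"
    proof -
      have [measurable]: "(\<lambda>X. X (i, j)) \<in> borel_measurable (cspace ?I)" if "i < n" "j < n" for i j
        using that by (intro cspace_component) auto
      show ?thesis unfolding colR_def colw_def by measurable
    qed
    from measurable_compose[OF rmul_measurable this] show ?thesis .
  qed
  have "(\<integral>\<^sup>+ b. \<Theta> B * mgauss (Suc n) (deflated n u l B b) \<partial>vsp n)
      = ennreal (exp (- (cmod l)\<^sup>2) * pi ^ n / usq n u ^ Suc n) * (\<Theta> B * ennreal (exp (- colR n u (rmul n ?P B))))" for B
  proof (subst nn_integral_cmult)
    have "(\<lambda>b. deflated n u l B b) \<in> measurable (vsp n) (msp (Suc n))"
      by (intro deflated_measurable cspace_component) auto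
    then show "(\<lambda>b. mgauss (Suc n) (deflated n u l B b)) \<in> borel_measurable (vsp n)"
      by (rule measurable_compose) measurable
  qed (simp add: nn_integral_gauss_deflated_row mult_ac)
  then have "(\<integral>\<^sup>+ B. (\<integral>\<^sup>+ b. \<Theta> B * mgauss (Suc n) (deflated n u l B b) \<partial>vsp n) \<partial>cspace ?I)
    = (\<integral>\<^sup>+ B. ennreal (exp (- (cmod l)\<^sup>2) * pi ^ n / usq n u ^ Suc n) * (\<Theta> B * ennreal (exp (- colR n u (rmul n ?P B)))) \<partial>cspace ?I)"
    by simp
  also have "\<dots> = ennreal (exp (- (cmod l)\<^sup>2) * pi ^ n / usq n u ^ Suc n) * (\<integral>\<^sup>+ B. \<Theta> B * ennreal (exp (- colR n u (rmul n ?P B))) \<partial>cspace ?I)"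
    by (rule nn_integral_cmult) measurable
  also have "(\<integral>\<^sup>+ B. \<Theta> B * ennreal (exp (- colR n u (rmul n ?P B))) \<partial>cspace ?I) =
      (\<integral>\<^sup>+ B. \<Theta> (rmul n ?Q (lmul n {..<n} ?P B)) * ennreal (exp (- colR n u (rmul n ?P (rmul n ?Q (lmul n {..<n} ?P B))))) \<partial>cspace ?I)"
    by (rule cspace_similarity[OF rootI_inv, where f = "\<lambda>B. \<Theta> B * ennreal (exp (- colR n u (rmul n ?P B)))", symmetric]) measurable
  also have "\<dots> = (\<integral>\<^sup>+ B. \<Theta> B * gauss ?I B \<partial>cspace ?I)"
    by (simp add: inv[OF rootI_inv] colR_conjugate gauss_def)
  finally show ?thesis .
qed

section \<open>The corner entry as a function of an eigenvalue\<close>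

lemma nn_integral_reverse3:
  assumes s: "sigma_finite_measure M1" "sigma_finite_measure M2" "sigma_finite_measure M3"
    and f: "(\<lambda>(x, y, z). f x y z) \<in> borel_measurable (M1 \<Otimes>\<^sub>M (M2 \<Otimes>\<^sub>M M3))"
  shows "(\<integral>\<^sup>+ x. (\<integral>\<^sup>+ y. (\<integral>\<^sup>+ z. f x y z \<partial>M3) \<partial>M2) \<partial>M1) = (\<integral>\<^sup>+ z. (\<integral>\<^sup>+ y. (\<integral>\<^sup>+ x. f x y z \<partial>M1) \<partial>M2) \<partial>M3)"
proof -
  interpret M1: sigma_finite_measure M1 by fact
  interpret M2: sigma_finite_measure M2 by fact
  interpret M3: sigma_finite_measure M3 by fact
  have [measurable (raw)]: "(\<lambda>\<omega>. f (X \<omega>) (Y \<omega>) (Z \<omega>)) \<in> borel_measurable N"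
    if "X \<in> measurable N M1" "Y \<in> measurable N M2" "Z \<in> measurable N M3" for X Y Z N
    using measurable_compose[OF measurable_Pair[OF that(1) measurable_Pair[OF that(2,3)]] f] by simp
  have "(\<integral>\<^sup>+ x. (\<integral>\<^sup>+ y. (\<integral>\<^sup>+ z. f x y z \<partial>M3) \<partial>M2) \<partial>M1) = (\<integral>\<^sup>+ x. (\<integral>\<^sup>+ z. (\<integral>\<^sup>+ y. f x y z \<partial>M2) \<partial>M3) \<partial>M1)"
    by (rule nn_integral_cong, rule nn_integral_swap[OF s(2,3)]) measurable
  also have "\<dots> = (\<integral>\<^sup>+ z. (\<integral>\<^sup>+ x. (\<integral>\<^sup>+ y. f x y z \<partial>M2) \<partial>M1) \<partial>M3)"
    by (rule nn_integral_swap[OF s(1,3)]) measurable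
  also have "\<dots> = (\<integral>\<^sup>+ z. (\<integral>\<^sup>+ y. (\<integral>\<^sup>+ x. f x y z \<partial>M1) \<partial>M2) \<partial>M3)"
    by (rule nn_integral_cong, rule nn_integral_swap[OF s(1,2)]) measurable
  finally show ?thesis .
qed

lemma bord_pair_measurable:
  "(\<lambda>((D, b, c), a). bord n D b c a) \<in> measurable ((msp n \<Otimes>\<^sub>M (vsp n \<Otimes>\<^sub>M vsp n)) \<Otimes>\<^sub>M lborel) (msp (Suc n))"
proof -
  have 1: "(\<lambda>x. fst (fst x) (i, j)) \<in> borel_measurable ((msp n \<Otimes>\<^sub>M (vsp n \<Otimes>\<^sub>M vsp n)) \<Otimes>\<^sub>M (lborel :: complex measure))" if "i < n" "j < n" for i j
    using that by (intro measurable_compose[OF _ cspace_component[of "(i, j)" "{..<n} \<times> {..<n}"]]) auto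
  have 2: "(\<lambda>x. fst (snd (fst x)) j) \<in> borel_measurable ((msp n \<Otimes>\<^sub>M (vsp n \<Otimes>\<^sub>M vsp n)) \<Otimes>\<^sub>M (lborel :: complex measure))" if "j < n" for j
    using that by (intro measurable_compose[OF _ cspace_component[of j "{..<n}"]]) auto
  have 3: "(\<lambda>x. snd (snd (fst x)) j) \<in> borel_measurable ((msp n \<Otimes>\<^sub>M (vsp n \<Otimes>\<^sub>M vsp n)) \<Otimes>\<^sub>M (lborel :: complex measure))" if "j < n" for j
    using that by (intro measurable_compose[OF _ cspace_component[of j "{..<n}"]]) auto
  show ?thesis
    unfolding case_prod_beta' by (intro bord_measurable 1 2 3) auto
qed

text \<open>Bordering merely rearranges coordinates, so it suffices to compare volumes of
  rectangles.\<close>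

lemma distr_bord:
  "distr ((msp n \<Otimes>\<^sub>M (vsp n \<Otimes>\<^sub>M vsp n)) \<Otimes>\<^sub>M lborel) (msp (Suc n)) (\<lambda>((D, b, c), a). bord n D b c a) = msp (Suc n)"
    (is "distr ?Q _ ?bd = _")
proof (rule cs.PiM_eqI)
  fix A :: "nat \<times> nat \<Rightarrow> complex set"
  assume A: "\<And>p. p \<in> {..<Suc n} \<times> {..<Suc n} \<Longrightarrow> A p \<in> sets lborel"
  let ?A1 = "Pi\<^sub>E ({..<n} \<times> {..<n}) A" and ?A2 = "Pi\<^sub>E {..<n} (\<lambda>j. A (n, j))" and ?A3 = "Pi\<^sub>E {..<n} (\<lambda>i. A (i, n))"
  interpret V: sigma_finite_measure "vsp n" by (rule sigma_finite_cspace) simp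
  interpret VV: pair_sigma_finite "vsp n" "vsp n" ..
  interpret MVV: sigma_finite_measure "msp n \<Otimes>\<^sub>M (vsp n \<Otimes>\<^sub>M vsp n)"
    by (intro sigma_finite_pair_measure sigma_finite_cspace) auto
  have pre: "?bd -` Pi\<^sub>E ({..<Suc n} \<times> {..<Suc n}) A \<inter> space ?Q = (?A1 \<times> (?A2 \<times> ?A3)) \<times> A (n, n)"
  proof -
    have *: "bord n D b c a \<in> Pi\<^sub>E ({..<Suc n} \<times> {..<Suc n}) A \<longleftrightarrow>
      (\<forall>i<n. \<forall>j<n. D (i, j) \<in> A (i, j)) \<and> (\<forall>j<n. b j \<in> A (n, j)) \<and> (\<forall>i<n. c i \<in> A (i, n)) \<and> a \<in> A (n, n)" for D b c a
      by (auto simp: bord_def PiE_def Pi_def less_Suc_eq)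
    show ?thesis
    proof (rule Set.set_eqI)
      fix x :: "(cmatrix \<times> cvec \<times> cvec) \<times> complex"
      obtain D b c a where x: "x = ((D, b, c), a)" by (metis prod.exhaust)
      show "x \<in> ?bd -` Pi\<^sub>E ({..<Suc n} \<times> {..<Suc n}) A \<inter> space ?Q \<longleftrightarrow> x \<in> (?A1 \<times> (?A2 \<times> ?A3)) \<times> A (n, n)"
        unfolding x by (simp add: * space_pair_measure space_PiM) (auto simp: PiE_def Pi_def)
    qed
  qed
  have "emeasure (distr ?Q (msp (Suc n)) ?bd) (Pi\<^sub>E ({..<Suc n} \<times> {..<Suc n}) A) = emeasure ?Q ((?A1 \<times> (?A2 \<times> ?A3)) \<times> A (n, n))"
    unfolding pre[symmetric] using A by (intro emeasure_distr bord_pair_measurable sets_PiM_I_finite) auto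
  also have "\<dots> = emeasure (msp n) ?A1 * (emeasure (vsp n) ?A2 * emeasure (vsp n) ?A3) * emeasure lborel (A (n, n))"
  proof -
    have m: "?A1 \<in> sets (msp n)" "?A2 \<in> sets (vsp n)" "?A3 \<in> sets (vsp n)" "A (n, n) \<in> sets lborel"
      using A by (auto intro!: sets_PiM_I_finite)
    show ?thesis
      using m by (simp add: lborel.emeasure_pair_measure_Times V.emeasure_pair_measure_Times
          sigma_finite_measure.emeasure_pair_measure_Times[OF sigma_finite_pair_measure[OF V.sigma_finite_measure_axioms V.sigma_finite_measure_axioms]])
  qed
  also have "\<dots> = (\<Prod>p\<in>{..<n} \<times> {..<n}. emeasure lborel (A p)) * ((\<Prod>j<n. emeasure lborel (A (n, j))) * (\<Prod>i<n. emeasure lborel (A (i, n)))) * emeasure lborel (A (n, n))"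
    using A by (subst (1 2 3) cs.emeasure_PiM) auto
  also have "\<dots> = (\<Prod>p\<in>{..<Suc n} \<times> {..<Suc n}. emeasure lborel (A p))"
  proof -
    have "(\<Prod>p\<in>{..<Suc n} \<times> {..<Suc n}. emeasure lborel (A p)) = (\<Prod>i<Suc n. \<Prod>j<Suc n. emeasure lborel (A (i, j)))"
      by (simp add: prod.cartesian_product del: prod.lessThan_Suc)
    also have "\<dots> = (\<Prod>i<n. (\<Prod>j<n. emeasure lborel (A (i, j))) * emeasure lborel (A (i, n))) * ((\<Prod>j<n. emeasure lborel (A (n, j))) * emeasure lborel (A (n, n)))"
      by simp
    also have "\<dots> = (\<Prod>p\<in>{..<n} \<times> {..<n}. emeasure lborel (A p)) * (\<Prod>i<n. emeasure lborel (A (i, n))) * ((\<Prod>j<n. emeasure lborel (A (n, j))) * emeasure lborel (A (n, n)))"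
      by (simp add: prod.distrib prod.cartesian_product)
    finally show ?thesis by (simp add: mult_ac)
  qed
  finally show "emeasure (distr ?Q (msp (Suc n)) ?bd) (Pi\<^sub>E ({..<Suc n} \<times> {..<Suc n}) A) = (\<Prod>p\<in>{..<Suc n} \<times> {..<Suc n}. emeasure lborel (A p))" .
qed auto

text \<open>The derivative is a limit of difference quotients with steps 1 / (m + 1), so
  measurability of the evaluations is enough and coefficients need not be discussed.\<close>

lemma poly_pderiv_measurable:
  fixes P :: "'a \<Rightarrow> complex poly" and x :: "'a \<Rightarrow> complex"
  assumes P: "\<And>y. y \<in> borel_measurable M \<Longrightarrow> (\<lambda>\<omega>. poly (P \<omega>) (y \<omega>)) \<in> borel_measurable M"
    and x[measurable]: "x \<in> borel_measurable M"
  shows "(\<lambda>\<omega>. poly (pderiv (P \<omega>)) (x \<omega>)) \<in> borel_measurable M"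
proof (rule borel_measurable_LIMSEQ_metric)
  define d where "d = (\<lambda>m. complex_of_real (1 / real (Suc m)))"
  show "(\<lambda>\<omega>. (poly (P \<omega>) (x \<omega> + d m) - poly (P \<omega>) (x \<omega>)) / d m) \<in> borel_measurable M" for m
    using P[of x] P[of "\<lambda>\<omega>. x \<omega> + d m"] by measurable
  fix \<omega>
  have "((\<lambda>h. (poly (P \<omega>) (x \<omega> + h) - poly (P \<omega>) (x \<omega>)) / h) \<longlongrightarrow> poly (pderiv (P \<omega>)) (x \<omega>)) (at 0)"
    using poly_DERIV[of "P \<omega>" "x \<omega>"] by (simp add: DERIV_def)
  moreover have "filterlim d (at 0) sequentially"
  proof -
    have "d \<longlonglongrightarrow> of_real 0" unfolding d_def by (intro tendsto_of_real LIMSEQ_Suc lim_1_over_n)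
    moreover have "d m \<noteq> 0" for m unfolding d_def by (simp del: of_nat_Suc)
    ultimately show ?thesis unfolding filterlim_at by (simp add: eventually_sequentially)
  qed
  ultimately show "(\<lambda>m. (poly (P \<omega>) (x \<omega> + d m) - poly (P \<omega>) (x \<omega>)) / d m) \<longlonglongrightarrow> poly (pderiv (P \<omega>)) (x \<omega>)"
    by (rule filterlim_compose)
qed

text \<open>
  For an eigenvalue \<open>x\<close> of the bordered matrix that is not an eigenvalue of \<open>D\<close>, the corner entry
  is the rational function \<open>corner n D b c x\<close> of \<open>x\<close>.
\<close>

definition corner :: "nat \<Rightarrow> cmatrix \<Rightarrow> cvec \<Rightarrow> cvec \<Rightarrow> complex \<Rightarrow> complex" where
  "corner n D b c x = poly (charp (Suc n) (bord n D b c 0)) x / poly (charp n D) x"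

text \<open>The derivative of \<open>corner\<close> by the quotient rule, written out so that it is
  visibly measurable in all its arguments jointly.\<close>

definition corner' :: "nat \<Rightarrow> cmatrix \<Rightarrow> cvec \<Rightarrow> cvec \<Rightarrow> complex \<Rightarrow> complex" where
  "corner' n D b c x =
    (poly (pderiv (charp (Suc n) (bord n D b c 0))) x * poly (charp n D) x
      - poly (charp (Suc n) (bord n D b c 0)) x * poly (pderiv (charp n D)) x) / (poly (charp n D) x * poly (charp n D) x)"

lemma charp_bord_eq: "charp (Suc n) (bord n D b c a) = charp (Suc n) (bord n D b c 0) - Polynomial.smult a (charp n D)"
  by (rule poly_ext) (simp add: charp_bord_corner[of n D b c a])

text \<open>The solutions of \<open>corner n D b c x = a\<close> are eigenvalues of the bordered
  matrix with corner \<open>a\<close>, whose characteristic polynomial has degree n + 1.\<close>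

lemma corner_area_le:
  assumes \<psi>: "\<psi> \<in> borel_measurable borel"
  shows "(\<integral>\<^sup>+ x. ennreal ((cmod (corner' n D b c x))\<^sup>2) * indicator {x. poly (charp n D) x \<noteq> 0} x * \<psi> (corner n D b c x) \<partial>lborel)
    \<le> of_nat (Suc n) * (\<integral>\<^sup>+ a. \<psi> a \<partial>lborel)"
proof (rule nn_integral_area_le)
  have pm[measurable]: "poly p \<in> borel_measurable borel" for p :: "complex poly"
    by (intro borel_measurable_continuous_onI continuous_on_poly continuous_on_id)
  show "open {x. poly (charp n D) x \<noteq> 0}"
    by (intro open_Collect_neq continuous_on_poly continuous_on_id continuous_on_const)
  show "(corner n D b c has_field_derivative corner' n D b c x) (at x)" if "x \<in> {x. poly (charp n D) x \<noteq> 0}" for x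
    unfolding corner_def[abs_def] corner'_def using that
    by (auto intro!: DERIV_divide poly_DERIV)
  show "corner' n D b c \<in> borel_measurable borel" "corner n D b c \<in> borel_measurable borel"
    unfolding corner_def[abs_def] corner'_def[abs_def] by measurable
  fix a
  have sub: "{x \<in> {x. poly (charp n D) x \<noteq> 0}. corner n D b c x = a} \<subseteq> {x. poly (charp (Suc n) (bord n D b c a)) x = 0}"
    by (auto simp: corner_def charp_bord_corner[of n D b c a] field_simps)
  have fin: "finite {x. poly (charp (Suc n) (bord n D b c a)) x = 0}"
    by (rule poly_roots_finite[OF charp_nonzero])
  show "finite {x \<in> {x. poly (charp n D) x \<noteq> 0}. corner n D b c x = a}"
    using finite_subset[OF sub fin] .
  have "card {x. poly (charp (Suc n) (bord n D b c a)) x = 0} \<le> Suc n"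
    using card_poly_roots_bound[OF charp_nonzero, of "Suc n" "bord n D b c a"] charp_monic(1)[of "Suc n"] by simp
  then show "card {x \<in> {x. poly (charp n D) x \<noteq> 0}. corner n D b c x = a} \<le> Suc n"
    using card_mono[OF fin sub] by simp
qed (rule \<psi>)

text \<open>With c = (x - D) u the vector (u, 1) becomes an eigenvector, which gives the first two
  claims. For the third, let P be the polynomial for corner 0, q that of D and a = h(x): then h' q =
  P' - a q' at x, the derivative of the bordered characteristic polynomial at its root x. Since that
  polynomial is (X - x) times the one of B, the derivative is the latter's value at x.\<close>

lemma corner_deflated:
  fixes u b :: cvec
  assumes q: "poly (charp n D) x \<noteq> 0"
  defines "c \<equiv> mulv n (\<lambda>i j. (if i = j then x else 0) - D (i, j)) u"
  defines "B \<equiv> \<lambda>p\<in>{..<n} \<times> {..<n}. D p + - (u (fst p) * b (snd p))"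
  shows "bord n D b c (corner n D b c x) = deflated n u x B b"
    and "charp (Suc n) (bord n D b c (corner n D b c x)) = [:-x, 1:] * charp n B"
    and "corner' n D b c x * poly (charp n D) x = poly (charp n B) x"
proof -
  define a where "a = x - (\<Sum>j<n. b j * u j)"
  have cu: "c i = x * u i - (\<Sum>j<n. D (i, j) * u j)" if "i < n" for i
  proof -
    have "c i = (\<Sum>j<n. (if j = i then x * u i else 0) - D (i, j) * u j)"
      using that by (auto simp: c_def mulv_def algebra_simps intro!: sum.cong)
    then show ?thesis using that by (simp add: sum_subtractf)
  qed
  have ch: "charp (Suc n) (bord n D b c a) = [:-x, 1:] * charp n B"
    by (rule charp_eigen_bord[where u = u]) (auto simp: B_def cu a_def)
  have "poly (charp (Suc n) (bord n D b c a)) x = 0" unfolding ch by simp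
  then have ca: "corner n D b c x = a"
    using q by (simp add: corner_def charp_bord_corner[of n D b c a] field_simps)
  have "bord n D b c a = deflated n u x B b"
    unfolding deflated_def bord_def
    by (auto simp: fun_eq_iff restrict_def B_def cu a_def)
  then show "bord n D b c (corner n D b c x) = deflated n u x B b" by (simp add: ca)
  show "charp (Suc n) (bord n D b c (corner n D b c x)) = [:-x, 1:] * charp n B" by (simp add: ca ch)
  let ?P = "charp (Suc n) (bord n D b c 0)" and ?q = "charp n D"
  have P: "poly ?P x = a * poly ?q x" using ca q by (simp add: corner_def field_simps)
  have "poly (pderiv ?P) x - a * poly (pderiv ?q) x = poly (pderiv (charp (Suc n) (bord n D b c a))) x"
    by (simp add: charp_bord_eq[of n D b c a] pderiv_diff pderiv_smult)
  also have "\<dots> = poly (charp n B) x"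
    unfolding ch by (simp only: pderiv_mult) (simp add: pderiv_pCons)
  finally have "poly (pderiv ?P) x - a * poly (pderiv ?q) x = poly (charp n B) x" .
  moreover have "corner' n D b c x * poly ?q x = poly (pderiv ?P) x - a * poly (pderiv ?q) x"
    using q by (simp add: corner'_def P field_simps)
  ultimately show "corner' n D b c x * poly (charp n D) x = poly (charp n B) x" by simp
qed

section \<open>Deflation of one eigenvalue\<close>

text \<open>A deficit on a set would have to be compensated on its complement, which domination
  forbids; finiteness allows the complement's mass to be cancelled.\<close>

lemma measure_eqI_le_total:
  assumes s: "sets M = sets N" and le: "\<And>B. B \<in> sets M \<Longrightarrow> emeasure M B \<le> emeasure N B"
    and tot: "emeasure M (space M) = emeasure N (space N)" and fin: "emeasure N (space N) < \<infinity>"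
  shows "M = N"
proof (rule measure_eqI[OF s])
  fix B assume B: "B \<in> sets M"
  have sp: "space M = space N" using s by (rule sets_eq_imp_space_eq)
  have BN: "B \<in> sets N" using B s by simp
  have sub: "B \<subseteq> space N" using BN by (rule sets.sets_into_space)
  have fN: "emeasure N X \<noteq> \<infinity>" if "X \<in> sets N" for X
  proof -
    have "emeasure N X \<le> emeasure N (space N)" by (rule emeasure_mono) (use that sets.sets_into_space in auto)
    then show ?thesis using fin by (auto simp: top_unique)
  qed
  have "emeasure N B + emeasure N (space N - B) = emeasure N (space N)"
    using BN sub by (subst plus_emeasure) (auto intro!: arg_cong[where f = "emeasure N"])
  also have "\<dots> = emeasure M B + emeasure M (space N - B)"
    unfolding tot[symmetric] using B sub sp by (subst plus_emeasure) (auto intro!: arg_cong[where f = "emeasure M"] simp: s)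
  also have "\<dots> \<le> emeasure M B + emeasure N (space N - B)"
    using B BN s by (intro add_left_mono le) auto
  finally have "emeasure N B \<le> emeasure M B"
    using fN[of "space N - B"] BN by (simp add: ennreal_add_left_cancel_le add.commute[of _ "emeasure N (space N - B)"])
  then show "emeasure M B = emeasure N B" using le[OF B] by (rule antisym[rotated])
qed

lemma cspace_component_of:
  "X \<in> measurable N (cspace I) \<Longrightarrow> i \<in> I \<Longrightarrow> (\<lambda>\<omega>. X \<omega> i) \<in> borel_measurable N"
  by (rule measurable_compose[OF _ cspace_component])

lemma corner_measurable:
  assumes D: "D \<in> measurable N (msp n)" and b: "b \<in> measurable N (vsp n)" and c: "c \<in> measurable N (vsp n)"
    and x: "x \<in> borel_measurable N"
  shows "(\<lambda>\<omega>. poly (charp n (D \<omega>)) (x \<omega>)) \<in> borel_measurable N"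
    and "(\<lambda>\<omega>. corner n (D \<omega>) (b \<omega>) (c \<omega>) (x \<omega>)) \<in> borel_measurable N"
    and "(\<lambda>\<omega>. corner' n (D \<omega>) (b \<omega>) (c \<omega>) (x \<omega>)) \<in> borel_measurable N"
    and "(\<lambda>\<omega>. bord n (D \<omega>) (b \<omega>) (c \<omega>) (x \<omega>)) \<in> measurable N (msp (Suc n))"
proof -
  have Dc: "(\<lambda>\<omega>. D \<omega> (i, j)) \<in> borel_measurable N" if "i < n" "j < n" for i j
    using that by (intro cspace_component_of[OF D]) auto
  have bc: "(\<lambda>\<omega>. b \<omega> i) \<in> borel_measurable N" "(\<lambda>\<omega>. c \<omega> i) \<in> borel_measurable N" if "i < n" for i
    using that by (auto intro!: cspace_component_of[OF b] cspace_component_of[OF c])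
  have bm: "(\<lambda>\<omega>. bord n (D \<omega>) (b \<omega>) (c \<omega>) (y \<omega>)) \<in> measurable N (msp (Suc n))" if "y \<in> borel_measurable N" for y
    using that by (intro bord_measurable Dc bc)
  then show "(\<lambda>\<omega>. bord n (D \<omega>) (b \<omega>) (c \<omega>) (x \<omega>)) \<in> measurable N (msp (Suc n))" using x .
  have q: "(\<lambda>\<omega>. poly (charp n (D \<omega>)) (y \<omega>)) \<in> borel_measurable N" if "y \<in> borel_measurable N" for y
    using that by (intro poly_charp_measurable Dc)
  have P: "(\<lambda>\<omega>. poly (charp (Suc n) (bord n (D \<omega>) (b \<omega>) (c \<omega>) 0)) (y \<omega>)) \<in> borel_measurable N" if "y \<in> borel_measurable N" for y
    using that by (intro poly_charp_measurable cspace_component_of[OF bm]) auto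
  note m = q[OF x] P[OF x] poly_pderiv_measurable[OF q x] poly_pderiv_measurable[OF P x]
  show "(\<lambda>\<omega>. poly (charp n (D \<omega>)) (x \<omega>)) \<in> borel_measurable N" by (rule q[OF x])
  show "(\<lambda>\<omega>. corner n (D \<omega>) (b \<omega>) (c \<omega>) (x \<omega>)) \<in> borel_measurable N"
    unfolding corner_def by (intro borel_measurable_divide m)
  show "(\<lambda>\<omega>. corner' n (D \<omega>) (b \<omega>) (c \<omega>) (x \<omega>)) \<in> borel_measurable N"
    unfolding corner'_def by (intro borel_measurable_divide borel_measurable_diff borel_measurable_times m)
qed

text \<open>The indicator removes the finitely many zeros of the denominator, where
  \<open>corner\<close> and \<open>corner'\<close> are 0 by the convention for division.\<close>

definition cweight :: "nat \<Rightarrow> cmatrix \<Rightarrow> cvec \<Rightarrow> cvec \<Rightarrow> complex \<Rightarrow> ennreal" where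
  "cweight n D b c x = ennreal ((cmod (corner' n D b c x))\<^sup>2) * indicator {x. poly (charp n D) x \<noteq> 0} x"

definition cmap :: "nat \<Rightarrow> cmatrix \<Rightarrow> cvec \<Rightarrow> cvec \<Rightarrow> complex \<Rightarrow> cmatrix" where
  "cmap n D b c x = bord n D b c (corner n D b c x)"

lemma cweight_measurable [measurable (raw)]:
  assumes "D \<in> measurable N (msp n)" "b \<in> measurable N (vsp n)" "c \<in> measurable N (vsp n)" "x \<in> borel_measurable N"
  shows "(\<lambda>\<omega>. cweight n (D \<omega>) (b \<omega>) (c \<omega>) (x \<omega>)) \<in> borel_measurable N"
proof -
  note [measurable] = corner_measurable[OF assms]
  have "(\<lambda>\<omega>. indicator {x. poly (charp n (D \<omega>)) x \<noteq> 0} (x \<omega>) :: ennreal) = (\<lambda>\<omega>. if poly (charp n (D \<omega>)) (x \<omega>) = 0 then 0 else 1)"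
    by (auto simp: indicator_def)
  also have "\<dots> \<in> borel_measurable N" by measurable
  finally show ?thesis unfolding cweight_def by measurable
qed

lemma cmap_measurable [measurable (raw)]:
  assumes "D \<in> measurable N (msp n)" "b \<in> measurable N (vsp n)" "c \<in> measurable N (vsp n)" "x \<in> borel_measurable N"
  shows "(\<lambda>\<omega>. cmap n (D \<omega>) (b \<omega>) (c \<omega>) (x \<omega>)) \<in> measurable N (msp (Suc n))"
  unfolding cmap_def by (rule corner_measurable(4)[OF assms(1-3) corner_measurable(2)[OF assms]])

abbreviation dbc :: "nat \<Rightarrow> (cmatrix \<times> cvec \<times> cvec) measure" where
  "dbc n \<equiv> msp n \<Otimes>\<^sub>M (vsp n \<Otimes>\<^sub>M vsp n)"

text \<open>\<open>corner_area_le\<close> is integrated over D, b, c. The factor reflects that a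
  matrix can arise once for each of its at most n + 1 eigenvalues.\<close>

lemma deflation_le:
  assumes \<phi>[measurable]: "\<phi> \<in> borel_measurable (msp (Suc n))"
  shows "(\<integral>\<^sup>+ ((D, b, c), x). cweight n D b c x * \<phi> (cmap n D b c x) \<partial>(dbc n \<Otimes>\<^sub>M lborel))
    \<le> of_nat (Suc n) * (\<integral>\<^sup>+ X. \<phi> X \<partial>msp (Suc n))"
proof -
  have m1: "(\<lambda>((D, b, c), x). cweight n D b c x * \<phi> (cmap n D b c x)) \<in> borel_measurable (dbc n \<Otimes>\<^sub>M lborel)"
    unfolding case_prod_beta' by measurable
  have m2: "(\<lambda>((D, b, c), a). \<phi> (bord n D b c a)) \<in> borel_measurable (dbc n \<Otimes>\<^sub>M lborel)"
    using measurable_compose[OF bord_pair_measurable \<phi>] by (simp add: case_prod_beta')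
  have "(\<integral>\<^sup>+ ((D, b, c), x). cweight n D b c x * \<phi> (cmap n D b c x) \<partial>(dbc n \<Otimes>\<^sub>M lborel))
      = (\<integral>\<^sup>+ (D, b, c). (\<integral>\<^sup>+ x. cweight n D b c x * \<phi> (cmap n D b c x) \<partial>lborel) \<partial>dbc n)"
    by (subst lborel.nn_integral_fst[OF m1, symmetric]) (simp add: case_prod_beta')
  also have "\<dots> \<le> (\<integral>\<^sup>+ (D, b, c). of_nat (Suc n) * (\<integral>\<^sup>+ a. \<phi> (bord n D b c a) \<partial>lborel) \<partial>dbc n)"
  proof (rule nn_integral_mono, clarify)
    fix D b c assume "(D, b, c) \<in> space (dbc n)"
    then have sp: "D \<in> space (msp n)" "b \<in> space (vsp n)" "c \<in> space (vsp n)" by (auto simp: space_pair_measure)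
    have "(\<lambda>a. \<phi> (bord n D b c a)) \<in> borel_measurable borel"
      using measurable_compose[OF corner_measurable(4)[of "\<lambda>_. D" borel n "\<lambda>_. b" "\<lambda>_. c" "\<lambda>a. a"] \<phi>] sp by simp
    from corner_area_le[OF this, of n D b c]
    show "(\<integral>\<^sup>+ x. cweight n D b c x * \<phi> (cmap n D b c x) \<partial>lborel) \<le> of_nat (Suc n) * (\<integral>\<^sup>+ a. \<phi> (bord n D b c a) \<partial>lborel)"
      by (simp add: cweight_def cmap_def)
  qed
  also have "\<dots> = of_nat (Suc n) * (\<integral>\<^sup>+ (D, b, c). (\<integral>\<^sup>+ a. \<phi> (bord n D b c a) \<partial>lborel) \<partial>dbc n)"
    unfolding case_prod_beta'
    using lborel.borel_measurable_nn_integral_fst[OF m2] by (intro nn_integral_cmult) (simp add: case_prod_beta')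
  also have "(\<integral>\<^sup>+ (D, b, c). (\<integral>\<^sup>+ a. \<phi> (bord n D b c a) \<partial>lborel) \<partial>dbc n) = (\<integral>\<^sup>+ ((D, b, c), a). \<phi> (bord n D b c a) \<partial>(dbc n \<Otimes>\<^sub>M lborel))"
    by (subst lborel.nn_integral_fst[OF m2, symmetric]) (simp add: case_prod_beta')
  also have "\<dots> = (\<integral>\<^sup>+ X. \<phi> X \<partial>distr (dbc n \<Otimes>\<^sub>M lborel) (msp (Suc n)) (\<lambda>((D, b, c), a). bord n D b c a))"
    by (subst nn_integral_distr[OF bord_pair_measurable]) (simp_all add: case_prod_beta')
  also have "\<dots> = (\<integral>\<^sup>+ X. \<phi> X \<partial>msp (Suc n))" by (simp only: distr_bord)
  finally show ?thesis .
qed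

lemma nn_integral_msp_gauss: "(\<integral>\<^sup>+ X. mgauss n X \<partial>msp n) = ennreal (pi ^ (n * n))"
  using nn_integral_cspace_gauss[of "{..<n} \<times> {..<n}" 1] by (simp add: gauss_def)

text \<open>
  The inequality \<open>deflation_le\<close> holds for all test functions, so equality of the total masses forces
  equality of the two measures. This avoids proving that a Gaussian matrix almost surely has simple
  spectrum and shares no eigenvalue with its principal submatrix.
\<close>

lemma deflation_eq:
  assumes tot: "(\<integral>\<^sup>+ ((D, b, c), x). cweight n D b c x * mgauss (Suc n) (cmap n D b c x) \<partial>(dbc n \<Otimes>\<^sub>M lborel))
      = of_nat (Suc n) * ennreal (pi ^ (Suc n * Suc n))"
    and K[measurable]: "K \<in> borel_measurable (msp (Suc n))"
  shows "(\<integral>\<^sup>+ ((D, b, c), x). cweight n D b c x * (mgauss (Suc n) (cmap n D b c x) * K (cmap n D b c x)) \<partial>(dbc n \<Otimes>\<^sub>M lborel))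
    = of_nat (Suc n) * (\<integral>\<^sup>+ X. mgauss (Suc n) X * K X \<partial>msp (Suc n))"
proof -
  let ?g = "mgauss (Suc n)"
  define t where "t = (\<lambda>((D, b, c), x). cmap n D b c x)"
  define w where "w = (\<lambda>((D, b, c), x). cweight n D b c x * ?g (cmap n D b c x))"
  have t[measurable]: "t \<in> measurable (dbc n \<Otimes>\<^sub>M lborel) (msp (Suc n))" unfolding t_def case_prod_beta' by measurable
  have w[measurable]: "w \<in> borel_measurable (dbc n \<Otimes>\<^sub>M lborel)" unfolding w_def case_prod_beta' by measurable
  \<comment> \<open>\<open>M\<close> and \<open>N\<close> are the two sides of the claim as measures
    on matrices; \<open>deflation_le\<close> on indicators gives domination, and \<open>tot\<close>
    gives equal masses.\<close>
  define M where "M = distr (density (dbc n \<Otimes>\<^sub>M lborel) w) (msp (Suc n)) t"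
  define N where "N = density (msp (Suc n)) (\<lambda>X. of_nat (Suc n) * ?g X)"
  have iM: "(\<integral>\<^sup>+ X. f X \<partial>M) = (\<integral>\<^sup>+ ((D, b, c), x). cweight n D b c x * (?g (cmap n D b c x) * f (cmap n D b c x)) \<partial>(dbc n \<Otimes>\<^sub>M lborel))"
    if [measurable]: "f \<in> borel_measurable (msp (Suc n))" for f
    unfolding M_def by (subst nn_integral_distr) (auto simp: nn_integral_density w_def t_def case_prod_beta' mult_ac)
  have iN: "(\<integral>\<^sup>+ X. f X \<partial>N) = of_nat (Suc n) * (\<integral>\<^sup>+ X. ?g X * f X \<partial>msp (Suc n))"
    if [measurable]: "f \<in> borel_measurable (msp (Suc n))" for f
    unfolding N_def by (subst nn_integral_density) (auto simp: mult.assoc nn_integral_cmult simp del: of_nat_Suc)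
  have "M = N"
  proof (rule measure_eqI_le_total)
    show s: "sets M = sets N" by (simp add: M_def N_def)
    show "emeasure M B \<le> emeasure N B" if B: "B \<in> sets M" for B
    proof -
      have [measurable]: "B \<in> sets (msp (Suc n))" using B by (simp add: M_def)
      have "emeasure M B = (\<integral>\<^sup>+ X. indicator B X \<partial>M)" using B by simp
      also have "\<dots> \<le> of_nat (Suc n) * (\<integral>\<^sup>+ X. ?g X * indicator B X \<partial>msp (Suc n))"
        by (subst iM) (auto intro!: deflation_le[where \<phi> = "\<lambda>X. ?g X * indicator B X"] simp del: of_nat_Suc)
      also have "\<dots> = (\<integral>\<^sup>+ X. indicator B X \<partial>N)" by (subst iN) auto
      also have "\<dots> = emeasure N B" using B s by simp
      finally show ?thesis .
    qed
    have "emeasure M (space M) = (\<integral>\<^sup>+ X. 1 \<partial>M)" by simp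
    also have "\<dots> = of_nat (Suc n) * ennreal (pi ^ (Suc n * Suc n))"
      by (subst iM) (use tot in simp_all)
    finally have M: "emeasure M (space M) = of_nat (Suc n) * ennreal (pi ^ (Suc n * Suc n))" .
    have "emeasure N (space N) = (\<integral>\<^sup>+ X. 1 \<partial>N)" by simp
    also have "\<dots> = of_nat (Suc n) * ennreal (pi ^ (Suc n * Suc n))"
      by (subst iN) (use nn_integral_msp_gauss[of "Suc n"] in simp_all)
    finally have N: "emeasure N (space N) = of_nat (Suc n) * ennreal (pi ^ (Suc n * Suc n))" .
    show "emeasure M (space M) = emeasure N (space N)" unfolding M N ..
    show "emeasure N (space N) < \<infinity>" unfolding N by (simp add: ennreal_mult_less_top ennreal_of_nat_eq_real_of_nat del: of_nat_Suc)
  qed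
  then show ?thesis using iM[OF K] iN[OF K] by simp
qed

section \<open>Integrating out everything but the eigenvalue and the deflated block\<close>

lemma charp_bord_zero: "charp (Suc n) (bord n B (\<lambda>_. 0) (\<lambda>_. 0) x) = [:-x, 1:] * charp n B"
  by (rule charp_eigen_bord[where u = "\<lambda>_. 0"]) auto

text \<open>Polynomials carry no sigma-algebra here; \<open>H\<close> is measurable only along
  characteristic polynomials. The product is therefore realised as the characteristic polynomial of
  a matrix bordered by zeros.\<close>

lemma charp_shift_measurable:
  assumes H: "(\<lambda>X. H (charp (Suc n) X)) \<in> borel_measurable (msp (Suc n))"
    and "B \<in> measurable N (msp n)" "x \<in> borel_measurable N"
  shows "(\<lambda>\<omega>. H ([:- x \<omega>, 1:] * charp n (B \<omega>)) :: ennreal) \<in> borel_measurable N"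
proof -
  have "(\<lambda>\<omega>. bord n (B \<omega>) (\<lambda>_. 0) (\<lambda>_. 0) (x \<omega>)) \<in> measurable N (msp (Suc n))"
    using assms(3) by (intro bord_measurable cspace_component_of[OF assms(2)]) auto
  from measurable_compose[OF this H] show ?thesis by (simp only: charp_bord_zero)
qed

text \<open>Each substitution dictates which variables must be held fixed: \<open>c\<close> becomes
  \<open>u\<close> at fixed D, b, x, then \<open>D\<close> becomes \<open>B\<close> at fixed u, b,
  x, and only then are \<open>b\<close> and finally \<open>u\<close> integrated out. The exchanges
  of integrals serve this order.\<close>

theorem deflation_formula:
  fixes H :: "complex poly \<Rightarrow> ennreal"
  assumes H: "(\<lambda>X. H (charp (Suc n) X)) \<in> borel_measurable (msp (Suc n))"
  shows "(\<integral>\<^sup>+ ((D, b, c), x). cweight n D b c x * (mgauss (Suc n) (cmap n D b c x) * H (charp (Suc n) (cmap n D b c x))) \<partial>(dbc n \<Otimes>\<^sub>M lborel))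
    = ennreal (pi ^ (2 * n) / fact n) * (\<integral>\<^sup>+ x. ennreal (exp (- (cmod x)\<^sup>2)) *
        (\<integral>\<^sup>+ B. ennreal ((cmod (poly (charp n B) x))\<^sup>2) * H ([:-x, 1:] * charp n B) * mgauss n B \<partial>msp n) \<partial>lborel)"
proof -
  let ?g = "mgauss (Suc n)"
  let ?I = "{..<n} \<times> {..<n}"
  interpret V: sigma_finite_measure "vsp n" by (rule sigma_finite_cspace) simp
  interpret M: sigma_finite_measure "msp n" by (rule sigma_finite_cspace) simp
  interpret VV: sigma_finite_measure "vsp n \<Otimes>\<^sub>M vsp n" by (intro sigma_finite_pair_measure sigma_finite_cspace) auto
  define f where "f D b c x = cweight n D b c x * (?g (cmap n D b c x) * H (charp (Suc n) (cmap n D b c x)))" for D b c x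
  have f[measurable (raw)]: "(\<lambda>\<omega>. f (D \<omega>) (b \<omega>) (c \<omega>) (x \<omega>)) \<in> borel_measurable N"
    if [measurable]: "D \<in> measurable N (msp n)" "b \<in> measurable N (vsp n)" "c \<in> measurable N (vsp n)" "x \<in> borel_measurable N" for D b c x N
    unfolding f_def using measurable_compose[OF cmap_measurable[OF that] H] by measurable
  define \<Theta> where "\<Theta> x B = ennreal ((cmod (poly (charp n B) x))\<^sup>2) * H ([:-x, 1:] * charp n B)" for x B
  let ?J = "\<lambda>x. \<integral>\<^sup>+ B. \<Theta> x B * gauss ?I B \<partial>msp n"
  have \<Theta>[measurable (raw)]: "(\<lambda>\<omega>. \<Theta> (x \<omega>) (B \<omega>)) \<in> borel_measurable N"
    if "B \<in> measurable N (msp n)" "x \<in> borel_measurable N" for x B N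
  proof -
    have z: "(\<lambda>_. \<lambda>i\<in>{..<n}. 0) \<in> measurable N (vsp n)" by (intro cspace_restrictI) auto
    note [measurable] = corner_measurable(1)[OF that(1) z z that(2)]
    note [measurable] = charp_shift_measurable[OF H that]
    show ?thesis unfolding \<Theta>_def by measurable
  qed
  define E where "E x u B b = \<Theta> x B * ?g (deflated n u x B b)" for x u B b
  have E[measurable (raw)]: "(\<lambda>\<omega>. E (x \<omega>) (u \<omega>) (B \<omega>) (b \<omega>)) \<in> borel_measurable N"
    if [measurable]: "B \<in> measurable N (msp n)" "x \<in> borel_measurable N" "u \<in> measurable N (vsp n)" "b \<in> measurable N (vsp n)" for x B u b N
  proof -
    have [measurable]: "(\<lambda>\<omega>. deflated n (u \<omega>) (x \<omega>) (B \<omega>) (b \<omega>)) \<in> measurable N (msp (Suc n))"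
      by (intro deflated_measurable cspace_component_of[OF that(1)] cspace_component_of[OF that(3)] cspace_component_of[OF that(4)] that(2)) auto
    show ?thesis unfolding E_def by measurable
  qed
  define sh where "sh u b D = (\<lambda>p\<in>?I. D p + - (u (fst p) * b (snd p)))" for u b :: cvec and D :: cmatrix
  have sh[measurable (raw)]: "(\<lambda>\<omega>. sh (u \<omega>) (b \<omega>) (D \<omega>)) \<in> measurable N (msp n)"
    if "D \<in> measurable N (msp n)" "u \<in> measurable N (vsp n)" "b \<in> measurable N (vsp n)" for D u b N
    unfolding sh_def
    by (intro cspace_restrictI borel_measurable_add borel_measurable_uminus borel_measurable_times
        cspace_component_of[OF that(1)] cspace_component_of[OF that(2)] cspace_component_of[OF that(3)]) auto

  have "(\<integral>\<^sup>+ ((D, b, c), x). f D b c x \<partial>(dbc n \<Otimes>\<^sub>M lborel))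
      = (\<integral>\<^sup>+ (D, b, c). (\<integral>\<^sup>+ x. f D b c x \<partial>lborel) \<partial>dbc n)"
  proof -
    have "(\<lambda>((D, b, c), x). f D b c x) \<in> borel_measurable (dbc n \<Otimes>\<^sub>M lborel)"
      unfolding case_prod_beta' by measurable
    from lborel.nn_integral_fst[OF this] show ?thesis by (simp add: case_prod_beta')
  qed
  also have "\<dots> = (\<integral>\<^sup>+ D. (\<integral>\<^sup>+ (b, c). (\<integral>\<^sup>+ x. f D b c x \<partial>lborel) \<partial>(vsp n \<Otimes>\<^sub>M vsp n)) \<partial>msp n)"
  proof -
    have "(\<lambda>(D, b, c). (\<integral>\<^sup>+ x. f D b c x \<partial>lborel)) \<in> borel_measurable (dbc n)"
      unfolding case_prod_beta' by measurable
    from VV.nn_integral_fst[OF this] show ?thesis by (simp add: case_prod_beta')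
  qed
  also have "\<dots> = (\<integral>\<^sup>+ D. (\<integral>\<^sup>+ x. (\<integral>\<^sup>+ (b, c). f D b c x \<partial>(vsp n \<Otimes>\<^sub>M vsp n)) \<partial>lborel) \<partial>msp n)"
    unfolding case_prod_beta'
    by (rule nn_integral_cong, rule nn_integral_swap[OF VV.sigma_finite_measure_axioms sigma_finite_lborel]) measurable
  also have "\<dots> = (\<integral>\<^sup>+ D. (\<integral>\<^sup>+ x. (\<integral>\<^sup>+ b. (\<integral>\<^sup>+ c. f D b c x \<partial>vsp n) \<partial>vsp n) \<partial>lborel) \<partial>msp n)"
  proof (rule nn_integral_cong, rule nn_integral_cong)
    fix D x assume [measurable]: "D \<in> space (msp n)"
    have "(\<lambda>(b, c). f D b c x) \<in> borel_measurable (vsp n \<Otimes>\<^sub>M vsp n)" by measurable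
    from V.nn_integral_fst[OF this] show "(\<integral>\<^sup>+ (b, c). f D b c x \<partial>(vsp n \<Otimes>\<^sub>M vsp n)) = (\<integral>\<^sup>+ b. (\<integral>\<^sup>+ c. f D b c x \<partial>vsp n) \<partial>vsp n)"
      by simp
  qed
  also have "\<dots> = (\<integral>\<^sup>+ D. (\<integral>\<^sup>+ x. (\<integral>\<^sup>+ b. (\<integral>\<^sup>+ u. E x u (sh u b D) b \<partial>vsp n) \<partial>vsp n) \<partial>lborel) \<partial>msp n)"
  proof (rule nn_integral_cong, rule nn_integral_cong_AE)
    fix D assume D[measurable]: "D \<in> space (msp n)"
    \<comment> \<open>The substitution c = (x - D) u is invertible unless x is an eigenvalue of
      \<open>D\<close>, which excludes finitely many x.\<close>
    have ae: "AE x in lborel. x \<notin> {x. poly (charp n D) x = 0}"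
      using poly_roots_finite[OF charp_nonzero] by (intro AE_not_in finite_imp_null_set_lborel)
    show "AE x in lborel. (\<integral>\<^sup>+ b. (\<integral>\<^sup>+ c. f D b c x \<partial>vsp n) \<partial>vsp n) = (\<integral>\<^sup>+ b. (\<integral>\<^sup>+ u. E x u (sh u b D) b \<partial>vsp n) \<partial>vsp n)"
    proof (rule AE_mp[OF ae], rule AE_I2, rule impI, rule nn_integral_cong)
      fix x b assume "x \<notin> {x. poly (charp n D) x = 0}" and b[measurable]: "b \<in> space (vsp n)"
      then have q: "poly (charp n D) x \<noteq> 0" by simp
      let ?m = "\<lambda>i j. (if i = j then x else 0) - D (i, j)"
      let ?d = "ennreal ((cmod (poly (charp n D) x))\<^sup>2)"
      have fc[measurable]: "(\<lambda>c. f D b c x) \<in> borel_measurable (vsp n)" by measurable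
      have "(\<integral>\<^sup>+ c. f D b c x \<partial>vsp n) = ?d * (\<integral>\<^sup>+ u. f D b (mulv n ?m u) x \<partial>vsp n)"
        using cspace_linear[OF _ fc, of ?m] q unfolding poly_charp[symmetric] by simp
      also have "\<dots> = (\<integral>\<^sup>+ u. ?d * f D b (mulv n ?m u) x \<partial>vsp n)"
        using measurable_compose[OF mulv_measurable fc] by (rule nn_integral_cmult[symmetric])
      also have "\<dots> = (\<integral>\<^sup>+ u. E x u (sh u b D) b \<partial>vsp n)"
      proof (rule nn_integral_cong)
        fix u
        have 1: "cmap n D b (mulv n ?m u) x = deflated n u x (sh u b D) b"
          and 2: "charp (Suc n) (cmap n D b (mulv n ?m u) x) = [:-x, 1:] * charp n (sh u b D)"
          and 3: "corner' n D b (mulv n ?m u) x * poly (charp n D) x = poly (charp n (sh u b D)) x"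
          using corner_deflated[OF q, where u = u and b = b] by (simp_all only: cmap_def sh_def)
        \<comment> \<open>The Jacobian of the linear substitution and the weight from the area
          formula combine into the squared modulus of the characteristic polynomial of the deflated
          block at x.\<close>
        have "?d * ennreal ((cmod (corner' n D b (mulv n ?m u) x))\<^sup>2) = ennreal ((cmod (poly (charp n (sh u b D)) x))\<^sup>2)"
          unfolding 3[symmetric] by (simp add: norm_mult power_mult_distrib mult.commute flip: ennreal_mult)
        then show "?d * f D b (mulv n ?m u) x = E x u (sh u b D) b"
          using q unfolding f_def E_def \<Theta>_def cweight_def 2 unfolding 1
          by (simp add: mult.assoc[symmetric]) (simp add: mult_ac)
      qed
      finally show "(\<integral>\<^sup>+ c. f D b c x \<partial>vsp n) = (\<integral>\<^sup>+ u. E x u (sh u b D) b \<partial>vsp n)" .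
    qed
  qed
  also have "\<dots> = (\<integral>\<^sup>+ x. (\<integral>\<^sup>+ D. (\<integral>\<^sup>+ b. (\<integral>\<^sup>+ u. E x u (sh u b D) b \<partial>vsp n) \<partial>vsp n) \<partial>msp n) \<partial>lborel)"
    by (rule nn_integral_swap[OF M.sigma_finite_measure_axioms sigma_finite_lborel]) measurable
  also have "\<dots> = (\<integral>\<^sup>+ x. (\<integral>\<^sup>+ u. (\<integral>\<^sup>+ b. (\<integral>\<^sup>+ D. E x u (sh u b D) b \<partial>msp n) \<partial>vsp n) \<partial>vsp n) \<partial>lborel)"
    by (rule nn_integral_cong, rule nn_integral_reverse3[OF M.sigma_finite_measure_axioms V.sigma_finite_measure_axioms V.sigma_finite_measure_axioms]) measurable
  \<comment> \<open>For fixed \<open>u\<close> and \<open>b\<close> the passage from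
    \<open>D\<close> to \<open>B\<close> is the translation by -u b.\<close>
  also have "\<dots> = (\<integral>\<^sup>+ x. (\<integral>\<^sup>+ u. (\<integral>\<^sup>+ b. (\<integral>\<^sup>+ B. E x u B b \<partial>msp n) \<partial>vsp n) \<partial>vsp n) \<partial>lborel)"
  proof (rule nn_integral_cong, rule nn_integral_cong, rule nn_integral_cong)
    fix x u b assume [measurable]: "u \<in> space (vsp n)" "b \<in> space (vsp n)"
    show "(\<integral>\<^sup>+ D. E x u (sh u b D) b \<partial>msp n) = (\<integral>\<^sup>+ B. E x u B b \<partial>msp n)"
      unfolding sh_def by (rule cspace_translation) (simp, measurable)
  qed
  also have "\<dots> = (\<integral>\<^sup>+ x. (\<integral>\<^sup>+ u. (\<integral>\<^sup>+ B. (\<integral>\<^sup>+ b. E x u B b \<partial>vsp n) \<partial>msp n) \<partial>vsp n) \<partial>lborel)"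
  proof (rule nn_integral_cong, rule nn_integral_cong)
    fix x u assume [measurable]: "u \<in> space (vsp n)"
    show "(\<integral>\<^sup>+ b. (\<integral>\<^sup>+ B. E x u B b \<partial>msp n) \<partial>vsp n) = (\<integral>\<^sup>+ B. (\<integral>\<^sup>+ b. E x u B b \<partial>vsp n) \<partial>msp n)"
      by (rule nn_integral_swap[OF V.sigma_finite_measure_axioms M.sigma_finite_measure_axioms]) measurable
  qed
  also have "\<dots> = (\<integral>\<^sup>+ x. (\<integral>\<^sup>+ u. ennreal (1 / (1 + (\<Sum>i<n. (cmod (u i))\<^sup>2)) ^ Suc n) *
      (ennreal (exp (- (cmod x)\<^sup>2) * pi ^ n) * ?J x) \<partial>vsp n) \<partial>lborel)"
  proof (rule nn_integral_cong, rule nn_integral_cong)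
    fix x u
    have inv: "\<Theta> x (rmul n Q (lmul n {..<n} P B)) = \<Theta> x B" if "matf n P * matf n Q = 1\<^sub>m n" for P Q B
      unfolding \<Theta>_def charp_similarity[OF that] ..
    have tm: "\<Theta> x \<in> borel_measurable (msp n)" by measurable
    have "(\<integral>\<^sup>+ B. (\<integral>\<^sup>+ b. E x u B b \<partial>vsp n) \<partial>msp n) = ennreal (exp (- (cmod x)\<^sup>2) * pi ^ n / usq n u ^ Suc n) * ?J x"
      unfolding E_def by (rule nn_integral_gauss_deflated[OF tm inv])
    also have "ennreal (exp (- (cmod x)\<^sup>2) * pi ^ n / usq n u ^ Suc n) = ennreal (1 / usq n u ^ Suc n) * ennreal (exp (- (cmod x)\<^sup>2) * pi ^ n)"
      using usq_pos[of n u] by (subst ennreal_mult[symmetric]) auto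
    finally show "(\<integral>\<^sup>+ B. (\<integral>\<^sup>+ b. E x u B b \<partial>vsp n) \<partial>msp n) = ennreal (1 / (1 + (\<Sum>i<n. (cmod (u i))\<^sup>2)) ^ Suc n) *
      (ennreal (exp (- (cmod x)\<^sup>2) * pi ^ n) * ?J x)"
      unfolding usq_def by (simp only: mult.assoc)
  qed
  also have "\<dots> = (\<integral>\<^sup>+ x. ennreal (pi ^ (2 * n) / fact n) * (ennreal (exp (- (cmod x)\<^sup>2)) * ?J x) \<partial>lborel)"
  proof (rule nn_integral_cong)
    fix x
    have um: "(\<lambda>u. ennreal (1 / (1 + (\<Sum>i<n. (cmod (u i))\<^sup>2)) ^ Suc n)) \<in> borel_measurable (vsp n)"
      using cspace_component[of _ "{..<n}"] by measurable
    have "ennreal (pi ^ n / fact n) * ennreal (exp (- (cmod x)\<^sup>2) * pi ^ n) = ennreal (pi ^ (2 * n) / fact n) * ennreal (exp (- (cmod x)\<^sup>2))"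
      unfolding mult_2 power_add by (simp add: mult_ac flip: ennreal_mult)
    then show "(\<integral>\<^sup>+ u. ennreal (1 / (1 + (\<Sum>i<n. (cmod (u i))\<^sup>2)) ^ Suc n) *
      (ennreal (exp (- (cmod x)\<^sup>2) * pi ^ n) * ?J x) \<partial>vsp n)
      = ennreal (pi ^ (2 * n) / fact n) * (ennreal (exp (- (cmod x)\<^sup>2)) * ?J x)"
      by (subst nn_integral_multc[OF um]) (simp only: nn_integral_cspace_cauchy mult.assoc[symmetric])
  qed
  also have "\<dots> = ennreal (pi ^ (2 * n) / fact n) * (\<integral>\<^sup>+ x. ennreal (exp (- (cmod x)\<^sup>2)) * ?J x \<partial>lborel)"
    by (rule nn_integral_cmult) measurable
  finally show ?thesis unfolding f_def \<Theta>_def .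
qed

section \<open>The joint density of the eigenvalues\<close>

text \<open>The polynomials \<open>p j\<close> are the Newton basis at the nodes \<open>z\<close>.
  Passing to it from monomials is unitriangular, and the matrix of values p_j(z_i) is lower
  triangular with the stated product on its diagonal.\<close>

lemma det_vandermonde:
  fixes z :: cvec
  shows "det (matf n (\<lambda>i j. z i ^ j)) = (\<Prod>i<n. \<Prod>j<i. z i - z j)"
proof -
  define p where "p j = (\<Prod>l<j. [:- z l, 1:])" for j
  have lead: "degree (p j) = j \<and> lead_coeff (p j) = 1" for j
  proof -
    have "p j \<noteq> 0" for j by (simp add: p_def)
    then show ?thesis
    proof (induction j)
      case (Suc j)
      have "p (Suc j) = p j * [:- z j, 1:]" by (simp add: p_def)
      then have "lead_coeff (p (Suc j)) = lead_coeff (p j) * lead_coeff [:- z j, 1:]"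
        and "degree (p (Suc j)) = degree (p j) + degree [:- z j, 1:]"
        using Suc.prems by (simp_all only: lead_coeff_mult) (intro degree_mult_eq, auto)
      moreover have "degree (p j) = j" "coeff (p j) j = 1" using Suc by auto
      ultimately show ?case by simp
    qed (simp add: p_def)
  qed
  have deg: "degree (p j) = j" and lc: "coeff (p j) j = 1" for j
    using lead[of j] by auto
  have pe: "poly (p j) x = (\<Sum>k<n. x ^ k * coeff (p j) k)" if "j < n" for j x
  proof -
    have "poly (p j) x = (\<Sum>k\<le>j. coeff (p j) k * x ^ k)" by (simp add: poly_altdef deg)
    also have "\<dots> = (\<Sum>k<n. coeff (p j) k * x ^ k)"
      using that by (intro sum.mono_neutral_left) (auto intro: coeff_eq_0 simp: deg)
    finally show ?thesis by (simp add: mult.commute)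
  qed
  define U where "U = matf n (\<lambda>k j. coeff (p j) k)"
  define L where "L = matf n (\<lambda>i j. poly (p j) (z i))"
  have dU: "det U = 1"
    by (intro det_unitriangular[of _ n] disjI1) (auto simp: upper_triangular_def U_def lc deg intro!: coeff_eq_0)
  have zero: "poly (p j) (z i) = 0" if "i < j" for i j
    using that by (auto simp: p_def poly_prod)
  have dL: "det L = (\<Prod>i<n. \<Prod>j<i. z i - z j)"
  proof -
    have "det L = prod_list (diag_mat L)"
      by (rule det_lower_triangular[of n]) (auto simp: L_def zero)
    also have "\<dots> = (\<Prod>i<n. poly (p i) (z i))"
      by (auto simp: diag_mat_def L_def prod.list_conv_set_nth lessThan_atLeast0 intro!: prod.cong)
    finally show ?thesis by (simp add: p_def poly_prod)
  qed
  have "matf n (\<lambda>i j. z i ^ j) * U = L"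
    by (rule eq_matI) (auto simp: U_def L_def pe scalar_prod_def row_def col_def lessThan_atLeast0)
  then have "det (matf n (\<lambda>i j. z i ^ j)) * det U = det L"
    by (subst det_mult[symmetric, of _ n]) (auto simp: U_def)
  then show ?thesis by (simp add: dU dL)
qed

definition vdm2 :: "nat \<Rightarrow> cvec \<Rightarrow> real" where
  "vdm2 n z = (\<Prod>i<n. \<Prod>j<i. (cmod (z i - z j))\<^sup>2)"

definition perms :: "nat \<Rightarrow> (nat \<Rightarrow> nat) set" where
  "perms n = {p. p permutes {0..<n}}"

lemma perms_finite: "finite (perms n)" and perms_card: "card (perms n) = fact n"
  unfolding perms_def by (simp_all add: finite_permutations card_permutations[of _ n])

text \<open>The Leibniz expansion of the Vandermonde determinant times its conjugate; every term is
  a product of functions of single coordinates, so integrals factorise.\<close>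

lemma vdm2_expand:
  "complex_of_real (vdm2 n z) = (\<Sum>p\<in>perms n. \<Sum>q\<in>perms n. signof p * signof q * (\<Prod>i<n. z i ^ p i * cnj (z i) ^ q i))"
proof -
  let ?d = "det (matf n (\<lambda>i j. z i ^ j))"
  have "p i < n" if "p permutes {0..<n}" "i < n" for p i
    using permutes_in_image[OF that(1), of i] that(2) by auto
  then have d: "?d = (\<Sum>p\<in>perms n. signof p * (\<Prod>i<n. z i ^ p i))"
    by (subst det_def'[of _ n]) (auto simp: perms_def lessThan_atLeast0 intro!: sum.cong prod.cong)
  have "complex_of_real (vdm2 n z) = complex_of_real ((cmod ?d)\<^sup>2)"
    by (simp add: det_vandermonde vdm2_def prod_norm[symmetric] prod_power_distrib)
  also have "\<dots> = ?d * cnj ?d" by (rule complex_norm_square)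
  also have "cnj ?d = (\<Sum>q\<in>perms n. signof q * (\<Prod>i<n. cnj (z i) ^ q i))"
  proof -
    have "cnj (signof q) = signof q" for q :: "nat \<Rightarrow> nat" by (cases q rule: sign_cases) simp_all
    then show ?thesis by (simp add: d)
  qed
  finally show ?thesis
    by (simp add: d sum_product prod.distrib mult_ac)
qed

section \<open>Orthogonality of monomials under radial Gaussian weights\<close>

lemma integrable_complex_gauss_moment:
  assumes g: "g \<in> borel_measurable borel" and b: "\<And>z. cmod (g z) \<le> 1"
  shows "integrable lborel (\<lambda>z. g z * of_real (exp (- (cmod z)\<^sup>2)) * (z ^ a * cnj z ^ b))"
proof -
  have int: "integrable lborel (\<lambda>z::complex. cmod z ^ (2 * k) * exp (- (cmod z)\<^sup>2))" for k
    using nn_integral_complex_gauss[of 1 k]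
    by (intro integrableI_bounded) (auto simp: norm_mult norm_power abs_mult)
  have "integrable lborel (\<lambda>z::complex. cmod z ^ (2 * a) * exp (- (cmod z)\<^sup>2) + cmod z ^ (2 * b) * exp (- (cmod z)\<^sup>2))"
    by (intro Bochner_Integration.integrable_add int)
  then show ?thesis
  proof (rule Bochner_Integration.integrable_bound)
    show "AE z in lborel. norm (g z * of_real (exp (- (cmod z)\<^sup>2)) * (z ^ a * cnj z ^ b))
      \<le> norm (cmod z ^ (2 * a) * exp (- (cmod z)\<^sup>2) + cmod z ^ (2 * b) * exp (- (cmod z)\<^sup>2))"
    proof (rule AE_I2)
      fix z :: complex
      \<comment> \<open>Dominates a mixed moment by two even ones, whose Gaussian integrals are
        known to be finite.\<close>
      have "x * y \<le> x\<^sup>2 + y\<^sup>2" if "x \<ge> 0" "y \<ge> 0" for x y :: real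
        using sum_squares_bound[of x y] that mult_nonneg_nonneg[OF that] by linarith
      then have 1: "cmod z ^ a * cmod z ^ b \<le> cmod z ^ (2 * a) + cmod z ^ (2 * b)"
        by (metis norm_ge_zero power_even_eq zero_le_power)
      have "norm (g z * of_real (exp (- (cmod z)\<^sup>2)) * (z ^ a * cnj z ^ b)) = cmod (g z) * (exp (- (cmod z)\<^sup>2) * (cmod z ^ a * cmod z ^ b))"
        by (simp add: norm_mult norm_power)
      also have "\<dots> \<le> 1 * (exp (- (cmod z)\<^sup>2) * (cmod z ^ a * cmod z ^ b))"
        by (intro mult_right_mono b mult_nonneg_nonneg) auto
      also have "\<dots> \<le> exp (- (cmod z)\<^sup>2) * (cmod z ^ (2 * a) + cmod z ^ (2 * b))"
        using 1 by simp
      finally show "norm (g z * of_real (exp (- (cmod z)\<^sup>2)) * (z ^ a * cnj z ^ b))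
        \<le> norm (cmod z ^ (2 * a) * exp (- (cmod z)\<^sup>2) + cmod z ^ (2 * b) * exp (- (cmod z)\<^sup>2))"
        by (simp add: algebra_simps)
    qed
  next
    have [measurable]: "cnj \<in> borel_measurable borel"
      by (intro borel_measurable_continuous_onI continuous_intros)
    show "(\<lambda>z. g z * of_real (exp (- (cmod z)\<^sup>2)) * (z ^ a * cnj z ^ b)) \<in> borel_measurable lborel"
      using g by measurable
  qed
qed

lemma lborel_rotation: "cmod w = 1 \<Longrightarrow> distr lborel borel (\<lambda>z. w * z) = lborel"
proof (rule measure_eqI)
  assume w: "cmod w = 1"
  fix B assume "B \<in> sets (distr lborel borel (\<lambda>z. w * z))"
  then have B[measurable]: "B \<in> sets borel" by simp
  have "emeasure (distr lborel borel (\<lambda>z. w * z)) B = (\<integral>\<^sup>+ z. indicator B z \<partial>distr lborel borel (\<lambda>z. w * z))" by simp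
  also have "\<dots> = (\<integral>\<^sup>+ z. indicator B (w * z) \<partial>lborel)" by (subst nn_integral_distr) auto
  also have "\<dots> = emeasure lborel B"
  proof -
    have "w \<noteq> 0" using w by auto
    then show ?thesis using nn_integral_complex_affine[of w "indicator B" 0] w by simp
  qed
  finally show "emeasure (distr lborel borel (\<lambda>z. w * z)) B = emeasure lborel B" .
qed simp

definition radial_moment :: "(real \<Rightarrow> real) \<Rightarrow> nat \<Rightarrow> real" where
  "radial_moment g k = (LINT z|lborel. g (cmod z) * exp (- (cmod z)\<^sup>2) * cmod z ^ (2 * k))"

text \<open>For a different from b, rotation by the angle pi / (a - b) preserves area and the radial
  factors but multiplies the monomial by exp (i pi) = -1, so the integral equals its own
  negative.\<close>

lemma radial_orthogonality:
  assumes g[measurable]: "g \<in> borel_measurable borel"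
  shows "(LINT z|lborel. of_real (g (cmod z)) * of_real (exp (- (cmod z)\<^sup>2)) * (z ^ a * cnj z ^ b))
    = (if a = b then complex_of_real (radial_moment g a) else 0)"
proof (cases "a = b")
  case True
  have "z ^ a * cnj z ^ a = of_real (cmod z ^ (2 * a))" for z
    by (simp only: power_mult_distrib[symmetric] complex_norm_square[symmetric] power_mult of_real_power)
  then have "(\<lambda>z. of_real (g (cmod z)) * of_real (exp (- (cmod z)\<^sup>2)) * (z ^ a * cnj z ^ b))
      = (\<lambda>z. complex_of_real (g (cmod z) * exp (- (cmod z)\<^sup>2) * cmod z ^ (2 * a)))"
    using True by simp
  then show ?thesis using True by (simp only: radial_moment_def integral_complex_of_real HOL.simp_thms if_True)
next
  case False
  define \<theta> where "\<theta> = pi / (real a - real b)"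
  define w where "w = cis \<theta>"
  define F where "F z = of_real (g (cmod z)) * of_real (exp (- (cmod z)\<^sup>2)) * (z ^ a * cnj z ^ b)" for z
  have [measurable]: "cnj \<in> borel_measurable borel"
    by (intro borel_measurable_continuous_onI continuous_intros)
  have F[measurable]: "F \<in> borel_measurable borel" unfolding F_def[abs_def] by measurable
  have "w ^ a = cis (real a * \<theta>)" unfolding w_def by (rule Complex.DeMoivre)
  moreover have "cnj w ^ b = cis (real b * - \<theta>)" unfolding w_def cis_cnj by (rule Complex.DeMoivre)
  ultimately have "w ^ a * cnj w ^ b = cis (real a * \<theta> + real b * - \<theta>)" by (simp only: cis_mult)
  also have "real a * \<theta> + real b * - \<theta> = (real a - real b) * \<theta>" by (simp add: algebra_simps)
  also have "\<dots> = pi" using False by (simp add: \<theta>_def)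
  finally have w: "w ^ a * cnj w ^ b = -1" by simp
  have "F (w * z) = w ^ a * cnj w ^ b * F z" for z
    by (simp add: F_def w_def norm_mult power_mult_distrib mult_ac)
  then have Fw: "F (w * z) = - F z" for z by (simp add: w)
  have "(LINT z|lborel. F z) = (LINT z|distr lborel borel (\<lambda>z. w * z). F z)"
    by (subst lborel_rotation) (simp_all add: w_def)
  also have "\<dots> = (LINT z|lborel. F (w * z))" by (subst integral_distr) auto
  also have "\<dots> = - (LINT z|lborel. F z)" by (simp add: Fw)
  finally have "(LINT z|lborel. F z) = 0" by simp
  then show ?thesis using False by (simp add: F_def)
qed

text \<open>By orthogonality only the pairs p = q survive in the double sum over permutations. Each
  of the n! survivors has sign 1 and contributes the same product of moments.\<close>

theorem nn_integral_radial_vandermonde: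
  assumes g[measurable]: "g \<in> borel_measurable borel" and g01: "\<And>t. 0 \<le> g t" "\<And>t. g t \<le> 1"
  shows "(\<integral>\<^sup>+ z. gauss {..<n} z * ennreal (vdm2 n z) * (\<Prod>i<n. ennreal (g (cmod (z i)))) \<partial>vsp n)
    = ennreal (fact n * (\<Prod>k<n. radial_moment g k))"
proof -
  let ?m = "\<lambda>p q. \<Prod>i<n. if p i = q i then complex_of_real (radial_moment g (p i)) else 0"
  define \<phi> where "\<phi> a b z = of_real (g (cmod z)) * of_real (exp (- (cmod z)\<^sup>2)) * (z ^ a * cnj z ^ b)" for a b and z :: complex
  \<comment> \<open>The single terms are complex and signed, so the computation uses Bochner
    integrals; nonnegativity of the total integrand \<open>R\<close> leads back to the nonnegative
    integral.\<close>
  define R where "R z = (\<Prod>i<n. exp (- (cmod (z i))\<^sup>2)) * vdm2 n z * (\<Prod>i<n. g (cmod (z i)))" for z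
  have int: "integrable lborel (\<phi> a b)" for a b
    unfolding \<phi>_def[abs_def] by (rule integrable_complex_gauss_moment) (use g01 in auto)
  have R: "complex_of_real (R z) = (\<Sum>p\<in>perms n. \<Sum>q\<in>perms n. signof p * signof q * (\<Prod>i<n. \<phi> (p i) (q i) (z i)))" for z
  proof -
    have "complex_of_real (R z) = (\<Prod>i<n. of_real (exp (- (cmod (z i))\<^sup>2))) * of_real (vdm2 n z) * (\<Prod>i<n. of_real (g (cmod (z i))))"
      by (simp add: R_def)
    then show ?thesis
      unfolding vdm2_expand \<phi>_def
      by (simp add: sum_distrib_left sum_distrib_right prod.distrib mult_ac)
  qed
  have prodint: "integrable (vsp n) (\<lambda>z. \<Prod>i<n. \<phi> (p i) (q i) (z i))" for p q
    by (rule cs.product_integrable_prod) (auto intro: int)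
  have prodval: "(LINT z|vsp n. (\<Prod>i<n. \<phi> (p i) (q i) (z i))) = ?m p q" for p q
  proof -
    have "integral\<^sup>L lborel (\<phi> a b) = (if a = b then complex_of_real (radial_moment g a) else 0)" for a b
      unfolding \<phi>_def[abs_def] by (rule radial_orthogonality[OF g])
    then show ?thesis using int by (subst cs.product_integral_prod) auto
  qed
  have "integrable (vsp n) (\<lambda>z. complex_of_real (R z))"
    unfolding R by (intro Bochner_Integration.integrable_sum integrable_mult_right prodint)
  then have Rint: "integrable (vsp n) R"
    using integrable_Re by fastforce
  have "complex_of_real (LINT z|vsp n. R z) = (LINT z|vsp n. complex_of_real (R z))"
    by simp
  also have "\<dots> = (\<Sum>p\<in>perms n. \<Sum>q\<in>perms n. signof p * signof q * ?m p q)"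
    unfolding R
    by (subst Bochner_Integration.integral_sum, intro Bochner_Integration.integrable_sum integrable_mult_right prodint)
      (intro sum.cong refl, subst Bochner_Integration.integral_sum, auto intro!: integrable_mult_right prodint simp: prodval)
  also have "\<dots> = (\<Sum>p\<in>perms n. complex_of_real (\<Prod>k<n. radial_moment g k))"
  proof (rule sum.cong)
    fix p assume p: "p \<in> perms n"
    have sg: "signof p * signof p = (1::complex)" by (cases p rule: sign_cases) simp_all
    have "(\<Sum>q\<in>perms n. signof p * signof q * ?m p q)
      = (\<Sum>q\<in>perms n. if q = p then (\<Prod>i<n. complex_of_real (radial_moment g (p i))) else 0)"
    proof (rule sum.cong)
      fix q assume q: "q \<in> perms n"
      show "signof p * signof q * ?m p q
        = (if q = p then (\<Prod>i<n. complex_of_real (radial_moment g (p i))) else 0)"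
      proof (cases "q = p")
        case False
        have "\<exists>i<n. p i \<noteq> q i"
        proof (rule ccontr)
          assume "\<not> ?thesis"
          then have "p i = q i" for i
            using p q by (cases "i < n") (auto simp: perms_def permutes_not_in)
          then show False using False by auto
        qed
        then show ?thesis using False by (auto intro!: prod_zero)
      qed (simp add: sg)
    qed simp
    also have "\<dots> = (\<Prod>i<n. complex_of_real (radial_moment g (p i)))"
      using p perms_finite by simp
    also have "\<dots> = complex_of_real (\<Prod>k<n. radial_moment g k)"
    proof -
      have "bij_betw p {..<n} {..<n}" using p permutes_imp_bij by (auto simp: perms_def lessThan_atLeast0)
      then show ?thesis by (simp add: prod.reindex_bij_betw[where g = "\<lambda>k. complex_of_real (radial_moment g k)"])
    qed
    finally show "(\<Sum>q\<in>perms n. signof p * signof q * ?m p q)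
      = complex_of_real (\<Prod>k<n. radial_moment g k)" .
  qed simp
  also have "\<dots> = complex_of_real (fact n * (\<Prod>k<n. radial_moment g k))"
    by (simp add: perms_card)
  finally have val: "(LINT z|vsp n. R z) = fact n * (\<Prod>k<n. radial_moment g k)"
    by (simp only: of_real_eq_iff)
  have R0: "R z \<ge> 0" for z
    unfolding R_def vdm2_def by (intro mult_nonneg_nonneg prod_nonneg g01) auto
  have "gauss {..<n} z * ennreal (vdm2 n z) * (\<Prod>i<n. ennreal (g (cmod (z i)))) = ennreal (R z)" for z
  proof -
    have "vdm2 n z \<ge> 0" unfolding vdm2_def by (intro prod_nonneg) auto
    then show ?thesis
      unfolding R_def gauss_def
      by (simp add: prod_ennreal g01 ennreal_mult prod_nonneg exp_sum flip: sum_negf)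
  qed
  then show ?thesis
    using nn_integral_eq_integral[OF Rint] R0 by (simp add: val)
qed

text \<open>The reciprocal of the normalising constant of the joint eigenvalue density.\<close>

definition vdm_mass :: "nat \<Rightarrow> real" where
  "vdm_mass n = fact n * (\<Prod>k<n. pi * fact k)"

lemma vdm_mass_pos: "vdm_mass n > 0"
  unfolding vdm_mass_def by (intro mult_pos_pos prod_pos) auto

lemma radial_moment_one: "radial_moment (\<lambda>_. 1) k = pi * fact k"
proof -
  define f where "f z = 1 * exp (- (cmod z)\<^sup>2) * cmod z ^ (2 * k)" for z :: complex
  have f: "(\<integral>\<^sup>+ z. ennreal (f z) \<partial>lborel) = ennreal (pi * fact k)"
    using nn_integral_complex_gauss[of 1 k] by (simp add: f_def mult.commute)
  have f0: "f z \<ge> 0" for z by (simp add: f_def)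
  have [measurable]: "f \<in> borel_measurable borel" unfolding f_def[abs_def] by measurable
  have "integral\<^sup>L lborel f = pi * fact k"
    using nn_integral_eq_integrable[of f lborel "pi * fact k"] f0 f by simp
  then show ?thesis by (simp only: radial_moment_def f_def[abs_def])
qed

lemma nn_integral_vandermonde_gauss:
  "(\<integral>\<^sup>+ z. gauss {..<n} z * ennreal (vdm2 n z) \<partial>vsp n) = ennreal (vdm_mass n)"
  using nn_integral_radial_vandermonde[of "\<lambda>_. 1" n] by (simp add: radial_moment_one vdm_mass_def)

section \<open>Induction on the size of the matrix\<close>

definition root_poly :: "nat \<Rightarrow> cvec \<Rightarrow> complex poly" where
  "root_poly n z = (\<Prod>i<n. [:- z i, 1:])"

lemma charp_diagonal: "charp n (\<lambda>p. if fst p = snd p then z (fst p) else 0) = root_poly n z"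
proof -
  have "charp n (\<lambda>p. if fst p = snd p then z (fst p) else 0) = (\<Prod>a \<leftarrow> diag_mat (mat n n (\<lambda>p. if fst p = snd p then z (fst p) else 0)). [:- a, 1:])"
    by (rule char_poly_upper_triangular[of _ n]) (auto simp: upper_triangular_def)
  also have "\<dots> = root_poly n z"
    by (auto simp: root_poly_def diag_mat_def o_def prod.list_conv_set_nth lessThan_atLeast0 intro!: prod.cong)
  finally show ?thesis .
qed

text \<open>The same device as in \<open>charp_shift_measurable\<close>: the polynomial is the
  characteristic polynomial of a diagonal matrix, which depends measurably on
  \<open>z\<close>.\<close>

lemma root_poly_measurable:
  assumes "(\<lambda>X. H (charp n X)) \<in> borel_measurable (msp n)"
  shows "(\<lambda>z. H (root_poly n z) :: ennreal) \<in> borel_measurable (vsp n)"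
proof -
  have "(\<lambda>z. \<lambda>p\<in>{..<n} \<times> {..<n}. if fst p = snd p then z (fst p) else 0) \<in> measurable (vsp n) (msp n)"
  proof (rule cspace_restrictI)
    fix p :: "nat \<times> nat" assume "p \<in> {..<n} \<times> {..<n}"
    then show "(\<lambda>z. if fst p = snd p then z (fst p) else 0) \<in> borel_measurable (vsp n)"
      by (cases "fst p = snd p") (auto intro!: cspace_component)
  qed
  from measurable_compose[OF this assms]
  have "(\<lambda>z. H (charp n (\<lambda>p\<in>{..<n} \<times> {..<n}. if fst p = snd p then z (fst p) else 0))) \<in> borel_measurable (vsp n)" .
  moreover have "mat n n (\<lambda>p\<in>{..<n} \<times> {..<n}. if fst p = snd p then z (fst p) else 0) = mat n n (\<lambda>p. if fst p = snd p then z (fst p) else (0::complex))" for z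
    by (rule eq_matI) auto
  ultimately show ?thesis by (simp add: charp_diagonal)
qed

lemma vdm2_measurable [measurable]: "vdm2 n \<in> borel_measurable (vsp n)"
  unfolding vdm2_def[abs_def]
  by (intro borel_measurable_prod borel_measurable_power borel_measurable_norm borel_measurable_diff cspace_component) auto

text \<open>Deflation reduces size n + 1 to an eigenvalue x and an n x n matrix weighted by the
  squared modulus of its characteristic polynomial at x; by the induction hypothesis that matrix may
  be replaced by n points, and the weight completes their Vandermonde product to the one of n + 1
  points.\<close>

theorem ginibre_eigenvalue_density:
  fixes H :: "complex poly \<Rightarrow> ennreal"
  assumes "(\<lambda>X. H (charp n X)) \<in> borel_measurable (msp n)"
  shows "(\<integral>\<^sup>+ X. mgauss n X * H (charp n X) \<partial>msp n)
    = ennreal (pi ^ (n * n) / vdm_mass n) * (\<integral>\<^sup>+ z. gauss {..<n} z * ennreal (vdm2 n z) * H (root_poly n z) \<partial>vsp n)"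
  using assms
proof (induction n arbitrary: H)
  case 0
  have "charp 0 X = 1" for X by (simp add: char_poly_def char_poly_matrix_def)
  then show ?case
    by (simp add: PiM_empty nn_integral_count_space_finite gauss_def vdm2_def root_poly_def vdm_mass_def)
next
  case (Suc n)
  let ?F = "\<lambda>H x. \<integral>\<^sup>+ B. ennreal ((cmod (poly (charp n B) x))\<^sup>2) * H ([:-x, 1:] * charp n B) * mgauss n B \<partial>msp n"
  define c where "c = pi ^ (n * n) / vdm_mass n"
  define R where "R H = (\<integral>\<^sup>+ x. ennreal (exp (- (cmod x)\<^sup>2)) *
        ?F H x \<partial>lborel)"
    for H :: "complex poly \<Rightarrow> ennreal"
  have c: "c \<ge> 0" using vdm_mass_pos[of n] by (simp add: c_def)
  have R: "R H = ennreal c * (\<integral>\<^sup>+ z. gauss {..<Suc n} z * ennreal (vdm2 (Suc n) z) * H (root_poly (Suc n) z) \<partial>vsp (Suc n))"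
    if H: "(\<lambda>X. H (charp (Suc n) X)) \<in> borel_measurable (msp (Suc n))" for H
  proof -
    let ?f = "\<lambda>z. gauss {..<Suc n} z * ennreal (vdm2 (Suc n) z) * H (root_poly (Suc n) z)"
    have f[measurable]: "?f \<in> borel_measurable (vsp (Suc n))"
      using root_poly_measurable[OF H] by measurable
    have fi[measurable]: "?f \<in> borel_measurable (cspace (insert n {..<n}))"
      using f by (simp add: lessThan_Suc)
    have split: "ennreal (exp (- (cmod x)\<^sup>2)) * (gauss {..<n} z * ennreal (vdm2 n z) * (ennreal ((cmod (poly (root_poly n z) x))\<^sup>2) * H ([:-x, 1:] * root_poly n z)))
        = ?f (z(n := x))" for x z
    proof -
      have "gauss {..<Suc n} (z(n := x)) = ennreal (exp (- (cmod x)\<^sup>2)) * gauss {..<n} z"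
        by (simp add: gauss_def exp_add exp_diff exp_minus field_simps flip: ennreal_mult)
      moreover have "vdm2 (Suc n) (z(n := x)) = vdm2 n z * (cmod (poly (root_poly n z) x))\<^sup>2"
        by (simp add: vdm2_def root_poly_def poly_prod prod_norm[symmetric] prod_power_distrib)
      moreover have "root_poly (Suc n) (z(n := x)) = [:-x, 1:] * root_poly n z"
        by (simp add: root_poly_def mult.commute del: mult_pCons_left mult_pCons_right)
      moreover have "vdm2 n z \<ge> 0" unfolding vdm2_def by (intro prod_nonneg) auto
      ultimately show ?thesis by (simp add: ennreal_mult mult_ac del: mult_pCons_left mult_pCons_right)
    qed
    have fxm: "(\<lambda>(x, z). ?f (z(n := x))) \<in> borel_measurable (lborel \<Otimes>\<^sub>M vsp n)"
      using fi unfolding case_prod_beta' by measurable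
    have "ennreal (exp (- (cmod x)\<^sup>2)) *
        ?F H x
        = ennreal c * (\<integral>\<^sup>+ z. ?f (z(n := x)) \<partial>vsp n)" for x
    proof -
      \<comment> \<open>The weight and the additional root x are absorbed into the test function, so
        that the induction hypothesis applies at fixed x; this is why \<open>H\<close> is kept
        arbitrary.\<close>
      define Hx where "Hx p = ennreal ((cmod (poly p x))\<^sup>2) * H ([:-x, 1:] * p)" for p
      have "(\<lambda>B. poly (charp n B) x) \<in> borel_measurable (msp n)"
        by (intro poly_charp_measurable cspace_component) auto
      then have Hx: "(\<lambda>B. Hx (charp n B)) \<in> borel_measurable (msp n)"
        unfolding Hx_def using charp_shift_measurable[OF H, of "\<lambda>B. B" "msp n" "\<lambda>_. x"] by measurable
      have gHx: "(\<lambda>z. gauss {..<n} z * ennreal (vdm2 n z) * Hx (root_poly n z)) \<in> borel_measurable (vsp n)"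
        using root_poly_measurable[OF Hx] by measurable
      have "?F H x
          = (\<integral>\<^sup>+ B. mgauss n B * Hx (charp n B) \<partial>msp n)"
        by (simp add: Hx_def mult_ac del: mult_pCons_left)
      then have 1: "?F H x
          = ennreal c * (\<integral>\<^sup>+ z. gauss {..<n} z * ennreal (vdm2 n z) * Hx (root_poly n z) \<partial>vsp n)"
        by (simp only: Suc.IH[OF Hx] c_def)
      have "(\<integral>\<^sup>+ z. ?f (z(n := x)) \<partial>vsp n) = (\<integral>\<^sup>+ z. ennreal (exp (- (cmod x)\<^sup>2)) * (gauss {..<n} z * ennreal (vdm2 n z) * Hx (root_poly n z)) \<partial>vsp n)"
        unfolding Hx_def split ..
      also have "\<dots> = ennreal (exp (- (cmod x)\<^sup>2)) * (\<integral>\<^sup>+ z. gauss {..<n} z * ennreal (vdm2 n z) * Hx (root_poly n z) \<partial>vsp n)"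
        by (rule nn_integral_cmult[OF gHx])
      finally show ?thesis unfolding 1 by (simp only: mult.left_commute)
    qed
    then have "R H = (\<integral>\<^sup>+ x. ennreal c * (\<integral>\<^sup>+ z. ?f (z(n := x)) \<partial>vsp n) \<partial>lborel)"
      by (simp only: R_def)
    also have "\<dots> = ennreal c * (\<integral>\<^sup>+ x. (\<integral>\<^sup>+ z. ?f (z(n := x)) \<partial>vsp n) \<partial>lborel)"
    proof (rule nn_integral_cmult)
      interpret V: sigma_finite_measure "vsp n" by (rule sigma_finite_cspace) simp
      show "(\<lambda>x. \<integral>\<^sup>+ z. ?f (z(n := x)) \<partial>vsp n) \<in> borel_measurable lborel"
        using V.borel_measurable_nn_integral[OF fxm] .
    qed
    also have "(\<integral>\<^sup>+ x. (\<integral>\<^sup>+ z. ?f (z(n := x)) \<partial>vsp n) \<partial>lborel) = (\<integral>\<^sup>+ z. (\<integral>\<^sup>+ x. ?f (z(n := x)) \<partial>lborel) \<partial>vsp n)"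
      by (rule nn_integral_swap[OF sigma_finite_lborel sigma_finite_cspace fxm]) simp
    also have "\<dots> = (\<integral>\<^sup>+ z. ?f z \<partial>cspace (insert n {..<n}))"
      by (rule cspace_nn_integral_insert[OF _ _ fi, symmetric]) auto
    finally show ?thesis by (simp only: lessThan_Suc)
  qed
  define \<kappa> where "\<kappa> = pi ^ (2 * n) / fact n"
  \<comment> \<open>The numerical identity behind equality of total masses; the powers of pi match
    since (n + 1)^2 = 2n + n^2 + 1.\<close>
  have const: "\<kappa> * (c * vdm_mass (Suc n)) = real (Suc n) * pi ^ (Suc n * Suc n)"
  proof -
    have "vdm_mass (Suc n) = vdm_mass n * (real (Suc n) * (pi * fact n))"
      by (simp add: vdm_mass_def algebra_simps)
    then have "\<kappa> * (c * vdm_mass (Suc n)) = pi ^ (2 * n) * pi ^ (n * n) * real (Suc n) * pi"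
      using vdm_mass_pos[of n] by (simp add: \<kappa>_def c_def)
    also have "\<dots> = real (Suc n) * pi ^ (Suc n * Suc n)"
    proof -
      have "Suc n * Suc n = 2 * n + n * n + 1" by simp
      then show ?thesis by (simp only: power_add power_one_right mult_ac)
    qed
    finally show ?thesis .
  qed
  have qq: "ennreal (real (Suc n) * (pi ^ (Suc n * Suc n) / vdm_mass (Suc n))) = of_nat (Suc n) * ennreal (pi ^ (Suc n * Suc n) / vdm_mass (Suc n))"
    using vdm_mass_pos[of "Suc n"] by (subst ennreal_mult) (simp_all add: ennreal_of_nat_eq_real_of_nat less_imp_le del: of_nat_Suc)
  have k0: "\<kappa> \<ge> 0" by (simp add: \<kappa>_def)
  \<comment> \<open>The test function 1 is treated first: its integral is known from the mass of the
    Vandermonde weight, and this supplies the hypothesis \<open>tot\<close> of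
    \<open>deflation_eq\<close> for general \<open>H\<close>.\<close>
  have one: "(\<lambda>X. (1::ennreal)) \<in> borel_measurable (msp (Suc n))" by simp
  have "(\<integral>\<^sup>+ ((D, b, c), x). cweight n D b c x * mgauss (Suc n) (cmap n D b c x) \<partial>(dbc n \<Otimes>\<^sub>M lborel)) = ennreal \<kappa> * R (\<lambda>_. 1)"
    using deflation_formula[of "\<lambda>_. 1", OF one] by (simp add: R_def \<kappa>_def)
  also have "\<dots> = ennreal \<kappa> * (ennreal c * ennreal (vdm_mass (Suc n)))"
    using nn_integral_vandermonde_gauss[of "Suc n"] by (simp add: R[OF one])
  also have "\<dots> = of_nat (Suc n) * ennreal (pi ^ (Suc n * Suc n))"
    using c k0 vdm_mass_pos[of "Suc n"] const
    by (simp add: ennreal_of_nat_eq_real_of_nat less_imp_le flip: ennreal_mult del: of_nat_Suc)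
  finally have "of_nat (Suc n) * (\<integral>\<^sup>+ X. mgauss (Suc n) X * H (charp (Suc n) X) \<partial>msp (Suc n)) = ennreal \<kappa> * R H"
    using deflation_eq[OF _ Suc.prems] deflation_formula[OF Suc.prems] by (simp only: R_def \<kappa>_def)
  also have "\<dots> = ennreal (\<kappa> * c) * (\<integral>\<^sup>+ z. gauss {..<Suc n} z * ennreal (vdm2 (Suc n) z) * H (root_poly (Suc n) z) \<partial>vsp (Suc n))"
    using c k0 by (simp add: R[OF Suc.prems] ennreal_mult mult.assoc)
  also have "\<kappa> * c = real (Suc n) * (pi ^ (Suc n * Suc n) / vdm_mass (Suc n))"
    using const vdm_mass_pos[of "Suc n"] by (simp add: field_simps del: of_nat_Suc)
  finally have *: "of_nat (Suc n) * (\<integral>\<^sup>+ X. mgauss (Suc n) X * H (charp (Suc n) X) \<partial>msp (Suc n))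
    = of_nat (Suc n) * (ennreal (pi ^ (Suc n * Suc n) / vdm_mass (Suc n)) * (\<integral>\<^sup>+ z. gauss {..<Suc n} z * ennreal (vdm2 (Suc n) z) * H (root_poly (Suc n) z) \<partial>vsp (Suc n)))"
    unfolding qq by (simp only: mult.assoc)
  then show ?case
    by (subst (asm) ennreal_mult_cancel_left) (auto simp: ennreal_of_nat_eq_real_of_nat simp del: of_nat_Suc)
qed

section \<open>The eigenvalue of minimal modulus\<close>

lemma nn_integral_gaussian_density: "(\<integral>\<^sup>+ z. ennreal (complex_gaussian_density z) \<partial>lborel) = 1"
proof -
  have "(\<integral>\<^sup>+ z. ennreal (complex_gaussian_density z) \<partial>lborel)
      = (\<integral>\<^sup>+ z. ennreal (1 / pi) * ennreal (exp (- 1 * (cmod z)\<^sup>2)) \<partial>lborel)"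
    by (intro nn_integral_cong) (simp add: complex_gaussian_density_def flip: ennreal_mult)
  also have "\<dots> = ennreal (1 / pi) * (\<integral>\<^sup>+ z. ennreal (exp (- 1 * (cmod z)\<^sup>2)) \<partial>lborel)"
    by (rule nn_integral_cmult) measurable
  also have "\<dots> = 1"
    using nn_integral_complex_gauss[of 1 0] by (simp flip: ennreal_mult)
  finally show ?thesis .
qed

lemma complex_gaussian_density_measurable [measurable]: "complex_gaussian_density \<in> borel_measurable borel"
  unfolding complex_gaussian_density_def[abs_def] by measurable

lemma PiM_gaussian:
  assumes I: "finite I"
  shows "PiM I (\<lambda>_. density lborel (\<lambda>w. ennreal (complex_gaussian_density w)))
    = density (cspace I) (\<lambda>X. ennreal (1 / pi ^ card I) * gauss I X)"
proof -
  let ?D = "density lborel (\<lambda>w. ennreal (complex_gaussian_density w))"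
  interpret D: prob_space ?D
    by (rule prob_spaceI) (simp add: emeasure_density nn_integral_gaussian_density)
  interpret P: product_sigma_finite "\<lambda>_. ?D" ..
  have prod: "ennreal (1 / pi ^ card I) * gauss I X = (\<Prod>i\<in>I. ennreal (complex_gaussian_density (X i)))" for X
    unfolding gauss_def complex_gaussian_density_def
    using I by (simp add: prod_ennreal prod_dividef exp_sum ennreal_mult[symmetric] prod_nonneg flip: sum_negf)
  show ?thesis
  proof (rule P.PiM_eqI[symmetric])
    fix A :: "'a \<Rightarrow> complex set" assume "\<And>i. i \<in> I \<Longrightarrow> A i \<in> sets ?D"
    then have A: "\<And>i. i \<in> I \<Longrightarrow> A i \<in> sets borel" by simp
    have "emeasure (density (cspace I) (\<lambda>X. ennreal (1 / pi ^ card I) * gauss I X)) (Pi\<^sub>E I A)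
        = (\<integral>\<^sup>+ X. (\<Prod>i\<in>I. ennreal (complex_gaussian_density (X i))) * indicator (Pi\<^sub>E I A) X \<partial>cspace I)"
      using A I unfolding prod[symmetric] by (intro emeasure_density) (auto intro!: sets_PiM_I_finite)
    also have "\<dots> = (\<integral>\<^sup>+ X. (\<Prod>i\<in>I. ennreal (complex_gaussian_density (X i)) * indicator (A i) (X i)) \<partial>cspace I)"
    proof (rule nn_integral_cong)
      fix X assume "X \<in> space (cspace I)"
      then have "indicator (Pi\<^sub>E I A) X = (\<Prod>i\<in>I. indicator (A i) (X i) :: ennreal)"
        using I by (auto simp: indicator_def space_PiM PiE_def Pi_def prod_zero_iff)
      then show "(\<Prod>i\<in>I. ennreal (complex_gaussian_density (X i))) * indicator (Pi\<^sub>E I A) X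
          = (\<Prod>i\<in>I. ennreal (complex_gaussian_density (X i)) * indicator (A i) (X i))"
        by (simp add: prod.distrib)
    qed
    also have "\<dots> = (\<Prod>i\<in>I. \<integral>\<^sup>+ x. ennreal (complex_gaussian_density x) * indicator (A i) x \<partial>lborel)"
      using A I by (intro cs.product_nn_integral_prod) auto
    also have "\<dots> = (\<Prod>i\<in>I. emeasure ?D (A i))"
      using A by (intro prod.cong) (auto simp: emeasure_density)
    finally show "emeasure (density (cspace I) (\<lambda>X. ennreal (1 / pi ^ card I) * gauss I X)) (Pi\<^sub>E I A) = (\<Prod>i\<in>I. emeasure ?D (A i))" .
  qed (use I in \<open>auto intro!: sets_PiM_cong\<close>)
qed

lemma ginibre_distr:
  assumes g: "ginibre_matrix M N A" and N: "N \<ge> 1"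
  defines "X \<equiv> \<lambda>\<omega>. \<lambda>p\<in>{..<N} \<times> {..<N}. A \<omega> $$ p"
  shows "X \<in> measurable M (msp N)"
    and "distr M (msp N) X = density (msp N) (\<lambda>X. ennreal (1 / pi ^ (N * N)) * mgauss N X)"
proof -
  let ?I = "{..<N} \<times> {..<N}"
  interpret prob_space M using g by (simp add: ginibre_matrix_def)
  have d: "distributed M lborel (\<lambda>\<omega>. A \<omega> $$ p) (\<lambda>w. ennreal (complex_gaussian_density w))" if "p \<in> ?I" for p
    using g that by (auto simp: ginibre_matrix_def)
  have rv: "(\<lambda>\<omega>. A \<omega> $$ p) \<in> borel_measurable M" if "p \<in> ?I" for p
    using distributed_measurable[OF d[OF that]] by simp
  show X: "X \<in> measurable M (msp N)" unfolding X_def by (intro cspace_restrictI rv)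
  have "indep_vars (\<lambda>_. borel) (\<lambda>p \<omega>. A \<omega> $$ p) ?I" using g by (simp add: ginibre_matrix_def)
  have "distr M (\<Pi>\<^sub>M p\<in>?I. borel) X = (\<Pi>\<^sub>M p\<in>?I. distr M borel (\<lambda>\<omega>. A \<omega> $$ p))"
  proof -
    \<comment> \<open>The characterisation of independence by product measures is applied to a
      nonempty index set, which is where \<open>N\<close> must be positive.\<close>
    have "(0, 0) \<in> ?I" using N by auto
    then have "?I \<noteq> {}" by blast
    then show ?thesis
      using \<open>indep_vars (\<lambda>_. borel) (\<lambda>p \<omega>. A \<omega> $$ p) ?I\<close> rv unfolding X_def
      by (subst indep_vars_iff_distr_eq_PiM'[symmetric]) auto
  qed
  also have "\<dots> = (\<Pi>\<^sub>M p\<in>?I. density lborel (\<lambda>w. ennreal (complex_gaussian_density w)))"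
  proof (rule PiM_cong)
    fix p assume "p \<in> ?I"
    from distributed_distr_eq_density[OF d[OF this]]
    show "distr M borel (\<lambda>\<omega>. A \<omega> $$ p) = density lborel (\<lambda>w. ennreal (complex_gaussian_density w))"
      by (simp cong: distr_cong)
  qed simp
  also have "\<dots> = density (msp N) (\<lambda>X. ennreal (1 / pi ^ card ?I) * gauss ?I X)"
    by (rule PiM_gaussian) simp
  also have "distr M (\<Pi>\<^sub>M p\<in>?I. borel) X = distr M (msp N) X"
    by (rule distr_cong) (auto intro!: sets_PiM_cong)
  finally show "distr M (msp N) X = density (msp N) (\<lambda>X. ennreal (1 / pi ^ (N * N)) * gauss ?I X)"
    by simp
qed

section \<open>From the eigenvalue density to the minimal modulus\<close>

definition root_free :: "real \<Rightarrow> complex poly \<Rightarrow> bool" where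
  "root_free r p \<longleftrightarrow> (\<forall>z. cmod z < r \<longrightarrow> poly p z \<noteq> 0)"

text \<open>
  The infimum of a polynomial over a countable dense subset of a ball detects its roots in the
  closed ball, which makes the event measurable.
\<close>

lemma root_free_measurable:
  assumes r: "r > 0"
  shows "{X \<in> space (msp n). root_free r (charp n X)} \<in> sets (msp n)"
proof -
  obtain D :: "complex set" where D: "countable D" "\<And>U. open U \<Longrightarrow> U \<noteq> {} \<Longrightarrow> \<exists>d\<in>D. d \<in> U"
    using countable_dense_exists by metis
  \<comment> \<open>Radii increasing to \<open>r\<close> from below: each root in the open disc lies
    within some radius, while a minimiser found on the corresponding closed disc still has modulus
    below \<open>r\<close>.\<close>
  define \<rho> where "\<rho> m = r - r / real (m + 2)" for m :: nat
  have \<rho>: "\<rho> m < r" for m using r by (simp add: \<rho>_def)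
  have iff: "\<not> root_free r p \<longleftrightarrow> (\<exists>m. \<forall>k. \<exists>d\<in>{d\<in>D. cmod d < \<rho> m}. cmod (poly p d) < 1 / real (Suc k))" for p
  proof
    assume "\<not> root_free r p"
    then obtain z where z: "cmod z < r" "poly p z = 0" by (auto simp: root_free_def)
    have "(\<lambda>m. r - r / real (m + 2)) \<longlonglongrightarrow> r - 0"
      by (intro tendsto_intros real_tendsto_divide_at_top[where c = r] filterlim_compose[OF filterlim_real_sequentially] filterlim_add_const_nat_at_top)
    then have "eventually (\<lambda>m. cmod z < \<rho> m) sequentially"
      using z(1) by (intro order_tendstoD) (auto simp: \<rho>_def)
    then obtain m where m: "cmod z < \<rho> m" by (auto simp: eventually_sequentially)
    have "\<exists>d\<in>{d\<in>D. cmod d < \<rho> m}. cmod (poly p d) < 1 / real (Suc k)" for k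
    proof -
      let ?U = "ball 0 (\<rho> m) \<inter> {x. cmod (poly p x) < 1 / real (Suc k)}"
      have "open ?U"
        by (intro open_Int open_ball open_Collect_less continuous_on_norm continuous_on_poly continuous_on_id continuous_on_const)
      moreover have "z \<in> ?U" using m z by simp
      ultimately obtain d where "d \<in> D" "d \<in> ?U" using D(2)[of ?U] by blast
      then show ?thesis by auto
    qed
    then show "\<exists>m. \<forall>k. \<exists>d\<in>{d\<in>D. cmod d < \<rho> m}. cmod (poly p d) < 1 / real (Suc k)" by blast
  next
    assume "\<exists>m. \<forall>k. \<exists>d\<in>{d\<in>D. cmod d < \<rho> m}. cmod (poly p d) < 1 / real (Suc k)"
    then obtain m where m: "\<And>k. \<exists>d\<in>{d\<in>D. cmod d < \<rho> m}. cmod (poly p d) < 1 / real (Suc k)" by blast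
    have "cball 0 (\<rho> m) \<noteq> ({} :: complex set)"
    proof -
      obtain d where "cmod d < \<rho> m" using m[of 0] by auto
      then show ?thesis by (metis cball_eq_empty less_le_not_le norm_ge_zero order.strict_trans1)
    qed
    moreover have "continuous_on (cball 0 (\<rho> m)) (\<lambda>x. cmod (poly p x))"
      by (intro continuous_on_norm continuous_on_poly continuous_on_id)
    ultimately obtain z where z: "z \<in> cball 0 (\<rho> m)" "\<And>x. x \<in> cball 0 (\<rho> m) \<Longrightarrow> cmod (poly p z) \<le> cmod (poly p x)"
      using continuous_attains_inf[of "cball 0 (\<rho> m)" "\<lambda>x. cmod (poly p x)"] by auto
    have "cmod (poly p z) < 1 / real (Suc k)" for k
    proof -
      obtain d where "cmod d < \<rho> m" "cmod (poly p d) < 1 / real (Suc k)" using m[of k] by auto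
      then show ?thesis using z(2)[of d] by auto
    qed
    then have "cmod (poly p z) = 0"
      by (metis nat_approx_posE norm_ge_zero order.asym order_le_less)
    then show "\<not> root_free r p" using z(1) \<rho>[of m] by (auto simp: root_free_def intro!: exI[of _ z])
  qed
  have pm: "(\<lambda>X. poly (charp n X) d) \<in> borel_measurable (msp n)" for d
    by (intro poly_charp_measurable cspace_component) auto
  have "{X \<in> space (msp n). \<not> root_free r (charp n X)}
      = (\<Union>m. \<Inter>k. \<Union>d\<in>{d\<in>D. cmod d < \<rho> m}. {X \<in> space (msp n). cmod (poly (charp n X) d) < 1 / real (Suc k)})"
    unfolding iff by (rule Set.set_eqI) (simp only: mem_Collect_eq UN_iff INT_iff, blast)
  also have "\<dots> \<in> sets (msp n)"
  proof -
    have meas: "{X \<in> space (msp n). cmod (poly (charp n X) d) < 1 / real (Suc k)} \<in> sets (msp n)" for d k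
      using pm[of d] by measurable
    have "countable {d\<in>D. cmod d < \<rho> m}" for m using D(1) by simp
    then have "(\<Union>d\<in>{d\<in>D. cmod d < \<rho> m}. {X \<in> space (msp n). cmod (poly (charp n X) d) < 1 / real (Suc k)}) \<in> sets (msp n)" for m k
      by (intro sets.countable_UN'' meas)
    then have "(\<Inter>k. \<Union>d\<in>{d\<in>D. cmod d < \<rho> m}. {X \<in> space (msp n). cmod (poly (charp n X) d) < 1 / real (Suc k)}) \<in> sets (msp n)" for m
      by (intro sets.countable_INT) auto
    then show ?thesis
      by (intro sets.countable_UN) auto
  qed
  finally have "space (msp n) - {X \<in> space (msp n). \<not> root_free r (charp n X)} \<in> sets (msp n)"
    by (rule sets.compl_sets)
  moreover have "space (msp n) - {X \<in> space (msp n). \<not> root_free r (charp n X)} = {X \<in> space (msp n). root_free r (charp n X)}"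
    by auto
  ultimately show ?thesis by simp
qed

lemma min_modulus_root_free:
  assumes A: "A \<in> carrier_mat n n" and n: "n \<ge> 1"
  shows "min_modulus A < r \<longleftrightarrow> \<not> root_free r (char_poly A)"
proof -
  have fin: "finite (cmod ` spectrum A)" using card_finite_spectrum(1)[OF A] by simp
  have ne: "cmod ` spectrum A \<noteq> {}" using spectrum_non_empty[OF A] n by auto
  show ?thesis
    unfolding min_modulus_def Min_less_iff[OF fin ne]
    using eigenvalue_root_char_poly[OF A] by (auto simp: spectrum_def root_free_def)
qed

text \<open>The normalised upper incomplete Gamma function, that is, Gamma(k + 1, r^2) / k!.\<close>

definition tail_ratio :: "real \<Rightarrow> nat \<Rightarrow> real" where
  "tail_ratio r k = radial_moment (indicator {r..}) k / (pi * fact k)"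

text \<open>The complementary event depends only on the characteristic polynomial and is a product
  of radial conditions on its roots. The powers of pi and N! cancel against
  \<open>vdm_mass N\<close>, one factor pi k! for each moment.\<close>

theorem ginibre_min_modulus:
  assumes g: "ginibre_matrix M N A" and N: "N \<ge> 1" and r: "r > 0"
  shows "measure M {\<omega> \<in> space M. min_modulus (A \<omega>) < r} = 1 - (\<Prod>k<N. tail_ratio r k)"
proof -
  let ?I = "{..<N} \<times> {..<N}"
  interpret prob_space M using g by (simp add: ginibre_matrix_def)
  define X where "X \<omega> = (\<lambda>p\<in>?I. A \<omega> $$ p)" for \<omega>
  have X: "X \<in> measurable M (msp N)" and dX: "distr M (msp N) X = density (msp N) (\<lambda>X. ennreal (1 / pi ^ (N * N)) * gauss ?I X)"
    using ginibre_distr[OF g N] by (simp_all add: X_def[abs_def])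
  let ?S = "{X \<in> space (msp N). root_free r (charp N X)}"
  have S[measurable]: "?S \<in> sets (msp N)" by (rule root_free_measurable[OF r])
  have AX: "root_free r (char_poly (A \<omega>)) \<longleftrightarrow> X \<omega> \<in> ?S" if "\<omega> \<in> space M" for \<omega>
  proof -
    have c: "A \<omega> \<in> carrier_mat N N" using g that by (simp add: ginibre_matrix_def)
    have "mat N N (X \<omega>) = A \<omega>" using c by (intro eq_matI) (auto simp: X_def)
    then show ?thesis using measurable_space[OF X that] by simp
  qed
  define H where "H p = (if root_free r p then 1 else 0 :: ennreal)" for p
  have HX: "H (charp N X) = indicator ?S X" if "X \<in> space (msp N)" for X
    using that by (auto simp: H_def)
  have Hm: "(\<lambda>X. H (charp N X)) \<in> borel_measurable (msp N)"
    by (subst measurable_cong[OF HX]) measurable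
  have Hroot: "H (root_poly N z) = (\<Prod>i<N. ennreal (indicator {r..} (cmod (z i))))" for z
  proof -
    have "root_free r (root_poly N z) \<longleftrightarrow> (\<forall>i<N. r \<le> cmod (z i))"
      by (auto simp: root_free_def root_poly_def poly_prod not_less prod_zero_iff)
    then show ?thesis
      by (auto simp: H_def indicator_def prod_zero_iff)
  qed
  have ev: "{\<omega> \<in> space M. min_modulus (A \<omega>) < r} = space M - (X -` ?S \<inter> space M)"
    using AX g N by (auto simp: ginibre_matrix_def min_modulus_root_free)
  have "emeasure M (X -` ?S \<inter> space M) = emeasure (distr M (msp N) X) ?S"
    by (rule emeasure_distr[OF X S, symmetric])
  also have "\<dots> = (\<integral>\<^sup>+ X. ennreal (1 / pi ^ (N * N)) * gauss ?I X * indicator ?S X \<partial>msp N)"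
    unfolding dX by (rule emeasure_density[OF _ S]) measurable
  also have "\<dots> = (\<integral>\<^sup>+ X. ennreal (1 / pi ^ (N * N)) * (gauss ?I X * H (charp N X)) \<partial>msp N)"
    by (intro nn_integral_cong) (simp add: HX mult.assoc)
  also have "\<dots> = ennreal (1 / pi ^ (N * N)) * (\<integral>\<^sup>+ X. gauss ?I X * H (charp N X) \<partial>msp N)"
    by (intro nn_integral_cmult borel_measurable_times_ennreal gauss_measurable Hm)
  also have "(\<integral>\<^sup>+ X. gauss ?I X * H (charp N X) \<partial>msp N) = ennreal (pi ^ (N * N) / vdm_mass N) * ennreal (fact N * (\<Prod>k<N. radial_moment (indicator {r..}) k))"
    unfolding ginibre_eigenvalue_density[OF Hm] Hroot
    by (subst nn_integral_radial_vandermonde) (auto simp: indicator_def)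
  also have "ennreal (1 / pi ^ (N * N)) * (ennreal (pi ^ (N * N) / vdm_mass N) * ennreal (fact N * (\<Prod>k<N. radial_moment (indicator {r..}) k)))
      = ennreal (\<Prod>k<N. tail_ratio r k)"
  proof -
    have nn: "radial_moment (indicator {r..}) k \<ge> 0" for k
      unfolding radial_moment_def by (intro Bochner_Integration.integral_nonneg) auto
    have "ennreal (1 / pi ^ (N * N)) * (ennreal (pi ^ (N * N) / vdm_mass N) * ennreal (fact N * (\<Prod>k<N. radial_moment (indicator {r..}) k)))
      = ennreal (1 / pi ^ (N * N) * (pi ^ (N * N) / vdm_mass N * (fact N * (\<Prod>k<N. radial_moment (indicator {r..}) k))))"
      using less_imp_le[OF vdm_mass_pos[of N]] nn by (simp add: ennreal_mult[symmetric] prod_nonneg)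
    also have "1 / pi ^ (N * N) * (pi ^ (N * N) / vdm_mass N * (fact N * (\<Prod>k<N. radial_moment (indicator {r..}) k))) = (\<Prod>k<N. tail_ratio r k)"
      by (simp add: vdm_mass_def tail_ratio_def prod_dividef)
    finally show ?thesis .
  qed
  finally have "measure M (X -` ?S \<inter> space M) = (\<Prod>k<N. tail_ratio r k)"
    unfolding measure_def
    by (simp add: prod_nonneg divide_nonneg_nonneg Bochner_Integration.integral_nonneg tail_ratio_def radial_moment_def)
  then show ?thesis
    unfolding ev using measurable_sets[OF X S] by (simp add: prob_compl)
qed

lemma tail_ratio_zero:
  assumes r: "r > 0"
  shows "tail_ratio r 0 = exp (- r\<^sup>2)"
proof -
  define f where "f z = indicator {r..} (cmod z) * exp (- (cmod z)\<^sup>2) * cmod z ^ (2 * 0)" for z :: complex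
  have f0: "f z \<ge> 0" for z by (simp add: f_def)
  have fm[measurable]: "f \<in> borel_measurable borel" unfolding f_def[abs_def] by measurable
  have "(\<integral>\<^sup>+ z. ennreal (f z) \<partial>lborel) = (\<integral>\<^sup>+ z. (\<lambda>t. ennreal (indicator {r..} (sqrt t) * exp (- t))) ((cmod z)\<^sup>2) \<partial>lborel)"
    by (simp add: f_def)
  also have "\<dots> = ennreal pi * (\<integral>\<^sup>+ t. ennreal (indicator {r..} (sqrt t) * exp (- t)) * indicator {0..} t \<partial>lborel)"
    by (rule nn_integral_complex_radial) measurable
  also have "(\<integral>\<^sup>+ t. ennreal (indicator {r..} (sqrt t) * exp (- t)) * indicator {0..} t \<partial>lborel)
      = (\<integral>\<^sup>+ t. ennreal (exp (- t)) * indicator {r\<^sup>2..} t \<partial>lborel)"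
  proof (rule nn_integral_cong)
    fix t :: real
    have "t \<ge> 0 \<and> r \<le> sqrt t \<longleftrightarrow> r\<^sup>2 \<le> t"
      using r by (auto simp: real_le_rsqrt sqrt_le_D intro: order_trans[of _ "r\<^sup>2"])
         (metis abs_of_pos real_sqrt_abs real_sqrt_le_iff real_sqrt_le_mono real_sqrt_pow2 power_mono less_imp_le)
    then show "ennreal (indicator {r..} (sqrt t) * exp (- t)) * indicator {0..} t = ennreal (exp (- t)) * indicator {r\<^sup>2..} t"
      by (auto simp: indicator_def)
  qed
  also have "\<dots> = (\<integral>\<^sup>+ s. ennreal (exp (- (r\<^sup>2 + s))) * indicator {r\<^sup>2..} (r\<^sup>2 + s) \<partial>lborel)"
    by (subst nn_integral_real_affine[where c = 1 and t = "r\<^sup>2"]) auto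
  also have "\<dots> = (\<integral>\<^sup>+ s. ennreal (exp (- r\<^sup>2)) * (ennreal (exp (- s)) * indicator {0..} s) \<partial>lborel)"
    by (intro nn_integral_cong) (auto simp: indicator_def exp_diff exp_minus divide_inverse simp flip: ennreal_mult exp_add)
  also have "\<dots> = ennreal (exp (- r\<^sup>2)) * (\<integral>\<^sup>+ s. ennreal (exp (- s)) * indicator {0..} s \<partial>lborel)"
    by (rule nn_integral_cmult) measurable
  also have "(\<integral>\<^sup>+ s. ennreal (exp (- s)) * indicator {0..} s \<partial>lborel) = 1"
    using nn_intergal_power_times_exp_Ici[of 0] by simp
  finally have f: "(\<integral>\<^sup>+ z. ennreal (f z) \<partial>lborel) = ennreal (pi * exp (- r\<^sup>2))"
    by (simp flip: ennreal_mult)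
  have "integral\<^sup>L lborel f = pi * exp (- r\<^sup>2)"
    using nn_integral_eq_integrable[of f lborel "pi * exp (- r\<^sup>2)"] f0 f by simp
  then show ?thesis by (simp add: tail_ratio_def radial_moment_def f_def[abs_def])
qed

text \<open>For the last bound, the missing part is the integral over the disc of radius r, where
  the integrand is at most r^(2k) and the area is pi r^2; division by pi k! follows.\<close>

lemma tail_ratio_bounds:
  assumes r: "r > 0"
  shows "tail_ratio r k \<ge> 0" "tail_ratio r k \<le> 1" "1 - tail_ratio r k \<le> r ^ (2 * k + 2) / fact k"
proof -
  define f where "f z = exp (- (cmod z)\<^sup>2) * cmod z ^ (2 * k)" for z :: complex
  have f0: "f z \<ge> 0" for z by (simp add: f_def)
  have fm[measurable]: "f \<in> borel_measurable borel" unfolding f_def[abs_def] by measurable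
  have "(\<integral>\<^sup>+ z. ennreal (f z) \<partial>lborel) = ennreal (pi * fact k)"
    using nn_integral_complex_gauss[of 1 k] by (simp add: f_def mult.commute)
  then have fi: "integrable lborel f"
    by (intro integrableI_nonneg) (simp_all add: f0)
  have If: "integral\<^sup>L lborel f = pi * fact k"
    using radial_moment_one[of k] by (simp add: radial_moment_def f_def[abs_def])
  have o: "integrable lborel (\<lambda>z. indicator {r..} (cmod z) * f z)"
    by (rule Bochner_Integration.integrable_bound[OF fi]) (auto simp: indicator_def f0)
  have m: "radial_moment (indicator {r..}) k = (LINT z|lborel. indicator {r..} (cmod z) * f z)"
    by (simp add: radial_moment_def f_def mult.assoc)
  have m0: "radial_moment (indicator {r..}) k \<ge> 0"
    unfolding m by (intro Bochner_Integration.integral_nonneg) (auto simp: f0)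
  then show "tail_ratio r k \<ge> 0" by (simp add: tail_ratio_def)
  have "radial_moment (indicator {r..}) k \<le> pi * fact k"
    unfolding m If[symmetric] using o fi by (rule integral_mono) (auto simp: indicator_def f0)
  then show "tail_ratio r k \<le> 1" by (simp add: tail_ratio_def)
  have "pi * fact k - radial_moment (indicator {r..}) k = (LINT z|lborel. f z - indicator {r..} (cmod z) * f z)"
    unfolding m If[symmetric] using o fi by simp
  also have "\<dots> \<le> (LINT z|lborel. r ^ (2 * k) * indicator (ball 0 r) (z::complex))"
  proof (rule integral_mono)
    show "integrable lborel (\<lambda>z. f z - indicator {r..} (cmod z) * f z)" using o fi by simp
    show "integrable lborel (\<lambda>z::complex. r ^ (2 * k) * indicator (ball 0 r) z)"
      by (intro integrable_mult_right integrable_real_indicator) (auto simp: emeasure_ball r less_imp_le)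
    fix z :: complex
    show "f z - indicator {r..} (cmod z) * f z \<le> r ^ (2 * k) * indicator (ball 0 r) z"
    proof (cases "cmod z < r")
      case True
      have "f z \<le> 1 * r ^ (2 * k)"
        unfolding f_def using True by (intro mult_mono power_mono) auto
      then show ?thesis using True by simp
    qed simp
  qed
  also have "\<dots> = r ^ (2 * k) * (pi * r\<^sup>2)"
    using r by (simp add: content_ball unit_ball_vol_2)
  finally have "pi * fact k - radial_moment (indicator {r..}) k \<le> pi * r ^ (2 * k + 2)"
    by (simp add: power_add mult_ac power2_eq_square)
  then have "(pi * fact k - radial_moment (indicator {r..}) k) / (pi * fact k) \<le> pi * r ^ (2 * k + 2) / (pi * fact k)"
    by (intro divide_right_mono) auto
  then show "1 - tail_ratio r k \<le> r ^ (2 * k + 2) / fact k"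
    by (simp add: tail_ratio_def diff_divide_distrib)
qed

text \<open>The factor k = 0 is exactly exp (-r^2), so 1 - E r is the infinite product over k >= 1.
  Its partial products decrease and stay nonnegative, which gives the limit for every r > 0; only
  the bound on \<open>E\<close> uses r < 1.\<close>

theorem theorem3:
  fixes M :: "nat \<Rightarrow> 'a measure"
    and A :: "nat \<Rightarrow> 'a \<Rightarrow> complex mat"
  assumes "\<And>N. N \<ge> 1 \<Longrightarrow> ginibre_matrix (M N) N (A N)"
  shows "\<exists>E :: real \<Rightarrow> real. E \<in> O[at_right 0](\<lambda>r. r ^ 4) \<and>
    (\<forall>\<^sub>F r in at_right 0.
       (\<lambda>N. measure (M N) {\<omega> \<in> space (M N). min_modulus (A N \<omega>) < r})
         \<longlonglongrightarrow> 1 - exp (- r\<^sup>2) * (1 - E r))"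
proof -
  define Q where "Q r N = (\<Prod>k<N. tail_ratio r (Suc k))" for r N
  define E where "E r = 1 - lim (Q r)" for r
  have Q01: "0 \<le> Q r N \<and> Q r N \<le> 1" if "r > 0" for r N
    unfolding Q_def using tail_ratio_bounds(1,2)[OF that] by (auto intro!: prod_nonneg prod_le_1)
  have Qlim: "Q r \<longlonglongrightarrow> lim (Q r)" if r: "r > 0" for r
  proof -
    have "decseq (Q r)"
    proof (rule decseq_SucI)
      show "Q r (Suc N) \<le> Q r N" for N
        using Q01[OF r, of N] tail_ratio_bounds(2)[OF r] by (simp add: Q_def mult_left_le)
    qed
    then have "convergent (Q r)"
      using Q01[OF r] by (intro Bseq_monoseq_convergent decseq_imp_monoseq BseqI'[where K = 1]) auto
    then show ?thesis by (simp add: convergent_LIMSEQ_iff)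
  qed
  have Qlow: "1 - exp 1 * r ^ 4 \<le> Q r N" if r: "0 < r" "r < 1" for r N
  proof -
    \<comment> \<open>The Weierstrass product inequality: for factors in [0, 1], one minus the
      product is at most the sum of the deviations of the factors from 1.\<close>
    have "1 - (\<Sum>k<N. 1 - tail_ratio r (Suc k)) \<le> Q r N"
    proof (induction N)
      case (Suc N)
      let ?t = "tail_ratio r (Suc N)"
      have "Q r N * (1 - ?t) \<le> 1 * (1 - ?t)"
        using Q01[OF r(1), of N] tail_ratio_bounds(2)[OF r(1), of "Suc N"] by (intro mult_right_mono) auto
      then show ?case using Suc by (simp add: Q_def algebra_simps)
    qed (simp add: Q_def)
    moreover have "(\<Sum>k<N. 1 - tail_ratio r (Suc k)) \<le> (\<Sum>k<N. r ^ 4 * (1 / fact k))"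
    proof (rule sum_mono)
      fix k
      \<comment> \<open>The exponent is 2k + 4, at least 4, which is the source of the order r^4 for
        r < 1; relaxing (k + 1)! to k! lets the sum be bounded by the series of exp 1.\<close>
      have "1 - tail_ratio r (Suc k) \<le> r ^ (2 * Suc k + 2) / fact (Suc k)"
        by (rule tail_ratio_bounds(3)[OF r(1)])
      also have "\<dots> \<le> r ^ 4 / fact k"
        using r by (intro frac_le power_decreasing fact_mono) auto
      finally show "1 - tail_ratio r (Suc k) \<le> r ^ 4 * (1 / fact k)" by simp
    qed
    moreover have "(\<Sum>k<N. r ^ 4 * (1 / fact k)) \<le> r ^ 4 * exp 1"
    proof -
      have "(\<lambda>k. 1 / fact k) sums exp (1::real)"
        using exp_converges[of "1::real"] by (simp add: divide_inverse)
      then have "(\<Sum>k<N. 1 / fact k) \<le> exp (1::real)"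
        by (metis (no_types, lifting) divide_nonneg_nonneg fact_ge_zero sum_le_suminf sums_iff finite_lessThan zero_le_one)
      then show ?thesis
        unfolding sum_distrib_left[symmetric] using r by (intro mult_left_mono) auto
    qed
    ultimately show ?thesis by (simp add: mult.commute)
  qed
  have "E \<in> O[at_right 0](\<lambda>r. r ^ 4)"
  proof (rule bigoI[where c = "exp 1"])
    have "norm (E r) \<le> exp 1 * norm (r ^ 4)" if r: "0 < r" "r < 1" for r
    proof -
      have "lim (Q r) \<le> 1" using Qlim[OF r(1)] by (rule LIMSEQ_le_const2) (use Q01[OF r(1)] in auto)
      moreover have "1 - exp 1 * r ^ 4 \<le> lim (Q r)"
        using Qlim[OF r(1)] by (rule LIMSEQ_le_const) (use Qlow[OF r] in auto)
      ultimately show ?thesis by (simp add: E_def)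
    qed
    then show "\<forall>\<^sub>F r in at_right 0. norm (E r) \<le> exp 1 * norm (r ^ 4)"
      unfolding eventually_at_right_field by (intro exI[of _ 1]) auto
  qed
  moreover have "(\<lambda>N. measure (M N) {\<omega> \<in> space (M N). min_modulus (A N \<omega>) < r}) \<longlonglongrightarrow> 1 - exp (- r\<^sup>2) * (1 - E r)"
    if r: "r > 0" for r
  proof -
    \<comment> \<open>Shifting the size by one keeps it positive and leaves exactly the
      \<open>N\<close> factors of \<open>Q r N\<close> after the factor k = 0 is split off.\<close>
    have "measure (M (Suc N)) {\<omega> \<in> space (M (Suc N)). min_modulus (A (Suc N) \<omega>) < r} = 1 - exp (- r\<^sup>2) * Q r N" for N
      using ginibre_min_modulus[OF assms _ r, of "Suc N"]
      by (simp add: prod.lessThan_Suc_shift tail_ratio_zero[OF r] Q_def del: prod.lessThan_Suc)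
    moreover have "(\<lambda>N. 1 - exp (- r\<^sup>2) * Q r N) \<longlonglongrightarrow> 1 - exp (- r\<^sup>2) * (1 - E r)"
      using Qlim[OF r] by (auto intro!: tendsto_intros simp: E_def)
    ultimately show ?thesis by (subst filterlim_sequentially_Suc[symmetric]) simp
  qed
  then have "\<forall>\<^sub>F r in at_right 0. (\<lambda>N. measure (M N) {\<omega> \<in> space (M N). min_modulus (A N \<omega>) < r}) \<longlonglongrightarrow> 1 - exp (- r\<^sup>2) * (1 - E r)"
    unfolding eventually_at_right_field by (intro exI[of _ 1]) auto
  ultimately show ?thesis by blast
qed

end
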